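(* The class of all mapping tori of the form $F_m\rtimes_{\varphi}\langle t\rangle$, with $m\geq 1$ and $\varphi\in\mathrm{Aut}(F_m)$ such that $[\varphi]\in\mathrm{Out}(F_m)$ is of finite order, has congruences effectively separating torsion.
   Context: $F_m$ is the free group with basis $x_1,\dots,x_m$. For $\varphi\in\mathrm{Aut}(F_m)$, the mapping torus of $\varphi$ is $F_m\rtimes_\varphi\langle t\rangle=\langle x_1,\dots,x_m,t\mid t^{-1}x_it=\varphi(x_i)\ (1\le i\le m)\rangle$. $[\varphi]$ is the class of $\varphi$ in $\mathrm{Out}(F_m)=\mathrm{Aut}(F_m)/\mathrm{Inn}(F_m)$. A subgroup is characteristic if it is preserved by all automorphisms of the ambient group. A group $G$ has congruences separating torsion if it has a characteristic subgroup $G_0$ of finite index such that the morphism $\mathrm{Out}(G)\to\mathrm{Out}(G/G_0)$ induced by the quotient $G\to G/G_0$ has torsion-free kernel. A class of groups $\mathcal H$ has congruences effectively separating torsion if there is an algorithm that takes the presentation of a group $G$ in $\mathcal H$ and outputs one such $G_0$. *)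

theory Defs
  imports "HOL-Algebra.Bij" "HOL-Algebra.Coset" "HOL-Algebra.Generated_Groups"
    "HOL-Library.Nat_Bijection"
begin

section \<open>Free groups, group presentations, mapping tori\<close>

text \<open>The letter \<open>(i, False)\<close> is the generator of index \<open>i\<close> (counting from \<open>0\<close>), and
  \<open>(i, True)\<close> is its formal inverse.\<close>

type_synonym letter = "nat \<times> bool"
type_synonym word = "letter list"

definition inv_letter :: "letter \<Rightarrow> letter" where
  "inv_letter a = (fst a, \<not> snd a)"

definition inv_word :: "word \<Rightarrow> word" where
  "inv_word w = rev (map inv_letter w)"

definition words :: "nat \<Rightarrow> word set" where
  "words n = {w. \<forall>a\<in>set w. fst a < n}"

definition reduced :: "word \<Rightarrow> bool" where
  "reduced w \<longleftrightarrow> successively (\<lambda>a b. b \<noteq> inv_letter a) w"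

fun cons_reduce :: "letter \<Rightarrow> word \<Rightarrow> word" where
  "cons_reduce a [] = [a]"
| "cons_reduce a (b # w) = (if b = inv_letter a then w else a # b # w)"

definition reduce :: "word \<Rightarrow> word" where
  "reduce w = foldr cons_reduce w []"

definition free_group :: "nat \<Rightarrow> word monoid" where
  "free_group n =
    \<lparr>carrier = {w \<in> words n. reduced w}, mult = \<lambda>u v. reduce (u @ v), one = []\<rparr>"

definition normal_closure :: "('a, 'b) monoid_scheme \<Rightarrow> 'a set \<Rightarrow> 'a set" where
  "normal_closure G S = \<Inter>{N. N \<lhd> G \<and> S \<subseteq> N}"

text \<open>A finite presentation is a number of generators and a list of relators. Relators (and all
  other input and output words) need not be reduced.\<close>

type_synonym presentation = "nat \<times> word list"

definition presentations :: "presentation set" where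
  "presentations = {(n, rs). set rs \<subseteq> words n}"

definition relators_closure :: "presentation \<Rightarrow> word set" where
  "relators_closure P = normal_closure (free_group (fst P)) (reduce ` set (snd P))"

definition presented_group :: "presentation \<Rightarrow> word set monoid" where
  "presented_group P = free_group (fst P) Mod relators_closure P"

definition word_elem :: "presentation \<Rightarrow> word \<Rightarrow> word set" where
  "word_elem P w = relators_closure P #>\<^bsub>free_group (fst P)\<^esub> reduce w"

text \<open>The generators of index \<open>0, \<dots>, m - 1\<close> are \<open>x\<^sub>1, \<dots>, x\<^sub>m\<close> and the generator of index \<open>m\<close> is \<open>t\<close>.
  The relation \<open>t\<^sup>-\<^sup>1 x\<^sub>i t = \<phi>(x\<^sub>i)\<close> is written as the relator \<open>t\<^sup>-\<^sup>1 x\<^sub>i t \<phi>(x\<^sub>i)\<^sup>-\<^sup>1\<close>.\<close>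

definition mapping_torus :: "nat \<Rightarrow> (word \<Rightarrow> word) \<Rightarrow> word set monoid" where
  "mapping_torus m \<phi> = presented_group
    (Suc m, map (\<lambda>i. [(m, True), (i, False), (m, False)] @ inv_word (\<phi> [(i, False)])) [0..<m])"


section \<open>Outer automorphisms and congruences separating torsion\<close>

definition inner_aut :: "('a, 'b) monoid_scheme \<Rightarrow> 'a \<Rightarrow> 'a \<Rightarrow> 'a" where
  "inner_aut G g = (\<lambda>x\<in>carrier G. g \<otimes>\<^bsub>G\<^esub> x \<otimes>\<^bsub>G\<^esub> inv\<^bsub>G\<^esub> g)"

definition Inn :: "('a, 'b) monoid_scheme \<Rightarrow> ('a \<Rightarrow> 'a) set" where
  "Inn G = inner_aut G ` carrier G"

definition Out :: "('a, 'b) monoid_scheme \<Rightarrow> ('a \<Rightarrow> 'a) set monoid" where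
  "Out G = AutoGroup G Mod Inn G"

definition out_class :: "('a, 'b) monoid_scheme \<Rightarrow> ('a \<Rightarrow> 'a) \<Rightarrow> ('a \<Rightarrow> 'a) set" where
  "out_class G \<alpha> = Inn G #>\<^bsub>AutoGroup G\<^esub> \<alpha>"

definition finite_order :: "('a, 'b) monoid_scheme \<Rightarrow> 'a \<Rightarrow> bool" where
  "finite_order G x \<longleftrightarrow> (\<exists>k::nat. k > 0 \<and> x [^]\<^bsub>G\<^esub> k = \<one>\<^bsub>G\<^esub>)"

definition torsion_free :: "('a, 'b) monoid_scheme \<Rightarrow> bool" where
  "torsion_free G \<longleftrightarrow> (\<forall>x\<in>carrier G. finite_order G x \<longrightarrow> x = \<one>\<^bsub>G\<^esub>)"

definition characteristic :: "'a set \<Rightarrow> ('a, 'b) monoid_scheme \<Rightarrow> bool" where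
  "characteristic N G \<longleftrightarrow> subgroup N G \<and> (\<forall>\<alpha>\<in>auto G. \<alpha> ` N = N)"

text \<open>The automorphism of \<open>G/N\<close> induced by \<open>\<alpha>\<close> maps the coset \<open>N g\<close> to \<open>N \<alpha>(g)\<close>, which is
  the image of the set \<open>N g\<close> under \<open>\<alpha>\<close> when \<open>N\<close> is characteristic.\<close>

definition induced_aut ::
  "('a, 'b) monoid_scheme \<Rightarrow> 'a set \<Rightarrow> ('a \<Rightarrow> 'a) \<Rightarrow> 'a set \<Rightarrow> 'a set" where
  "induced_aut G N \<alpha> = (\<lambda>C\<in>carrier (G Mod N). \<alpha> ` C)"

text \<open>Elements of \<open>Out G\<close> are cosets of \<open>Inn G\<close>, and the automorphisms induced by the members of
  the class of \<open>\<alpha>\<close> form the whole class of \<open>induced_aut G N \<alpha>\<close>; see \<open>induced_out_class\<close> below.\<close>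

definition induced_out ::
  "('a, 'b) monoid_scheme \<Rightarrow> 'a set \<Rightarrow> ('a \<Rightarrow> 'a) set \<Rightarrow> ('a set \<Rightarrow> 'a set) set" where
  "induced_out G N c = induced_aut G N ` c"

definition congruence_separates_torsion :: "('a, 'b) monoid_scheme \<Rightarrow> 'a set \<Rightarrow> bool" where
  "congruence_separates_torsion G N \<longleftrightarrow>
     characteristic N G \<and> finite (rcosets\<^bsub>G\<^esub> N) \<and>
     torsion_free ((Out G)\<lparr>carrier := kernel (Out G) (Out (G Mod N)) (induced_out G N)\<rparr>)"


section \<open>Algorithms\<close>

text \<open>Algorithms are partial recursive functions: \<open>rec_eval p xs y\<close> states that the program \<open>p\<close>
  halts on the arguments \<open>xs\<close> with result \<open>y\<close>.\<close>

datatype recf =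
    Zero
  | Succ
  | Proj nat
  | Comp recf "recf list"
  | PrimRec recf recf
  | Mu recf

inductive rec_eval :: "recf \<Rightarrow> nat list \<Rightarrow> nat \<Rightarrow> bool" where
  zero: "rec_eval Zero xs 0"
| succ: "rec_eval Succ [x] (Suc x)"
| proj: "i < length xs \<Longrightarrow> rec_eval (Proj i) xs (xs ! i)"
| comp: "list_all2 (\<lambda>g y. rec_eval g xs y) gs ys \<Longrightarrow> rec_eval f ys z \<Longrightarrow>
    rec_eval (Comp f gs) xs z"
| primrec_0: "rec_eval f xs y \<Longrightarrow> rec_eval (PrimRec f g) (0 # xs) y"
| primrec_Suc: "rec_eval (PrimRec f g) (k # xs) r \<Longrightarrow> rec_eval g (k # r # xs) y \<Longrightarrow>
    rec_eval (PrimRec f g) (Suc k # xs) y"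
| mu: "rec_eval f (k # xs) 0 \<Longrightarrow> (\<And>i. i < k \<Longrightarrow> \<exists>y. rec_eval f (i # xs) (Suc y)) \<Longrightarrow>
    rec_eval (Mu f) xs k"

definition encode_letter :: "letter \<Rightarrow> nat" where
  "encode_letter a = 2 * fst a + of_bool (snd a)"

definition encode_word :: "word \<Rightarrow> nat" where
  "encode_word w = list_encode (map encode_letter w)"

definition encode_words :: "word list \<Rightarrow> nat" where
  "encode_words ws = list_encode (map encode_word ws)"

definition encode_presentation :: "presentation \<Rightarrow> nat" where
  "encode_presentation P = prod_encode (fst P, encode_words (snd P))"

text \<open>The input of the algorithm is an arbitrary finite presentation of a group isomorphic to a
  member of the class (nothing is required on other inputs). The output is a finite list of words
  in the generators of the presentation which generates the subgroup.\<close>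

definition congruences_effectively_separating_torsion :: "'a monoid set \<Rightarrow> bool" where
  "congruences_effectively_separating_torsion \<H> \<longleftrightarrow>
     (\<exists>p. \<forall>P\<in>presentations. (\<exists>G\<in>\<H>. presented_group P \<cong> G) \<longrightarrow>
       (\<exists>ws. set ws \<subseteq> words (fst P) \<and>
         rec_eval p [encode_presentation P] (encode_words ws) \<and>
         congruence_separates_torsion (presented_group P)
           (generate (presented_group P) (word_elem P ` set ws))))"


section \<open>Well-definedness\<close>

lemma rec_eval_deterministic: "rec_eval p xs y \<Longrightarrow> rec_eval p xs z \<Longrightarrow> y = z"
proof (induction arbitrary: z rule: rec_eval.induct)
  case (primrec_0 f xs y g)
  from primrec_0.prems have "rec_eval f xs z" by (auto elim: rec_eval.cases)
  with primrec_0.IH show ?case by blast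
next
  case (primrec_Suc f g k xs r y)
  from primrec_Suc.prems obtain r' where
    "rec_eval (PrimRec f g) (k # xs) r'" "rec_eval g (k # r' # xs) z"
    by (auto elim: rec_eval.cases)
  with primrec_Suc.IH show ?case by blast
next
  case (comp xs gs ys f z')
  from comp.prems obtain ys' where ys':
    "list_all2 (\<lambda>g y. rec_eval g xs y) gs ys'" "rec_eval f ys' z"
    by (auto elim: rec_eval.cases)
  have "ys = ys'"
    using comp.IH(1) ys'(1) by (auto simp: list_all2_conv_all_nth intro!: nth_equalityI)
  with comp.IH ys' show ?case by blast
next
  case (mu f k xs)
  from mu.prems have z: "rec_eval f (z # xs) 0" "\<And>i. i < z \<Longrightarrow> \<exists>y. rec_eval f (i # xs) (Suc y)"
    by (auto elim: rec_eval.cases)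
  show ?case
    using mu.IH z by (metis linorder_neqE_nat nat.distinct(1))
qed (auto elim: rec_eval.cases)

lemma inv_letter_inv_letter [simp]: "inv_letter (inv_letter a) = a"
  by (simp add: inv_letter_def)

lemma inv_letter_neq [simp]: "inv_letter a \<noteq> a"
  by (cases a) (simp add: inv_letter_def)

lemma fst_inv_letter [simp]: "fst (inv_letter a) = fst a"
  by (simp add: inv_letter_def)

lemma reduced_cons_reduce: "reduced w \<Longrightarrow> reduced (cons_reduce a w)"
  by (cases w) (auto simp: reduced_def successively_Cons)

lemma reduced_foldr: "reduced w \<Longrightarrow> reduced (foldr cons_reduce u w)"
  by (induction u) (auto intro: reduced_cons_reduce)

lemma reduced_reduce: "reduced (reduce w)"
  unfolding reduce_def by (rule reduced_foldr) (simp add: reduced_def)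

lemma reduce_reduced: "reduced w \<Longrightarrow> reduce w = w"
proof (induction w)
  case (Cons a w)
  then have "reduce w = w" by (auto simp: reduced_def successively_Cons)
  then have "reduce (a # w) = cons_reduce a w" by (simp add: reduce_def)
  also have "\<dots> = a # w" using Cons.prems by (cases w) (auto simp: reduced_def)
  finally show ?case .
qed (simp add: reduce_def)

lemma cons_reduce_inverse: "reduced w \<Longrightarrow> cons_reduce a (cons_reduce (inv_letter a) w) = w"
proof (cases w)
  case (Cons b v)
  assume "reduced w"
  with Cons show ?thesis by (cases v) (auto simp: reduced_def)
qed simp

lemma foldr_cons_reduce:
  "reduced w \<Longrightarrow> foldr cons_reduce (cons_reduce a u) w = cons_reduce a (foldr cons_reduce u w)"
  using cons_reduce_inverse[of "foldr cons_reduce (tl u) w" a]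
  by (cases u) (auto simp: reduced_foldr)

lemma foldr_reduce: "reduced w \<Longrightarrow> foldr cons_reduce (reduce u) w = foldr cons_reduce u w"
  by (induction u) (simp_all add: reduce_def foldr_cons_reduce)

lemma reduce_append: "reduce (u @ v) = foldr cons_reduce u (reduce v)"
  by (simp add: reduce_def)

lemma reduce_append_left: "reduce (reduce u @ v) = reduce (u @ v)"
  by (simp add: reduce_append foldr_reduce reduced_reduce)

lemma reduce_append_right: "reduce (u @ reduce v) = reduce (u @ v)"
  by (simp add: reduce_append reduce_reduced reduced_reduce)

lemma set_cons_reduce: "set (cons_reduce a w) \<subseteq> insert a (set w)"
  by (cases w) auto

lemma set_reduce: "set (reduce w) \<subseteq> set w"
proof (induction w)
  case (Cons a w)
  then show ?case using set_cons_reduce[of a "reduce w"] by (auto simp: reduce_def)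
qed (simp add: reduce_def)

lemma reduce_inv_word: "reduce (inv_word w @ w) = []"
proof (induction w)
  case (Cons a w)
  have "reduce (inv_word (a # w) @ a # w) = reduce (inv_word w @ reduce ([inv_letter a, a] @ w))"
    by (simp add: inv_word_def reduce_append_right)
  also have "reduce ([inv_letter a, a] @ w) = reduce w"
    using cons_reduce_inverse[OF reduced_reduce, of "inv_letter a" w]
    by (simp add: reduce_def)
  finally show ?case by (simp add: reduce_append_right Cons)
qed (simp add: inv_word_def reduce_def)

lemma group_free_group: "group (free_group n)"
proof (rule groupI)
  fix x assume x: "x \<in> carrier (free_group n)"
  show "\<exists>y\<in>carrier (free_group n). y \<otimes>\<^bsub>free_group n\<^esub> x = \<one>\<^bsub>free_group n\<^esub>"
  proof
    show "reduce (inv_word x) \<otimes>\<^bsub>free_group n\<^esub> x = \<one>\<^bsub>free_group n\<^esub>"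
      by (simp add: free_group_def reduce_append_left reduce_inv_word)
    show "reduce (inv_word x) \<in> carrier (free_group n)"
      using x set_reduce[of "inv_word x"]
      by (force simp: free_group_def words_def reduced_reduce inv_word_def)
  qed
next
  fix x y assume "x \<in> carrier (free_group n)" "y \<in> carrier (free_group n)"
  then show "x \<otimes>\<^bsub>free_group n\<^esub> y \<in> carrier (free_group n)"
    using set_reduce[of "x @ y"] by (fastforce simp: free_group_def words_def reduced_reduce)
qed (auto simp: free_group_def reduce_append_left reduce_append_right reduce_reduced words_def
       reduced_def)

lemma normal_normal_closure:
  assumes "group G" "S \<subseteq> carrier G"
  shows "normal_closure G S \<lhd> G"
proof -
  interpret group G by fact
  let ?C = "{N. N \<lhd> G \<and> S \<subseteq> N}"
  have ne: "?C \<noteq> {}"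
    using assms(2) normal_invI[OF subgroup_self] by blast
  have "subgroup (\<Inter>?C) G"
    by (rule subgroups_Inter[OF _ ne]) (auto dest: normal_imp_subgroup)
  then show ?thesis
    unfolding normal_closure_def
    by (rule normal_invI) (auto intro: normal.inv_op_closed2)
qed

lemma group_presented_group:
  assumes "P \<in> presentations"
  shows "group (presented_group P)"
proof -
  have "reduce ` set (snd P) \<subseteq> carrier (free_group (fst P))"
    using assms set_reduce
    by (fastforce simp: presentations_def free_group_def words_def reduced_reduce)
  then show ?thesis
    unfolding presented_group_def relators_closure_def
    by (intro normal.factorgroup_is_group normal_normal_closure group_free_group)
qed

lemma (in group) inner_aut_in_auto:
  assumes g: "g \<in> carrier G"
  shows "inner_aut G g \<in> auto G"
proof -
  have cancel: "g \<otimes> (inv g \<otimes> x) = x" "inv g \<otimes> (g \<otimes> x) = x" if "x \<in> carrier G" for x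
    using g that by (simp_all add: m_assoc[symmetric])
  have "bij_betw (inner_aut G g) (carrier G) (carrier G)"
    by (rule bij_betw_byWitness[where f' = "inner_aut G (inv g)"])
      (use g in \<open>auto simp: inner_aut_def m_assoc cancel\<close>)
  moreover have "inner_aut G g \<in> hom G G"
    using g by (auto simp: inner_aut_def hom_def m_assoc cancel)
  ultimately show ?thesis
    by (simp add: auto_def Bij_def inner_aut_def)
qed

lemma (in group) characteristic_normal:
  assumes "characteristic N G"
  shows "N \<lhd> G"
proof (rule normal_invI)
  show sub: "subgroup N G" using assms by (simp add: characteristic_def)
  fix g h assume gh: "g \<in> carrier G" "h \<in> N"
  then have "inner_aut G g h \<in> N"
    using assms inner_aut_in_auto[of g] unfolding characteristic_def by blast
  then show "g \<otimes> h \<otimes> inv g \<in> N"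
    using subgroup.mem_carrier[OF sub gh(2)] by (simp add: inner_aut_def)
qed

lemma (in group) image_coset:
  assumes "characteristic N G" "\<alpha> \<in> auto G" "x \<in> carrier G"
  shows "\<alpha> ` (N #> x) = N #> \<alpha> x"
proof -
  have sub: "N \<subseteq> carrier G" and im: "\<alpha> ` N = N"
    using assms subgroup.subset by (auto simp: characteristic_def)
  have "\<alpha> ` (N #> x) = (\<lambda>h. \<alpha> (h \<otimes> x)) ` N"
    by (auto simp: r_coset_def)
  also have "\<dots> = (\<lambda>h. \<alpha> h \<otimes> \<alpha> x) ` N"
    using assms(2,3) sub by (intro image_cong) (auto simp: auto_def hom_def)
  also have "\<dots> = (\<lambda>h. h \<otimes> \<alpha> x) ` (\<alpha> ` N)"
    by (simp only: image_image)
  also have "\<dots> = N #> \<alpha> x"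
    unfolding im by (auto simp: r_coset_def)
  finally show ?thesis .
qed

lemma (in group) induced_aut_in_auto:
  assumes N: "characteristic N G" and \<alpha>: "\<alpha> \<in> auto G"
  shows "induced_aut G N \<alpha> \<in> auto (G Mod N)"
proof -
  interpret N: normal N G by (rule characteristic_normal[OF N])
  have bij: "bij_betw \<alpha> (carrier G) (carrier G)" and hom: "\<alpha> \<in> hom G G"
    using \<alpha> by (auto simp: auto_def Bij_def)
  have cl: "\<alpha> x \<in> carrier G" if "x \<in> carrier G" for x
    using hom that by (auto simp: hom_def)
  have val: "induced_aut G N \<alpha> (N #> x) = N #> \<alpha> x" if "x \<in> carrier G" for x
    using image_coset[OF N \<alpha> that] that by (auto simp: induced_aut_def carrier_FactGroup)
  have "induced_aut G N \<alpha> ` carrier (G Mod N) = (\<lambda>x. N #> x) ` \<alpha> ` carrier G"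
    by (auto simp: carrier_FactGroup image_image val)
  also have "\<dots> = carrier (G Mod N)"
    using bij by (simp add: bij_betw_def carrier_FactGroup)
  finally have surj: "induced_aut G N \<alpha> ` carrier (G Mod N) = carrier (G Mod N)" .
  have "inj_on (induced_aut G N \<alpha>) (carrier (G Mod N))"
  proof (rule inj_onI)
    fix C D assume CD: "C \<in> carrier (G Mod N)" "D \<in> carrier (G Mod N)"
      and eq: "induced_aut G N \<alpha> C = induced_aut G N \<alpha> D"
    have "C \<subseteq> carrier G" "D \<subseteq> carrier G"
      using CD r_coset_subset_G[OF N.subset] by (fastforce simp: carrier_FactGroup)+
    moreover have "\<alpha> ` C = \<alpha> ` D" using eq CD by (simp add: induced_aut_def)
    ultimately show "C = D"
      using bij inj_on_image_eq_iff unfolding bij_betw_def by blast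
  qed
  with surj have "induced_aut G N \<alpha> \<in> Bij (carrier (G Mod N))"
    by (simp add: Bij_def bij_betw_def induced_aut_def)
  moreover have "induced_aut G N \<alpha> \<in> hom (G Mod N) (G Mod N)"
  proof (rule homI)
    fix C D assume "C \<in> carrier (G Mod N)" "D \<in> carrier (G Mod N)"
    then obtain x y where "x \<in> carrier G" "C = N #> x" "y \<in> carrier G" "D = N #> y"
      by (auto simp: carrier_FactGroup)
    then show "induced_aut G N \<alpha> (C \<otimes>\<^bsub>G Mod N\<^esub> D) =
        induced_aut G N \<alpha> C \<otimes>\<^bsub>G Mod N\<^esub> induced_aut G N \<alpha> D"
      using hom by (simp add: N.rcos_sum val cl hom_mult)
  qed (use surj in auto)
  ultimately show ?thesis by (simp add: auto_def)
qed

lemma (in group) out_class_eq: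
  assumes "\<alpha> \<in> auto G"
  shows "out_class G \<alpha> = (\<lambda>g. compose (carrier G) (inner_aut G g) \<alpha>) ` carrier G"
  using assms inner_aut_in_auto
  by (auto simp: out_class_def Inn_def r_coset_def AutoGroup_def BijGroup_def auto_def)

lemma (in group) induced_out_class:
  assumes N: "characteristic N G" and \<alpha>: "\<alpha> \<in> auto G"
  shows "induced_out G N (out_class G \<alpha>) = out_class (G Mod N) (induced_aut G N \<alpha>)"
proof -
  interpret N: normal N G by (rule characteristic_normal[OF N])
  interpret Q: group "G Mod N" by (rule N.factorgroup_is_group)
  have cl: "\<alpha> x \<in> carrier G" if "x \<in> carrier G" for x
    using \<alpha> that by (auto simp: auto_def hom_def)
  have *: "induced_aut G N (compose (carrier G) (inner_aut G g) \<alpha>) =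
      compose (carrier (G Mod N)) (inner_aut (G Mod N) (N #> g)) (induced_aut G N \<alpha>)"
    if g: "g \<in> carrier G" for g
  proof (rule extensionalityI[where A = "carrier (G Mod N)"])
    fix C assume C: "C \<in> carrier (G Mod N)"
    then obtain x where x: "x \<in> carrier G" "C = N #> x"
      by (auto simp: carrier_FactGroup)
    have "C \<subseteq> carrier G"
      using x r_coset_subset_G[OF N.subset] by auto
    then have "compose (carrier G) (inner_aut G g) \<alpha> ` C = inner_aut G g ` \<alpha> ` C"
      by (auto simp: compose_def image_image subset_iff intro!: image_cong)
    also have "\<dots> = N #> inner_aut G g (\<alpha> x)"
      using x g by (simp add: image_coset[OF N] inner_aut_in_auto \<alpha> cl)
    also have "\<dots> = N #> (g \<otimes> \<alpha> x \<otimes> inv g)"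
      using x by (simp add: inner_aut_def cl)
    also have "\<dots> = (N #> g) \<otimes>\<^bsub>G Mod N\<^esub> (N #> \<alpha> x) \<otimes>\<^bsub>G Mod N\<^esub> inv\<^bsub>G Mod N\<^esub> (N #> g)"
      using x g by (simp add: N.rcos_sum N.inv_FactGroup N.rcos_inv cl carrier_FactGroup)
    finally show "induced_aut G N (compose (carrier G) (inner_aut G g) \<alpha>) C =
        compose (carrier (G Mod N)) (inner_aut (G Mod N) (N #> g)) (induced_aut G N \<alpha>) C"
      using C x g cl by (simp add: induced_aut_def compose_def inner_aut_def[of "G Mod N"]
          image_coset[OF N \<alpha>] carrier_FactGroup)
  qed (simp_all add: induced_aut_def)
  have "induced_out G N (out_class G \<alpha>) =
      (\<lambda>g. compose (carrier (G Mod N)) (inner_aut (G Mod N) (N #> g)) (induced_aut G N \<alpha>)) ` carrier G"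
    unfolding induced_out_def out_class_eq[OF \<alpha>] image_image using * by (rule image_cong[OF refl])
  then show ?thesis
    unfolding Q.out_class_eq[OF induced_aut_in_auto[OF N \<alpha>]]
    by (simp add: carrier_FactGroup image_image)
qed

end

theory Submission
  imports Defs
begin

text \<open>Let \<open>G = F \<rtimes> \<langle>t\<rangle>\<close> with \<open>F\<close> free of rank \<open>m\<close> and \<open>\<phi>\<^sup>k\<close> inner. A suitable \<open>z \<in> t\<^sup>k F\<close> is central, so
  \<open>H = F \<times> \<langle>z\<rangle>\<close> has index \<open>k\<close> in \<open>G\<close>. Let \<open>H\<^sub>6\<close> be the kernel of \<open>H \<rightarrow> (\<int>/6)\<^sup>m\<^sup>+\<^sup>1\<close>. An automorphism \<open>\<alpha>\<close> of
  \<open>G\<close> that is trivial modulo a subgroup of \<open>H\<^sub>6\<close> and has finite order modulo inner automorphisms is inner: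
  by Minkowski's lemma it acts trivially on the abelianization of \<open>H\<close>. Hence it acts unipotently on
  the polynomial functions on \<open>H\<close>, and its finite order forces it to fix the polynomial class
  functions. The cyclically symmetrized Magnus coefficients are such functions, and they recognize the
  conjugacy classes of the generators \<open>x\<^sub>i\<close> and of the products \<open>x\<^sub>i x\<^sub>j\<close>; this makes \<open>\<alpha>\<close> inner on
  \<open>H\<close>. Finally, \<open>g\<^sup>-\<^sup>1 \<alpha>(g)\<close> centralizes \<open>H\<close> once \<open>\<alpha>\<close> is the identity there.

  So the intersection of all subgroups of index at most \<open>k 6\<^sup>m\<^sup>+\<^sup>1\<close> has the required property. It is
  generated by its elements of bounded length, and a word lies in it iff it acts trivially in
  every permutation action on \<open>k 6\<^sup>m\<^sup>+\<^sup>1\<close> points, which is decidable. The numbers \<open>m\<close> and \<open>k\<close> are found by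
  searching for a certified isomorphism with a mapping torus.\<close>

section \<open>Computable functions\<close>

text \<open>The modulus \<open>6\<close> has two tasks. Its factor \<open>3\<close> is for
  Minkowski's lemma, which fails modulo \<open>2\<close> because of \<open>-1\<close>. Its factor
  \<open>2\<close> is for rank one: if \<open>g\<close> inverts the generator \<open>x\<close> of
  \<open>F\<close>, then \<open>g \<mapsto> g x^(2s)\<close> is realized by conjugation with
  \<open>x^(-s)\<close>, while an odd exponent can give an outer automorphism of finite order. Rank
  one is separate because the centre of \<open>F\<close> is then nontrivial and the centralizer
  argument breaks down. Since \<open>\<alpha>\<close> has finite order only modulo inner
  automorphisms, a power of it restores class functions but not arbitrary polynomial functions;
  single Magnus coefficients are not class functions, hence the symmetrization. The generators alone
  would not suffice: a partial conjugation sends each generator to a conjugate, but with different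
  conjugators. The products \<open>x\<^sub>i x\<^sub>j\<close> tie these together. \<open>H\<close>
  depends on a choice of decomposition, so \<open>H\<^sub>6\<close> is not evidently characteristic.
  The intersection is so for formal reasons, and being trivial modulo it is the stronger condition
  on \<open>\<alpha>\<close>. The bound \<open>k 6\<^sup>m\<^sup>+\<^sup>1\<close> is the index of
  \<open>H\<close> times the order of \<open>(\<int>/6)\<^sup>m\<^sup>+\<^sup>1\<close>.\<close>

definition rcomp :: "nat \<Rightarrow> (nat list \<Rightarrow> nat) \<Rightarrow> bool" where
  "rcomp n f \<longleftrightarrow> (\<exists>p. \<forall>xs. length xs = n \<longrightarrow> rec_eval p xs (f xs))"

lemma rcomp_cong: "rcomp n f \<Longrightarrow> (\<And>xs. length xs = n \<Longrightarrow> f xs = g xs) \<Longrightarrow> rcomp n g"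
  unfolding rcomp_def by metis

lemma rcomp_nth: "i < n \<Longrightarrow> rcomp n (\<lambda>xs. xs ! i)"
  unfolding rcomp_def by (intro exI[of _ "Proj i"]) (auto intro: rec_eval.proj)

lemma rcomp_comp:
  assumes f: "rcomp (length gs) f" and gs: "\<And>g. g \<in> set gs \<Longrightarrow> rcomp n g"
  shows "rcomp n (\<lambda>xs. f (map (\<lambda>g. g xs) gs))"
proof -
  obtain p where p: "\<And>xs. length xs = length gs \<Longrightarrow> rec_eval p xs (f xs)"
    using f unfolding rcomp_def by blast
  obtain q where q: "\<And>g xs. g \<in> set gs \<Longrightarrow> length xs = n \<Longrightarrow> rec_eval (q g) xs (g xs)"
    using gs unfolding rcomp_def by metis
  have "rec_eval (Comp p (map q gs)) xs (f (map (\<lambda>g. g xs) gs))" if "length xs = n" for xs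
    by (rule rec_eval.comp[where ys = "map (\<lambda>g. g xs) gs"])
      (auto simp: list_all2_conv_all_nth intro!: q that p)
  then show ?thesis unfolding rcomp_def by blast
qed

lemma rcomp_comp1: "rcomp 1 (\<lambda>xs. f (xs ! 0)) \<Longrightarrow> rcomp n g \<Longrightarrow> rcomp n (\<lambda>xs. f (g xs))"
  using rcomp_comp[of "[g]" "\<lambda>xs. f (xs ! 0)" n] by simp

lemma rcomp_Suc: "rcomp n g \<Longrightarrow> rcomp n (\<lambda>xs. Suc (g xs))"
proof (rule rcomp_comp1[where f = Suc])
  have "rec_eval Succ xs (Suc (xs ! 0))" if "length xs = 1" for xs
    using that by (cases xs) (auto intro: rec_eval.succ)
  then show "rcomp 1 (\<lambda>xs. Suc (xs ! 0))"
    unfolding rcomp_def by blast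
qed

lemma rcomp_const: "rcomp n (\<lambda>_. c)"
  by (induction c) (auto simp: rcomp_def[of _ "\<lambda>_. 0"] intro: rec_eval.zero rcomp_Suc)

lemma rcomp_rec:
  assumes f: "rcomp n f" and g: "rcomp (Suc (Suc n)) (\<lambda>xs. g (xs ! 0) (xs ! 1) (tl (tl xs)))"
    and k: "rcomp n k"
  shows "rcomp n (\<lambda>xs. rec_nat (f xs) (\<lambda>i r. g i r xs) (k xs))"
proof -
  obtain p where p: "\<And>xs. length xs = n \<Longrightarrow> rec_eval p xs (f xs)"
    using f unfolding rcomp_def by blast
  obtain q where q: "\<And>xs. length xs = Suc (Suc n) \<Longrightarrow> rec_eval q xs (g (xs ! 0) (xs ! 1) (tl (tl xs)))"
    using g unfolding rcomp_def by blast
  have *: "rec_eval (PrimRec p q) (i # xs) (rec_nat (f xs) (\<lambda>i r. g i r xs) i)"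
    if xs: "length xs = n" for i xs
  proof (induction i)
    case 0 then show ?case using p[OF xs] by (auto intro: rec_eval.primrec_0)
  next
    case (Suc i)
    have "rec_eval q (i # rec_nat (f xs) (\<lambda>i r. g i r xs) i # xs)
      (rec_nat (f xs) (\<lambda>i r. g i r xs) (Suc i))"
      using q[of "i # rec_nat (f xs) (\<lambda>i r. g i r xs) i # xs"] xs by simp
    then show ?case by (rule rec_eval.primrec_Suc[OF Suc])
  qed
  then have R: "rcomp (Suc n) (\<lambda>ys. rec_nat (f (tl ys)) (\<lambda>i r. g i r (tl ys)) (hd ys))"
    unfolding rcomp_def by (intro exI[of _ "PrimRec p q"]) (auto simp: length_Suc_conv)
  have "rcomp n (\<lambda>xs. (\<lambda>ys. rec_nat (f (tl ys)) (\<lambda>i r. g i r (tl ys)) (hd ys))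
      (map (\<lambda>g. g xs) (k # map (\<lambda>i xs. xs ! i) [0..<n])))"
    by (rule rcomp_comp) (use R k in \<open>auto intro: rcomp_nth\<close>)
  then show ?thesis
    by (rule rcomp_cong) (auto simp: comp_def map_nth)
qed

text \<open>Only total functions satisfy \<open>rcomp\<close>, so minimization asks for a zero at
  every argument list. The one search that may diverge is built directly in
  \<open>computable_search\<close>.\<close>

lemma rcomp_Least:
  assumes f: "rcomp (Suc n) (\<lambda>xs. f (xs ! 0) (tl xs))" and ex: "\<And>xs. length xs = n \<Longrightarrow> \<exists>k. f k xs = 0"
  shows "rcomp n (\<lambda>xs. LEAST k. f k xs = 0)"
proof -
  obtain p where p: "\<And>xs. length xs = Suc n \<Longrightarrow> rec_eval p xs (f (xs ! 0) (tl xs))"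
    using f unfolding rcomp_def by blast
  have "rec_eval (Mu p) xs (LEAST k. f k xs = 0)" if xs: "length xs = n" for xs
  proof (rule rec_eval.mu)
    have "f (LEAST k. f k xs = 0) xs = 0"
      by (rule LeastI_ex[OF ex[OF xs]])
    then show "rec_eval p ((LEAST k. f k xs = 0) # xs) 0"
      using p[of "(LEAST k. f k xs = 0) # xs"] xs by simp
    fix i assume "i < (LEAST k. f k xs = 0)"
    then have "f i xs \<noteq> 0" using not_less_Least by blast
    then show "\<exists>y. rec_eval p (i # xs) (Suc y)"
      using p[of "i # xs"] xs by (auto simp: gr0_conv_Suc)
  qed
  then show ?thesis unfolding rcomp_def by blast
qed

text \<open>A recursion on \<open>c xs\<close> whose step ignores its state and returns
  \<open>g xs\<close>: zero steps leave \<open>f xs\<close>, any positive number of steps gives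
  \<open>g xs\<close>.\<close>

lemma rcomp_if:
  assumes "rcomp n c" "rcomp n f" "rcomp n g"
  shows "rcomp n (\<lambda>xs. if c xs = 0 then f xs else g xs)"
proof -
  have "rcomp n (\<lambda>xs. (\<lambda>ys. rec_nat (ys ! 1) (\<lambda>i r. ys ! 2) (ys ! 0)) (map (\<lambda>h. h xs) [c, f, g]))"
  proof (rule rcomp_comp)
    have "rcomp 5 (\<lambda>xs. tl (tl xs) ! 2)"
      by (rule rcomp_cong[OF rcomp_nth[of 4]]) (auto simp: nth_tl)
    then show "rcomp (length [c, f, g]) (\<lambda>ys. rec_nat (ys ! 1) (\<lambda>i r. ys ! 2) (ys ! 0))"
      by (intro rcomp_rec rcomp_nth) (simp_all add: numeral_eq_Suc)
  qed (use assms in auto)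
  then show ?thesis
    by (rule rcomp_cong) (auto simp: gr0_conv_Suc)
qed

lemma rcomp_tl:
  assumes "rcomp n f"
  shows "rcomp (Suc n) (\<lambda>xs. f (tl xs))"
proof -
  have "rcomp (Suc n) (\<lambda>xs. f (map (\<lambda>g. g xs) (map (\<lambda>i xs. xs ! Suc i) [0..<n])))"
    by (rule rcomp_comp) (use assms in \<open>auto intro: rcomp_nth\<close>)
  then show ?thesis
    by (rule rcomp_cong) (auto simp: length_Suc_conv comp_def map_nth)
qed

lemma rcomp_add: "rcomp n f \<Longrightarrow> rcomp n g \<Longrightarrow> rcomp n (\<lambda>xs. f xs + g xs)"
proof -
  assume "rcomp n f" "rcomp n g"
  then have "rcomp n (\<lambda>xs. rec_nat (f xs) (\<lambda>_ r. Suc r) (g xs))"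
    by (intro rcomp_rec rcomp_Suc rcomp_nth) auto
  moreover have "rec_nat a (\<lambda>_ r. Suc r) b = a + b" for a b :: nat
    by (induction b) auto
  ultimately show ?thesis by simp
qed

lemma rcomp_mult: "rcomp n f \<Longrightarrow> rcomp n g \<Longrightarrow> rcomp n (\<lambda>xs. f xs * g xs)"
proof -
  assume "rcomp n f" "rcomp n g"
  then have "rcomp n (\<lambda>xs. rec_nat 0 (\<lambda>_ r. r + f xs) (g xs))"
    by (intro rcomp_rec rcomp_add rcomp_const rcomp_nth rcomp_tl) auto
  moreover have "rec_nat 0 (\<lambda>_ r. r + a) b = a * b" for a b :: nat
    by (induction b) auto
  ultimately show ?thesis by simp
qed

lemma rcomp_diff: "rcomp n f \<Longrightarrow> rcomp n g \<Longrightarrow> rcomp n (\<lambda>xs. f xs - g xs)"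
proof -
  assume fg: "rcomp n f" "rcomp n g"
  have pred: "rcomp n (\<lambda>xs. h xs - 1)" if "rcomp n h" for h n
  proof -
    have "rcomp n (\<lambda>xs. rec_nat 0 (\<lambda>i _. i) (h xs))"
      using that by (intro rcomp_rec rcomp_const rcomp_nth) auto
    moreover have "rec_nat 0 (\<lambda>i _. i) a = a - 1" for a :: nat
      by (cases a) auto
    ultimately show ?thesis by simp
  qed
  have "rcomp n (\<lambda>xs. rec_nat (f xs) (\<lambda>_ r. r - 1) (g xs))"
    using fg by (intro rcomp_rec pred rcomp_nth) auto
  moreover have "rec_nat a (\<lambda>_ r. r - 1) b = a - b" for a b :: nat
    by (induction b) auto
  ultimately show ?thesis by simp
qed

lemma rcomp_triangle: "rcomp n f \<Longrightarrow> rcomp n (\<lambda>xs. triangle (f xs))"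
proof -
  assume "rcomp n f"
  then have "rcomp n (\<lambda>xs. rec_nat 0 (\<lambda>i r. r + Suc i) (f xs))"
    by (intro rcomp_rec rcomp_add rcomp_Suc rcomp_const rcomp_nth) auto
  moreover have "rec_nat 0 (\<lambda>i r. r + Suc i) a = triangle a" for a :: nat
    by (induction a) auto
  ultimately show ?thesis by simp
qed

lemma rcomp_power: "rcomp n f \<Longrightarrow> rcomp n g \<Longrightarrow> rcomp n (\<lambda>xs. f xs ^ g xs)"
proof -
  assume "rcomp n f" "rcomp n g"
  then have "rcomp n (\<lambda>xs. rec_nat 1 (\<lambda>_ r. r * f xs) (g xs))"
    by (intro rcomp_rec rcomp_mult rcomp_const rcomp_nth rcomp_tl) auto
  moreover have "rec_nat 1 (\<lambda>_ r. r * a) b = a ^ b" for a b :: nat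
    by (induction b) auto
  ultimately show ?thesis by simp
qed

lemma rcomp_div: "rcomp n f \<Longrightarrow> rcomp n g \<Longrightarrow> rcomp n (\<lambda>xs. f xs div g xs)"
proof -
  assume fg: "rcomp n f" "rcomp n g"
  \<comment> \<open>By truncated subtraction the first factor vanishes iff
    \<open>a < (q + 1) * b\<close>. The additional factor \<open>b\<close> makes
    \<open>q = 0\<close> a solution when \<open>b = 0\<close>, which agrees with
    \<open>a div 0 = 0\<close> and keeps the search total.\<close>
  have *: "(LEAST q. (Suc a - Suc q * b) * b = 0) = a div b" for a b :: nat
  proof (cases "b = 0")
    case False
    show ?thesis
    proof (rule Least_equality)
      have "a < b + b * (a div b)"
        using False by (metis dividend_less_times_div neq0_conv)
      then show "(Suc a - Suc (a div b) * b) * b = 0"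
        by (simp add: algebra_simps)
      fix q assume "(Suc a - Suc q * b) * b = 0"
      then have "a < Suc q * b" using False by simp
      then show "a div b \<le> q"
        using False by (metis less_Suc_eq_le less_mult_imp_div_less)
    qed
  qed simp
  have "rcomp n (\<lambda>xs. LEAST q. (Suc (f xs) - Suc q * g xs) * g xs = 0)"
  proof (rule rcomp_Least)
    show "rcomp (Suc n) (\<lambda>xs. (Suc (f (tl xs)) - Suc (xs ! 0) * g (tl xs)) * g (tl xs))"
      using fg by (intro rcomp_mult rcomp_diff rcomp_Suc rcomp_tl rcomp_nth) auto
    show "\<exists>q. (Suc (f xs) - Suc q * g xs) * g xs = 0" for xs
      by (rule exI[of _ "f xs"]) (cases "g xs"; simp)
  qed
  then show ?thesis unfolding * .
qed

lemma rcomp_prod_encode: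
  "rcomp n f \<Longrightarrow> rcomp n g \<Longrightarrow> rcomp n (\<lambda>xs. prod_encode (f xs, g xs))"
  by (simp add: prod_encode_def rcomp_add rcomp_triangle)

text \<open>The pairing runs through the diagonals \<open>a + b = s\<close>, and the diagonal of
  \<open>c\<close> is the least \<open>s\<close> with \<open>c < triangle (s + 1)\<close>. Both
  components are then differences.\<close>

lemma prod_decode_Least:
  defines "s \<equiv> \<lambda>c. LEAST k. Suc c - triangle (Suc k) = 0"
  shows "fst (prod_decode c) = c - triangle (s c)" "snd (prod_decode c) = s c - (c - triangle (s c))"
proof -
  obtain a b where c: "c = prod_encode (a, b)"
    by (metis prod_decode_inverse surj_pair)
  have "s c = a + b"
    unfolding s_def
  proof (rule Least_equality)
    show "Suc c - triangle (Suc (a + b)) = 0"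
      by (simp add: c prod_encode_def)
    fix k assume "Suc c - triangle (Suc k) = 0"
    then have *: "triangle (a + b) + a < triangle (Suc k)"
      by (simp add: c prod_encode_def)
    show "a + b \<le> k"
    proof (rule ccontr)
      assume "\<not> a + b \<le> k"
      then have "triangle (Suc k) \<le> triangle (a + b)"
        unfolding triangle_def by (intro div_le_mono mult_le_mono) auto
      with * show False by simp
    qed
  qed
  then show "fst (prod_decode c) = c - triangle (s c)" "snd (prod_decode c) = s c - (c - triangle (s c))"
    unfolding c prod_encode_inverse by (simp_all add: prod_encode_def)
qed

lemma rcomp_prod_decode:
  assumes "rcomp n f"
  shows "rcomp n (\<lambda>xs. fst (prod_decode (f xs)))" "rcomp n (\<lambda>xs. snd (prod_decode (f xs)))"
proof -
  have "rcomp n (\<lambda>xs. LEAST k. Suc (f xs) - triangle (Suc k) = 0)"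
  proof (rule rcomp_Least)
    show "rcomp (Suc n) (\<lambda>xs. Suc (f (tl xs)) - triangle (Suc (xs ! 0)))"
      using assms by (intro rcomp_diff rcomp_triangle rcomp_Suc rcomp_tl rcomp_nth) auto
    show "\<exists>k. Suc (f xs) - triangle (Suc k) = 0" for xs
      by (rule exI[of _ "f xs"]) simp
  qed
  with assms show "rcomp n (\<lambda>xs. fst (prod_decode (f xs)))" "rcomp n (\<lambda>xs. snd (prod_decode (f xs)))"
    unfolding prod_decode_Least by (simp_all only: rcomp_diff rcomp_triangle)
qed

text \<open>The codes of words obtained here differ from those of \<open>Defs\<close>, which code letters by
  \<open>encode_letter\<close>.\<close>

class enc =
  fixes enc :: "'a \<Rightarrow> nat"
  assumes inj_enc: "inj enc"

instantiation nat :: enc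
begin
definition "enc (n::nat) = n"
instance by standard (simp add: enc_nat_def inj_on_def)
end

instantiation bool :: enc
begin
definition "enc (b::bool) = of_bool b"
instance by standard (auto simp: enc_bool_def inj_on_def of_bool_def split: if_splits)
end

instantiation prod :: (enc, enc) enc
begin
definition "enc (p::'a \<times> 'b) = prod_encode (enc (fst p), enc (snd p))"
instance
  by standard (auto simp: enc_prod_def inj_on_def dest: injD[OF inj_enc])
end

instantiation list :: (enc) enc
begin
definition "enc (xs::'a list) = list_encode (map enc xs)"
instance
  by standard (auto simp: enc_list_def inj_on_def list_encode_eq dest: map_injective[OF _ inj_enc])
end

lemma enc_eq_iff: "enc x = enc y \<longleftrightarrow> x = y"
  using inj_enc by (auto dest: injD)

text \<open>\<open>g\<close> is arbitrary on numbers that are not codes. All functions are unary: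
  the body of a fold or of a bounded quantifier is read as a function of a nested pair of the
  ambient argument and the bound variables. The rules in \<open>comp_intros\<close> already include
  composition with functions of the ambient argument, so a definition is decomposed by
  \<open>intro\<close>; an instance \<open>computable_comp[OF ...]\<close> makes an assumption
  usable under such a binder.\<close>

definition computable :: "('a::enc \<Rightarrow> 'b::enc) \<Rightarrow> bool" where
  "computable f \<longleftrightarrow> (\<exists>g. rcomp 1 (\<lambda>xs. g (xs ! 0)) \<and> (\<forall>x. g (enc x) = enc (f x)))"

named_theorems comp_intros

lemma computableI:
  "rcomp 1 (\<lambda>xs. g (xs ! 0)) \<Longrightarrow> (\<And>x. g (enc x) = enc (f x)) \<Longrightarrow> computable f"
  unfolding computable_def by blast

lemma computableE:
  assumes "computable f"
  obtains g where "\<And>n h. rcomp n h \<Longrightarrow> rcomp n (\<lambda>xs. g (h xs))" "\<And>x. g (enc x) = enc (f x)"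
  using assms rcomp_comp1 unfolding computable_def by metis

lemma computable_cong: "computable f \<Longrightarrow> (\<And>x. f x = g x) \<Longrightarrow> computable g"
  using ext[of f g] by simp

lemma computable_id [comp_intros]: "computable (\<lambda>x. x)"
  by (rule computableI[where g = "\<lambda>x. x"]) (auto intro: rcomp_nth)

lemma computable_const [comp_intros]: "computable (\<lambda>_. c)"
  by (rule computableI[where g = "\<lambda>_. enc c"]) (auto intro: rcomp_const)

lemma computable_comp: "computable f \<Longrightarrow> computable g \<Longrightarrow> computable (\<lambda>x. f (g x))"
proof -
  assume f: "computable f" and g: "computable g"
  obtain f' where f': "\<And>n h. rcomp n h \<Longrightarrow> rcomp n (\<lambda>xs. f' (h xs))" "\<And>x. f' (enc x) = enc (f x)"
    using computableE[OF f] by blast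
  obtain g' where g': "\<And>n h. rcomp n h \<Longrightarrow> rcomp n (\<lambda>xs. g' (h xs))" "\<And>x. g' (enc x) = enc (g x)"
    using computableE[OF g] by blast
  show ?thesis
    by (rule computableI[where g = "\<lambda>x. f' (g' x)"]) (auto intro!: f' g' rcomp_nth simp: f' g')
qed

lemma computable_Pair [comp_intros]:
  assumes "computable f" "computable g"
  shows "computable (\<lambda>x. (f x, g x))"
proof -
  obtain f' where f': "\<And>n h. rcomp n h \<Longrightarrow> rcomp n (\<lambda>xs. f' (h xs))" "\<And>x. f' (enc x) = enc (f x)"
    using computableE[OF assms(1)] by blast
  obtain g' where g': "\<And>n h. rcomp n h \<Longrightarrow> rcomp n (\<lambda>xs. g' (h xs))" "\<And>x. g' (enc x) = enc (g x)"
    using computableE[OF assms(2)] by blast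
  show ?thesis
    by (intro computableI[where g = "\<lambda>x. prod_encode (f' x, g' x)"])
      (auto intro!: f' g' rcomp_prod_encode rcomp_nth simp: f' g' enc_prod_def)
qed

lemma computable_fst [comp_intros]: "computable f \<Longrightarrow> computable (\<lambda>x. fst (f x))"
  by (rule computable_comp[where f = fst], rule computableI[where g = "\<lambda>x. fst (prod_decode x)"])
    (auto intro: rcomp_prod_decode rcomp_nth simp: enc_prod_def)

lemma computable_snd [comp_intros]: "computable f \<Longrightarrow> computable (\<lambda>x. snd (f x))"
  by (rule computable_comp[where f = snd], rule computableI[where g = "\<lambda>x. snd (prod_decode x)"])
    (auto intro: rcomp_prod_decode rcomp_nth simp: enc_prod_def)

lemma computable_nat1:
  assumes "rcomp 1 (\<lambda>xs. F (xs ! 0))" "computable f"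
  shows "computable (\<lambda>x. F (f x) :: nat)"
  by (rule computable_comp[where f = F], rule computableI[where g = F])
    (use assms in \<open>auto simp: enc_nat_def\<close>)

lemma computable_nat2:
  assumes F: "\<And>n f g. rcomp n f \<Longrightarrow> rcomp n g \<Longrightarrow> rcomp n (\<lambda>xs. F (f xs) (g xs))"
    and f: "computable f" and g: "computable g"
  shows "computable (\<lambda>x. F (f x) (g x) :: nat)"
proof -
  have "computable (\<lambda>p. F (fst p) (snd p))"
    by (rule computableI[where g = "\<lambda>c. F (fst (prod_decode c)) (snd (prod_decode c))"])
      (auto intro!: F rcomp_prod_decode rcomp_nth simp: enc_nat_def enc_prod_def)
  from computable_comp[OF this computable_Pair[OF f g]] show ?thesis by simp
qed

lemma computable_Suc [comp_intros]: "computable f \<Longrightarrow> computable (\<lambda>x. Suc (f x))"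
  by (rule computable_nat1[where F = Suc]) (auto intro: rcomp_Suc rcomp_nth)

lemmas computable_arith [comp_intros] =
  computable_nat2[where F = "(+)", OF rcomp_add] computable_nat2[where F = "(*)", OF rcomp_mult]
  computable_nat2[where F = "(-)", OF rcomp_diff] computable_nat2[where F = "(^)", OF rcomp_power]
  computable_nat2[where F = "(div)", OF rcomp_div]

lemma computable_mod [comp_intros]:
  "computable f \<Longrightarrow> computable g \<Longrightarrow> computable (\<lambda>x. f x mod g x :: nat)"
  unfolding minus_div_mult_eq_mod[symmetric] by (intro comp_intros)

lemma computable_If [comp_intros]:
  assumes "computable b" "computable f" "computable g"
  shows "computable (\<lambda>x. if b x then f x else g x)"
proof -
  obtain b' where b': "\<And>n h. rcomp n h \<Longrightarrow> rcomp n (\<lambda>xs. b' (h xs))" "\<And>x. b' (enc x) = enc (b x)"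
    using computableE[OF assms(1)] by blast
  obtain f' where f': "\<And>n h. rcomp n h \<Longrightarrow> rcomp n (\<lambda>xs. f' (h xs))" "\<And>x. f' (enc x) = enc (f x)"
    using computableE[OF assms(2)] by blast
  obtain g' where g': "\<And>n h. rcomp n h \<Longrightarrow> rcomp n (\<lambda>xs. g' (h xs))" "\<And>x. g' (enc x) = enc (g x)"
    using computableE[OF assms(3)] by blast
  show ?thesis
    by (intro computableI[where g = "\<lambda>x. if b' x = 0 then g' x else f' x"])
      (auto intro!: b' f' g' rcomp_if rcomp_nth simp: b' f' g' enc_bool_def)
qed

lemma computable_conj [comp_intros]:
  assumes "computable P" "computable Q"
  shows "computable (\<lambda>x. P x \<and> Q x)"
proof -
  have "computable (\<lambda>x. if P x then Q x else False)"
    by (intro comp_intros assms)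
  then show ?thesis by (rule computable_cong) auto
qed

lemma computable_Not [comp_intros]:
  assumes "computable P"
  shows "computable (\<lambda>x. \<not> P x)"
proof -
  have "computable (\<lambda>x. if P x then False else True)"
    by (intro comp_intros assms)
  then show ?thesis by (rule computable_cong) auto
qed

lemma computable_disj [comp_intros]:
  assumes "computable P" "computable Q"
  shows "computable (\<lambda>x. P x \<or> Q x)"
proof -
  have "computable (\<lambda>x. \<not> (\<not> P x \<and> \<not> Q x))"
    by (intro comp_intros assms)
  then show ?thesis by (rule computable_cong) auto
qed

lemma computable_imp [comp_intros]:
  assumes "computable P" "computable Q"
  shows "computable (\<lambda>x. P x \<longrightarrow> Q x)"
  unfolding imp_conv_disj by (intro comp_intros assms)

text \<open>Values agree iff their codes do, by injectivity of \<open>enc\<close>, and two numbers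
  agree iff both truncated differences vanish.\<close>

lemma computable_eq [comp_intros]:
  assumes "computable f" "computable g"
  shows "computable (\<lambda>x. f x = g x)"
proof -
  obtain f' where f': "\<And>n h. rcomp n h \<Longrightarrow> rcomp n (\<lambda>xs. f' (h xs))" "\<And>x. f' (enc x) = enc (f x)"
    using computableE[OF assms(1)] by blast
  obtain g' where g': "\<And>n h. rcomp n h \<Longrightarrow> rcomp n (\<lambda>xs. g' (h xs))" "\<And>x. g' (enc x) = enc (g x)"
    using computableE[OF assms(2)] by blast
  note fg = f' g'
  show ?thesis
  proof (rule computableI[where g = "\<lambda>x. 1 - ((f' x - g' x) + (g' x - f' x))"])
    show "rcomp 1 (\<lambda>xs. 1 - (f' (xs ! 0) - g' (xs ! 0) + (g' (xs ! 0) - f' (xs ! 0))))"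
      by (intro rcomp_diff rcomp_add rcomp_const fg rcomp_nth) auto
    show "1 - (f' (enc x) - g' (enc x) + (g' (enc x) - f' (enc x))) = enc (f x = g x)" for x
      using enc_eq_iff[of "f x" "g x"] by (auto simp: fg enc_bool_def)
  qed
qed

lemma computable_le [comp_intros]:
  assumes "computable f" "computable g"
  shows "computable (\<lambda>x. f x \<le> (g x :: nat))"
proof -
  have "computable (\<lambda>x. f x - g x = 0)" by (intro comp_intros assms)
  then show ?thesis by simp
qed

lemma computable_less [comp_intros]:
  assumes "computable f" "computable g"
  shows "computable (\<lambda>x. f x < (g x :: nat))"
  using computable_le[OF computable_Suc[OF assms(1)] assms(2)] by (simp add: Suc_le_eq)

lemma computable_odd [comp_intros]: "computable f \<Longrightarrow> computable (\<lambda>x. odd (f x :: nat))"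
  unfolding odd_iff_mod_2_eq_one by (intro comp_intros)

lemma computable_of_bool [comp_intros]: "computable P \<Longrightarrow> computable (\<lambda>x. of_bool (P x) :: nat)"
  unfolding of_bool_def by (intro comp_intros)

lemma computable_rec_nat [comp_intros]:
  assumes "computable f" "computable (\<lambda>z. g (fst z) (fst (snd z)) (snd (snd z)))" "computable k"
  shows "computable (\<lambda>x. rec_nat (f x) (\<lambda>n r. g x n r) (k x))"
proof -
  obtain f' where f': "\<And>n h. rcomp n h \<Longrightarrow> rcomp n (\<lambda>xs. f' (h xs))" "\<And>x. f' (enc x) = enc (f x)"
    using computableE[OF assms(1)] by blast
  obtain g' where g': "\<And>n h. rcomp n h \<Longrightarrow> rcomp n (\<lambda>xs. g' (h xs))"
    "\<And>z. g' (enc z) = enc (g (fst z) (fst (snd z)) (snd (snd z)))"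
    using computableE[OF assms(2)] by blast
  obtain k' where k': "\<And>n h. rcomp n h \<Longrightarrow> rcomp n (\<lambda>xs. k' (h xs))" "\<And>x. k' (enc x) = enc (k x)"
    using computableE[OF assms(3)] by blast
  note fg = f' k' g'
  show ?thesis
  proof (rule computableI[where
        g = "\<lambda>x. rec_nat (f' x) (\<lambda>n r. g' (prod_encode (x, prod_encode (n, r)))) (k' x)"])
    have "rcomp (Suc (Suc 1)) (\<lambda>xs. g' (prod_encode (tl (tl xs) ! 0, prod_encode (xs ! 0, xs ! 1))))"
      by (intro fg rcomp_prod_encode rcomp_nth rcomp_tl) auto
    then show "rcomp 1 (\<lambda>xs. rec_nat (f' (xs ! 0))
        (\<lambda>n r. g' (prod_encode (xs ! 0, prod_encode (n, r)))) (k' (xs ! 0)))"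
      by (intro rcomp_rec f' k' rcomp_nth) auto
    fix x
    have "rec_nat (f' (enc x)) (\<lambda>n r. g' (prod_encode (enc x, prod_encode (n, r)))) n =
        enc (rec_nat (f x) (g x) n)" for n
      using fg(6)[of "(x, n', r)" for n' r]
      by (induction n) (simp_all add: fg(2) enc_prod_def enc_nat_def)
    then show "rec_nat (f' (enc x)) (\<lambda>n r. g' (prod_encode (enc x, prod_encode (n, r)))) (k' (enc x)) =
        enc (rec_nat (f x) (g x) (k x))"
      by (simp add: fg(4) enc_nat_def)
  qed
qed

lemma computable_all_less [comp_intros]:
  assumes "computable (\<lambda>z. P (fst z) (snd z))" "computable k"
  shows "computable (\<lambda>x. \<forall>i<(k x :: nat). P x i)"
proof -
  have "computable (\<lambda>x. rec_nat True (\<lambda>n r. r \<and> P x n) (k x))"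
    using computable_comp[OF assms(1), of "\<lambda>z. (fst z, fst (snd z))"]
    by (intro comp_intros assms) (simp add: comp_intros)
  moreover have "rec_nat True (\<lambda>n r. r \<and> P x n) (b::nat) = (\<forall>i<b. P x i)" for x b
    by (induction b) (auto simp: less_Suc_eq)
  ultimately show ?thesis by simp
qed

lemma computable_enc [comp_intros]: "computable f \<Longrightarrow> computable (\<lambda>x. enc (f x))"
  by (rule computable_comp[where f = enc], rule computableI[where g = "\<lambda>x. x"])
    (auto intro: rcomp_nth simp: enc_nat_def)

lemma computable_Cons [comp_intros]:
  assumes "computable f" "computable g"
  shows "computable (\<lambda>x. f x # g x)"
proof -
  have "computable (\<lambda>p. fst p # snd p)"
    \<comment> \<open>A nonempty list is coded as the successor of the code of the pair of head and
      tail.\<close>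
    by (rule computableI[where g = Suc])
      (auto intro: rcomp_Suc rcomp_nth simp: enc_prod_def enc_list_def)
  from computable_comp[OF this computable_Pair[OF assms]] show ?thesis by simp
qed

lemma computable_tl [comp_intros]: "computable f \<Longrightarrow> computable (\<lambda>x. tl (f x))"
proof (rule computable_comp[where f = tl])
  show "computable (tl :: 'b list \<Rightarrow> 'b list)"
  proof (rule computableI[where g = "\<lambda>c. if c = 0 then 0 else snd (prod_decode (c - 1))"])
    show "(if enc l = 0 then 0 else snd (prod_decode (enc l - 1))) = enc (tl l)" for l :: "'b list"
      by (cases l) (auto simp: enc_list_def)
  qed (intro rcomp_if rcomp_prod_decode rcomp_diff rcomp_const rcomp_nth; simp)
qed

lemma computable_hd [comp_intros]: "computable f \<Longrightarrow> computable (\<lambda>x. hd (f x))"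
proof (rule computable_comp[where f = hd])
  show "computable (hd :: 'b list \<Rightarrow> 'b)"
  \<comment> \<open>\<open>hd []\<close> is unspecified but one fixed value, so its code can be
    built into the program.\<close>
  proof (rule computableI[where
        g = "\<lambda>c. if c = 0 then enc (hd [] :: 'b) else fst (prod_decode (c - 1))"])
    show "(if enc l = 0 then enc (hd [] :: 'b) else fst (prod_decode (enc l - 1))) = enc (hd l)"
      for l :: "'b list"
      by (cases l) (auto simp: enc_list_def)
  qed (intro rcomp_if rcomp_prod_decode rcomp_diff rcomp_const rcomp_nth; simp)
qed

text \<open>The code of a list serves as a bound for the number of steps of a recursion over it, so
  that folds become primitive recursions.\<close>

lemma length_le_enc: "length l \<le> enc l"
proof (induction l)
  case (Cons a l)
  have "enc l \<le> prod_encode (enc a, enc l)" by (rule le_prod_encode_2)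
  with Cons show ?case by (simp add: enc_list_def)
qed simp

lemma computable_foldl [comp_intros]:
  assumes i: "computable i" and g: "computable (\<lambda>z. g (fst z) (fst (snd z)) (snd (snd z)))"
    and l: "computable l"
  shows "computable (\<lambda>x. foldl (\<lambda>acc a. g x acc a) (i x) (l x))"
proof -
  \<comment> \<open>The state is the accumulator together with the unread rest. It no longer changes
    once the rest is empty, so surplus steps are harmless.\<close>
  define step where "step = (\<lambda>x (s :: 'b \<times> 'c list).
    if snd s = [] then s else (g x (fst s) (hd (snd s)), tl (snd s)))"
  have g': "computable (\<lambda>z::'a \<times> nat \<times> 'b \<times> 'c list.
      g (fst z) (fst (snd (snd z))) (hd (snd (snd (snd z)))))"
    using computable_comp[OF g, of "\<lambda>z::'a \<times> nat \<times> 'b \<times> 'c list.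
        (fst z, fst (snd (snd z)), hd (snd (snd (snd z))))"] by (simp add: comp_intros)
  have "computable (\<lambda>z::'a \<times> nat \<times> 'b \<times> 'c list. step (fst z) (snd (snd z)))"
    unfolding step_def by (intro comp_intros g')
  then have "computable (\<lambda>x. fst (rec_nat (i x, l x) (\<lambda>_ s. step x s) (enc (l x))))"
    by (intro comp_intros i l)
  moreover have "fst (rec_nat (b, l) (\<lambda>_ s. step x s) n) = foldl (\<lambda>acc a. g x acc a) b l"
    if "length l \<le> n" for x b n and l :: "'c list"
  proof -
    define R where "R = (\<lambda>s. rec_nat s (\<lambda>_ s. step x s))"
    have R0: "R s 0 = s" for s by (simp add: R_def)
    have RS: "R s (Suc n) = R (step x s) n" for s n
      by (induction n) (auto simp: R_def)
    have "fst (R (b, l) n) = foldl (\<lambda>acc a. g x acc a) b l"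
      using that
    proof (induction n arbitrary: b l)
      case (Suc n)
      then show ?case by (cases l) (auto simp: RS step_def)
    qed (simp add: R0)
    then show ?thesis by (simp add: R_def)
  qed
  ultimately show ?thesis by (simp add: length_le_enc)
qed

lemma computable_rev [comp_intros]:
  assumes "computable f"
  shows "computable (\<lambda>x. rev (f x))"
proof -
  have "computable (\<lambda>x. foldl (\<lambda>acc a. a # acc) [] (f x))"
    by (intro comp_intros assms)
  moreover have "foldl (\<lambda>acc a. a # acc) ys xs = rev xs @ ys" for xs ys :: "'b list"
    by (induction xs arbitrary: ys) auto
  ultimately show ?thesis by simp
qed

lemma computable_foldr [comp_intros]:
  assumes i: "computable i" and g: "computable (\<lambda>z. g (fst z) (fst (snd z)) (snd (snd z)))"
    and l: "computable l"
  shows "computable (\<lambda>x. foldr (\<lambda>a acc. g x a acc) (l x) (i x))"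
  using computable_comp[OF g, of "\<lambda>z. (fst z, snd (snd z), fst (snd z))"]
  unfolding foldr_conv_foldl by (intro comp_intros i l) (simp add: comp_intros)

lemma computable_append [comp_intros]:
  assumes "computable f" "computable g"
  shows "computable (\<lambda>x. f x @ g x)"
proof -
  have "computable (\<lambda>x. foldr (\<lambda>a acc. a # acc) (f x) (g x))"
    by (intro comp_intros assms)
  moreover have "foldr (\<lambda>a acc. a # acc) xs ys = xs @ ys" for xs ys :: "'b list"
    by (induction xs) auto
  ultimately show ?thesis by simp
qed

lemma computable_concat [comp_intros]: "computable f \<Longrightarrow> computable (\<lambda>x. concat (f x))"
  unfolding concat_conv_foldr by (intro comp_intros)

lemma computable_map [comp_intros]:
  assumes g: "computable (\<lambda>z. g (fst z) (snd z))" and l: "computable l"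
  shows "computable (\<lambda>x. map (\<lambda>a. g x a) (l x))"
proof -
  have "computable (\<lambda>x. foldr (\<lambda>a acc. g x a # acc) (l x) [])"
    using computable_comp[OF g, of "\<lambda>z. (fst z, fst (snd z))"]
    by (intro comp_intros l) (simp add: comp_intros)
  moreover have "foldr (\<lambda>a acc. h a # acc) xs [] = map h xs" for h :: "'b \<Rightarrow> 'c" and xs
    by (induction xs) auto
  ultimately show ?thesis by simp
qed

lemma computable_filter [comp_intros]:
  assumes g: "computable (\<lambda>z. g (fst z) (snd z))" and l: "computable l"
  shows "computable (\<lambda>x. filter (\<lambda>a. g x a) (l x))"
proof -
  have "computable (\<lambda>x. foldr (\<lambda>a acc. if g x a then a # acc else acc) (l x) [])"
    using computable_comp[OF g, of "\<lambda>z. (fst z, fst (snd z))"]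
    by (intro comp_intros l) (simp_all add: comp_intros)
  moreover have "foldr (\<lambda>a acc. if h a then a # acc else acc) xs [] = filter h xs"
    for h :: "'b \<Rightarrow> bool" and xs
    by (induction xs) auto
  ultimately show ?thesis by simp
qed

lemma computable_Ball_set [comp_intros]:
  assumes g: "computable (\<lambda>z. P (fst z) (snd z))" and l: "computable l"
  shows "computable (\<lambda>x. \<forall>a\<in>set (l x). P x a)"
proof -
  have "computable (\<lambda>x. filter (\<lambda>a. \<not> P x a) (l x) = [])"
    by (intro comp_intros g l)
  then show ?thesis by (rule computable_cong) (auto simp: filter_empty_conv)
qed

lemma computable_in_set [comp_intros]:
  assumes "computable f" "computable l"
  shows "computable (\<lambda>x. f x \<in> set (l x))"
proof -
  have "computable (\<lambda>x. \<not> (\<forall>a\<in>set (l x). \<not> a = f x))"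
    by (intro comp_intros assms computable_comp[OF assms(1)])
  then show ?thesis by (rule computable_cong) auto
qed

lemma computable_length [comp_intros]:
  assumes "computable l"
  shows "computable (\<lambda>x. length (l x))"
proof -
  have "computable (\<lambda>x. foldr (\<lambda>_ n. Suc n) (l x) 0)"
    by (intro comp_intros assms)
  moreover have "foldr (\<lambda>_ n. Suc n) l 0 = length l" for l :: "'b list"
    by (induction l) auto
  ultimately show ?thesis by simp
qed

lemma computable_nth [comp_intros]:
  assumes "computable l" "computable k" "computable d"
  shows "computable (\<lambda>x. if k x < length (l x) then l x ! k x else d x)"
proof -
  have "computable (\<lambda>x. if k x < length (l x) then hd (rec_nat (l x) (\<lambda>_ xs. tl xs) (k x)) else d x)"
    by (intro comp_intros assms)
  moreover have "rec_nat l (\<lambda>_ xs. tl xs) k = drop k l" for l :: "'b list" and k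
    by (induction k) (auto simp: drop_Suc tl_drop)
  ultimately show ?thesis
    by (simp add: hd_drop_conv_nth cong: if_cong)
qed

lemma computable_upt [comp_intros]:
  assumes "computable k"
  shows "computable (\<lambda>x. [0..<k x])"
proof -
  have "computable (\<lambda>x. rec_nat [] (\<lambda>n xs. xs @ [n]) (k x))"
    by (intro comp_intros assms)
  moreover have "rec_nat [] (\<lambda>n xs. xs @ [n]) k = [0..<k]" for k
    by (induction k) auto
  ultimately show ?thesis by simp
qed

lemma computable_funpow [comp_intros]:
  fixes f :: "'a::enc \<Rightarrow> 'b::enc \<Rightarrow> 'b"
  assumes "computable (\<lambda>z. f (fst z) (snd z))" "computable k" "computable a"
  shows "computable (\<lambda>x. ((\<lambda>y. f x y) ^^ k x) (a x))"
proof -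
  have "computable (\<lambda>x. rec_nat (a x) (\<lambda>_ y. f x y) (k x))"
    using computable_comp[OF assms(1), of "\<lambda>z. (fst z, snd (snd z))"]
    by (intro comp_intros assms) (simp add: comp_intros)
  moreover have "rec_nat b (\<lambda>_ y. h y) k = (h ^^ k) b" for b and h :: "'b \<Rightarrow> 'b" and k
    by (induction k) auto
  ultimately show ?thesis by simp
qed

section \<open>Words and presented groups\<close>

definition eval_letter :: "('a, 'b) monoid_scheme \<Rightarrow> (nat \<Rightarrow> 'a) \<Rightarrow> letter \<Rightarrow> 'a" where
  "eval_letter G a l = (if snd l then inv\<^bsub>G\<^esub> a (fst l) else a (fst l))"

definition eval_word :: "('a, 'b) monoid_scheme \<Rightarrow> (nat \<Rightarrow> 'a) \<Rightarrow> word \<Rightarrow> 'a" where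
  "eval_word G a w = foldr (\<lambda>l x. eval_letter G a l \<otimes>\<^bsub>G\<^esub> x) w \<one>\<^bsub>G\<^esub>"

definition subst :: "(nat \<Rightarrow> word) \<Rightarrow> word \<Rightarrow> word" where
  "subst v w = concat (map (\<lambda>l. if snd l then inv_word (v (fst l)) else v (fst l)) w)"

lemma eval_word_simps [simp]:
  "eval_word G a [] = \<one>\<^bsub>G\<^esub>" "eval_word G a (l # w) = eval_letter G a l \<otimes>\<^bsub>G\<^esub> eval_word G a w"
  by (simp_all add: eval_word_def)

lemma subst_simps [simp]:
  "subst v [] = []" "subst v ((i, b) # w) = (if b then inv_word (v i) else v i) @ subst v w"
  "subst v (w @ w') = subst v w @ subst v w'"
  by (simp_all add: subst_def)

lemma inv_word_simps [simp]:
  "inv_word [] = []" "inv_word (u @ v) = inv_word v @ inv_word u" "inv_word (inv_word w) = w"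
  "inv_word (a # w) = inv_word w @ [inv_letter a]"
  by (simp_all add: inv_word_def rev_map comp_def)

lemma words_simps [simp]:
  "[] \<in> words n" "a # w \<in> words n \<longleftrightarrow> fst a < n \<and> w \<in> words n"
  "u @ v \<in> words n \<longleftrightarrow> u \<in> words n \<and> v \<in> words n" "inv_word w \<in> words n \<longleftrightarrow> w \<in> words n"
  by (auto simp: words_def inv_word_def)

lemma reduce_in_words: "w \<in> words n \<Longrightarrow> reduce w \<in> words n"
  using set_reduce[of w] by (auto simp: words_def)

lemma subst_in_words: "w \<in> words n \<Longrightarrow> (\<And>i. i < n \<Longrightarrow> v i \<in> words k) \<Longrightarrow> subst v w \<in> words k"
  by (induction w) (auto simp: subst_def)

lemma subst_id [simp]: "subst (\<lambda>i. [(i, False)]) w = w"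
  by (induction w) (auto simp: inv_letter_def)

lemma reduced_simps [simp]: "reduced []" "reduced [a]"
  by (simp_all add: reduced_def)

lemma carrier_free_group: "carrier (free_group n) = {w \<in> words n. reduced w}"
  by (simp add: free_group_def)

lemma free_group_simps [simp]:
  "u \<otimes>\<^bsub>free_group n\<^esub> v = reduce (u @ v)" "\<one>\<^bsub>free_group n\<^esub> = []"
  by (simp_all add: free_group_def)

lemma reduce_carrier [simp]: "w \<in> words n \<Longrightarrow> reduce w \<in> carrier (free_group n)"
  by (simp add: carrier_free_group reduced_reduce reduce_in_words)

lemma reduce_inv_word': "reduce (w @ inv_word w) = []"
  using reduce_inv_word[of "inv_word w"] by simp

lemma reduce_cancel [simp]:
  "reduce (inv_word u @ u @ y) = reduce y" "reduce (x @ inv_word u @ u @ y) = reduce (x @ y)"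
  "reduce (u @ inv_word u @ y) = reduce y"
proof -
  show *: "reduce (inv_word u @ u @ y) = reduce y" for u y
    using reduce_append_left[of "inv_word u @ u" y] by (simp add: reduce_inv_word)
  show "reduce (x @ inv_word u @ u @ y) = reduce (x @ y)"
    by (metis * reduce_append)
  show "reduce (u @ inv_word u @ y) = reduce y"
    using *[of "inv_word u"] by simp
qed

lemma inv_free_group:
  assumes "w \<in> carrier (free_group n)"
  shows "inv\<^bsub>free_group n\<^esub> w = reduce (inv_word w)"
  by (rule group.inv_equality[OF group_free_group])
    (use assms in \<open>auto simp: reduce_append_left reduce_inv_word carrier_free_group
      reduced_reduce reduce_in_words\<close>)

context group
begin

lemma eval_letter_closed [simp]:
  "a \<in> {..<n} \<rightarrow> carrier G \<Longrightarrow> fst l < n \<Longrightarrow> eval_letter G a l \<in> carrier G"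
  by (auto simp: eval_letter_def Pi_def)

lemma eval_word_closed [simp]:
  "a \<in> {..<n} \<rightarrow> carrier G \<Longrightarrow> w \<in> words n \<Longrightarrow> eval_word G a w \<in> carrier G"
  by (induction w) auto

lemma eval_word_append:
  "a \<in> {..<n} \<rightarrow> carrier G \<Longrightarrow> u \<in> words n \<Longrightarrow> v \<in> words n \<Longrightarrow>
    eval_word G a (u @ v) = eval_word G a u \<otimes> eval_word G a v"
  by (induction u) (auto simp: m_assoc)

lemma eval_letter_inv:
  "a \<in> {..<n} \<rightarrow> carrier G \<Longrightarrow> fst l < n \<Longrightarrow> eval_letter G a (inv_letter l) = inv eval_letter G a l"
  by (auto simp: eval_letter_def inv_letter_def Pi_def)

lemma eval_word_inv_word:
  "a \<in> {..<n} \<rightarrow> carrier G \<Longrightarrow> w \<in> words n \<Longrightarrow> eval_word G a (inv_word w) = inv eval_word G a w"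
  by (induction w) (auto simp: eval_word_append eval_letter_inv inv_mult_group)

lemma eval_word_reduce:
  assumes a: "a \<in> {..<n} \<rightarrow> carrier G" and w: "w \<in> words n"
  shows "eval_word G a (reduce w) = eval_word G a w"
  using w
proof (induction w)
  case (Cons l w)
  have *: "eval_word G a (cons_reduce l u) = eval_letter G a l \<otimes> eval_word G a u"
    if "u \<in> words n" for u
  proof (cases "u \<noteq> [] \<and> hd u = inv_letter l")
    case True
    then obtain v where v: "u = inv_letter l # v" by (cases u) auto
    have "eval_letter G a l \<in> carrier G" "eval_word G a v \<in> carrier G"
      using a Cons.prems that v by auto
    then show ?thesis
      using a Cons.prems by (simp add: v eval_letter_inv m_assoc[symmetric])
  next
    case False
    then show ?thesis by (cases u) auto
  qed
  have "reduce w \<in> words n" using Cons.prems by (simp add: reduce_in_words)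
  from *[OF this] Cons show ?case by (simp add: reduce_def)
qed (simp add: reduce_def)

lemma eval_word_hom: "a \<in> {..<n} \<rightarrow> carrier G \<Longrightarrow> eval_word G a \<in> hom (free_group n) G"
  by (rule homI) (auto simp: carrier_free_group eval_word_reduce eval_word_append)

lemma eval_word_subst:
  assumes a: "a \<in> {..<k} \<rightarrow> carrier G" and v: "\<And>i. i < n \<Longrightarrow> v i \<in> words k" and w: "w \<in> words n"
  shows "eval_word G a (subst v w) = eval_word G (\<lambda>i. eval_word G a (v i)) w"
  using w
proof (induction w)
  case (Cons l w)
  then have "subst v w \<in> words k" using v by (auto intro: subst_in_words)
  with Cons show ?case
    using a v by (cases l) (auto simp: eval_word_append eval_word_inv_word eval_letter_def)
qed simp

lemma hom_eval_word:
  assumes h: "h \<in> hom G K" and K: "group K" and a: "a \<in> {..<n} \<rightarrow> carrier G" and w: "w \<in> words n"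
  shows "h (eval_word G a w) = eval_word K (\<lambda>i. h (a i)) w"
proof -
  interpret gh: group_hom G K h
    using h K by (simp add: group_hom_def group_hom_axioms_def)
  have "h (eval_letter G a l) = eval_letter K (\<lambda>i. h (a i)) l" if "fst l < n" for l
    using a that by (auto simp: eval_letter_def Pi_def)
  then show ?thesis
    using w a by (induction w) auto
qed

end

lemma eval_word_cong: "w \<in> words n \<Longrightarrow> (\<And>i. i < n \<Longrightarrow> a i = b i) \<Longrightarrow> eval_word G a w = eval_word G b w"
  by (induction w) (auto simp: eval_letter_def)

lemma free_gen_closed: "(\<lambda>i. [(i, False)]) \<in> {..<n} \<rightarrow> carrier (free_group n)"
  by (auto simp: carrier_free_group)

lemma reduce_Cons: "reduce (a # w) = cons_reduce a (reduce w)"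
  by (simp add: reduce_def)

lemma reduce_singleton [simp]: "reduce [a] = [a]" "reduce [] = []"
  by (simp_all add: reduce_def)

text \<open>Evaluation at the free generators is reduction. With \<open>hom_eval_word\<close> this
  says that a homomorphism on the free group is determined by its values on the generators.\<close>

lemma eval_word_free:
  assumes "w \<in> words n"
  shows "eval_word (free_group n) (\<lambda>i. [(i, False)]) w = reduce w"
  using assms
proof (induction w)
  case (Cons l w)
  have "eval_letter (free_group n) (\<lambda>i. [(i, False)]) l = [l]"
    using Cons.prems by (cases l) (auto simp: eval_letter_def inv_free_group carrier_free_group inv_letter_def)
  with Cons show ?case by (simp add: reduce_append_right del: append_Cons) (simp add: reduce_append_right)
qed simp

abbreviation gen :: "presentation \<Rightarrow> nat \<Rightarrow> word set" where
  "gen P i \<equiv> word_elem P [(i, False)]"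

lemma relators_in_carrier:
  "P \<in> presentations \<Longrightarrow> reduce ` set (snd P) \<subseteq> carrier (free_group (fst P))"
  by (auto simp: presentations_def)

lemma relators_closure_normal:
  "P \<in> presentations \<Longrightarrow> relators_closure P \<lhd> free_group (fst P)"
  unfolding relators_closure_def
  by (intro normal_normal_closure group_free_group relators_in_carrier)

context
  fixes P assumes P: "P \<in> presentations"
begin

interpretation N: normal "relators_closure P" "free_group (fst P)"
  by (rule relators_closure_normal[OF P])

lemma word_elem_hom:
  "(\<lambda>x. relators_closure P #>\<^bsub>free_group (fst P)\<^esub> x) \<in> hom (free_group (fst P)) (presented_group P)"
  unfolding presented_group_def by (rule N.r_coset_hom_Mod)

lemma gen_closed: "gen P \<in> {..<fst P} \<rightarrow> carrier (presented_group P)"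
  using hom_in_carrier[OF word_elem_hom] by (auto simp: word_elem_def carrier_free_group)

lemma word_elem_eval:
  assumes "w \<in> words (fst P)"
  shows "word_elem P w = eval_word (presented_group P) (gen P) w"
proof -
  have "word_elem P w = relators_closure P #>\<^bsub>free_group (fst P)\<^esub>
      eval_word (free_group (fst P)) (\<lambda>i. [(i, False)]) w"
    by (simp add: word_elem_def eval_word_free assms)
  also have "\<dots> = eval_word (presented_group P) (gen P) w"
    by (subst N.hom_eval_word[OF word_elem_hom group_presented_group[OF P] free_gen_closed assms])
      (simp add: word_elem_def)
  finally show ?thesis .
qed

lemma word_elem_closed: "w \<in> words (fst P) \<Longrightarrow> word_elem P w \<in> carrier (presented_group P)"
  using word_elem_hom by (auto simp: word_elem_def hom_def)

lemma word_elem_surj: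
  assumes "g \<in> carrier (presented_group P)"
  obtains w where "w \<in> words (fst P)" "g = word_elem P w"
proof -
  obtain w where "w \<in> carrier (free_group (fst P))" "g = relators_closure P #>\<^bsub>free_group (fst P)\<^esub> w"
    using assms by (auto simp: presented_group_def FactGroup_def RCOSETS_def)
  then show ?thesis
    by (intro that[of w]) (auto simp: word_elem_def carrier_free_group reduce_reduced)
qed

lemma word_elem_eq_one_iff:
  assumes "w \<in> words (fst P)"
  shows "word_elem P w = \<one>\<^bsub>presented_group P\<^esub> \<longleftrightarrow> reduce w \<in> relators_closure P"
proof -
  have "\<one>\<^bsub>presented_group P\<^esub> = relators_closure P" by (simp add: presented_group_def)
  then show ?thesis
    using N.coset_join1[OF _ reduce_carrier[OF assms] N.subgroup_axioms]
      N.coset_join2[OF reduce_carrier[OF assms] N.subgroup_axioms]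
    by (auto simp: word_elem_def)
qed

lemma relators_closure_least:
  assumes "M \<lhd> free_group (fst P)" "\<And>r. r \<in> set (snd P) \<Longrightarrow> reduce r \<in> M"
  shows "relators_closure P \<subseteq> M"
  using assms by (auto simp: relators_closure_def normal_closure_def)

lemma relator_trivial:
  assumes "r \<in> set (snd P)"
  shows "word_elem P r = \<one>\<^bsub>presented_group P\<^esub>"
  using assms P by (subst word_elem_eq_one_iff)
    (auto simp: presentations_def relators_closure_def normal_closure_def)

text \<open>Von Dyck's theorem: evaluation at \<open>b\<close> is a homomorphism on the free group,
  and its kernel is normal and contains the relators, hence their normal closure.\<close>

lemma presented_hom:
  assumes Q: "group Q" and b: "b \<in> {..<fst P} \<rightarrow> carrier Q"
    and rel: "\<And>r. r \<in> set (snd P) \<Longrightarrow> eval_word Q b r = \<one>\<^bsub>Q\<^esub>"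
  obtains h where "h \<in> hom (presented_group P) Q"
    "\<And>w. w \<in> words (fst P) \<Longrightarrow> h (word_elem P w) = eval_word Q b w"
proof -
  interpret Q: group Q by fact
  interpret G: group "presented_group P" by (rule group_presented_group[OF P])
  interpret h: group_hom "free_group (fst P)" Q "eval_word Q b"
    using Q.eval_word_hom[OF b] Q by (simp add: group_hom_def group_hom_axioms_def group_free_group)
  have "relators_closure P \<subseteq> kernel (free_group (fst P)) Q (eval_word Q b)"
  proof (rule relators_closure_least)
    show "kernel (free_group (fst P)) Q (eval_word Q b) \<lhd> free_group (fst P)"
      by (rule h.normal_kernel)
    show "reduce r \<in> kernel (free_group (fst P)) Q (eval_word Q b)" if "r \<in> set (snd P)" for r
      using that P rel by (auto simp: kernel_def presentations_def Q.eval_word_reduce[OF b])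
  qed
  then have triv: "eval_word Q b w = \<one>\<^bsub>Q\<^esub>"
    if "w \<in> words (fst P)" "word_elem P w = \<one>\<^bsub>presented_group P\<^esub>" for w
    using that by (auto simp: word_elem_eq_one_iff kernel_def Q.eval_word_reduce[OF b])
  have eq: "eval_word Q b u = eval_word Q b v"
    if uv: "u \<in> words (fst P)" "v \<in> words (fst P)" and e: "word_elem P u = word_elem P v" for u v
  proof -
    have "word_elem P (u @ inv_word v) = \<one>\<^bsub>presented_group P\<^esub>"
      using uv e gen_closed
      by (simp add: word_elem_eval G.eval_word_append G.eval_word_inv_word)
    then have "eval_word Q b (u @ inv_word v) = \<one>\<^bsub>Q\<^esub>" using uv by (intro triv) auto
    then have "eval_word Q b u \<otimes>\<^bsub>Q\<^esub> inv\<^bsub>Q\<^esub> eval_word Q b v = \<one>\<^bsub>Q\<^esub>"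
      using uv b by (simp add: Q.eval_word_append Q.eval_word_inv_word)
    from Q.inv_equality[OF this] show ?thesis
      using uv b by simp
  qed
  \<comment> \<open>The value is computed from a chosen representing word; \<open>eq\<close> makes
    it independent of the choice.\<close>
  define h where "h g = eval_word Q b (SOME w. w \<in> words (fst P) \<and> g = word_elem P w)" for g
  have h: "h (word_elem P w) = eval_word Q b w" if "w \<in> words (fst P)" for w
  proof -
    have "(SOME w'. w' \<in> words (fst P) \<and> word_elem P w = word_elem P w') \<in> words (fst P) \<and>
        word_elem P w = word_elem P (SOME w'. w' \<in> words (fst P) \<and> word_elem P w = word_elem P w')"
      by (rule someI_ex) (use that in blast)
    then show ?thesis using that eq unfolding h_def by metis
  qed
  have "h \<in> hom (presented_group P) Q"
  proof (rule homI)
    show "h g \<in> carrier Q" if "g \<in> carrier (presented_group P)" for g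
      using word_elem_surj[OF that] h b by (metis Q.eval_word_closed)
    fix g g' assume "g \<in> carrier (presented_group P)" "g' \<in> carrier (presented_group P)"
    then obtain w w' where w: "w \<in> words (fst P)" "g = word_elem P w" "w' \<in> words (fst P)" "g' = word_elem P w'"
      by (metis word_elem_surj)
    then have "g \<otimes>\<^bsub>presented_group P\<^esub> g' = word_elem P (w @ w')"
      by (simp add: word_elem_eval G.eval_word_append[OF gen_closed])
    then show "h (g \<otimes>\<^bsub>presented_group P\<^esub> g') = h g \<otimes>\<^bsub>Q\<^esub> h g'"
      using w b by (simp add: h Q.eval_word_append)
  qed
  with h show ?thesis using that by blast
qed

end

section \<open>Derivations\<close>

text \<open>A product of conjugates of relators and of their inverses. The list of pairs of
  conjugator and relator is a finite certificate that a word is trivial in the presented group,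
  which makes triviality accessible to a search.\<close>

definition derived_word :: "(word \<times> word) list \<Rightarrow> word" where
  "derived_word d = concat (map (\<lambda>p. fst p @ snd p @ inv_word (fst p)) d)"

definition derivation :: "presentation \<Rightarrow> (word \<times> word) list \<Rightarrow> bool" where
  "derivation P d \<longleftrightarrow> (\<forall>p\<in>set d. (\<forall>a\<in>set (fst p). fst a < fst P) \<and>
     (snd p \<in> set (snd P) \<or> inv_word (snd p) \<in> set (snd P)))"

lemma derivation_words: "P \<in> presentations \<Longrightarrow> derivation P d \<Longrightarrow> derived_word d \<in> words (fst P)"
proof (induction d)
  case (Cons p d)
  then have "snd p \<in> words (fst P) \<or> inv_word (snd p) \<in> words (fst P)"
    by (auto simp: derivation_def presentations_def)
  with Cons show ?case
    by (auto simp: derivation_def derived_word_def) (auto simp: words_def)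
qed (simp add: derived_word_def)

lemma derived_word_append: "derived_word (c @ d) = derived_word c @ derived_word d"
  by (simp add: derived_word_def)

lemma inv_derived_word:
  "derivation P d \<Longrightarrow> \<exists>e. derivation P e \<and> derived_word e = inv_word (derived_word d)"
proof (induction d)
  case (Cons p d)
  then obtain e where "derivation P e" "derived_word e = inv_word (derived_word d)"
    by (auto simp: derivation_def)
  with Cons.prems show ?case
    by (intro exI[of _ "e @ [(fst p, inv_word (snd p))]"]) (auto simp: derivation_def derived_word_def)
qed (auto simp: derivation_def derived_word_def intro: exI[of _ "[]"])

text \<open>Prefixing \<open>u\<close> to every conjugator conjugates the product, up to
  cancellation of \<open>inv_word u @ u\<close> between consecutive factors; hence an equation of
  reduced words only.\<close>

lemma conj_derived_word:
  assumes "u \<in> words (fst P)"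
  shows "derivation P d \<Longrightarrow>
    \<exists>e. derivation P e \<and> reduce (derived_word e) = reduce (u @ derived_word d @ inv_word u)"
proof (induction d)
  case Nil
  show ?case
    by (rule exI[of _ "[]"]) (simp add: derivation_def derived_word_def reduce_inv_word')
next
  case (Cons p d)
  then obtain e where e: "derivation P e" "reduce (derived_word e) = reduce (u @ derived_word d @ inv_word u)"
    by (auto simp: derivation_def)
  have "reduce (derived_word ((u @ fst p, snd p) # e)) =
      reduce (u @ fst p @ snd p @ inv_word (fst p) @ inv_word u @ reduce (derived_word e))"
    by (simp add: derived_word_def reduce_append_right flip: append_assoc)
  also have "\<dots> = reduce ((u @ fst p @ snd p @ inv_word (fst p)) @ inv_word u @ u @ derived_word d @ inv_word u)"
    unfolding e by (simp only: reduce_append_right append_assoc flip: reduce_append) (metis reduce_append_right)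
  also have "\<dots> = reduce (u @ derived_word (p # d) @ inv_word u)"
    using reduce_cancel(2)[of "u @ fst p @ snd p @ inv_word (fst p)" u] by (simp add: derived_word_def)
  finally show ?case
    using e Cons.prems assms
    by (intro exI[of _ "(u @ fst p, snd p) # e"]) (auto simp: derivation_def words_def)
qed

text \<open>The reduced derived words form a normal subgroup containing the relators, so it contains
  the normal closure. Conversely every factor of a derived word becomes trivial in the
  quotient.\<close>

lemma word_elem_eq_one_iff_derivation:
  assumes P: "P \<in> presentations" and w: "w \<in> words (fst P)"
  shows "word_elem P w = \<one>\<^bsub>presented_group P\<^esub> \<longleftrightarrow>
    (\<exists>d. derivation P d \<and> reduce (derived_word d) = reduce w)"
proof
  interpret F: group "free_group (fst P)" by (rule group_free_group)
  interpret G: group "presented_group P" by (rule group_presented_group[OF P])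
  note a = gen_closed[OF P]
  define M where "M = {reduce (derived_word d) |d. derivation P d}"
  have "M \<lhd> free_group (fst P)"
  proof (rule F.normal_invI)
    show "subgroup M (free_group (fst P))"
    proof (rule F.subgroupI)
      show "M \<subseteq> carrier (free_group (fst P))"
        using derivation_words[OF P] by (auto simp: M_def)
      have "reduce (derived_word []) \<in> M" unfolding M_def by (auto simp: derivation_def)
      then show "M \<noteq> {}" by auto
      fix x assume "x \<in> M"
      then obtain d where d: "derivation P d" "x = reduce (derived_word d)" by (auto simp: M_def)
      then obtain e where e: "derivation P e" "derived_word e = inv_word (derived_word d)"
        using inv_derived_word by blast
      have "inv\<^bsub>free_group (fst P)\<^esub> x = reduce (derived_word e)"
      proof (rule F.inv_equality)
        show "reduce (derived_word e) \<otimes>\<^bsub>free_group (fst P)\<^esub> x = \<one>\<^bsub>free_group (fst P)\<^esub>"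
          by (simp add: d e reduce_append_left reduce_append_right reduce_inv_word)
      qed (use d e derivation_words[OF P] in auto)
      with e(1) show "inv\<^bsub>free_group (fst P)\<^esub> x \<in> M" unfolding M_def by blast
      fix y assume "y \<in> M"
      then obtain c where c: "derivation P c" "y = reduce (derived_word c)" by (auto simp: M_def)
      have "x \<otimes>\<^bsub>free_group (fst P)\<^esub> y = reduce (derived_word (d @ c))"
        by (simp add: d c reduce_append_left reduce_append_right derived_word_append)
      moreover have "derivation P (d @ c)" using c d by (auto simp: derivation_def)
      ultimately show "x \<otimes>\<^bsub>free_group (fst P)\<^esub> y \<in> M" by (auto simp: M_def)
    qed
    fix x u assume u: "u \<in> carrier (free_group (fst P))" and "x \<in> M"
    then obtain d where d: "derivation P d" "x = reduce (derived_word d)" by (auto simp: M_def)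
    have "u \<in> words (fst P)" using u by (simp add: carrier_free_group)
    from conj_derived_word[OF this d(1)] obtain e
      where "derivation P e" "reduce (derived_word e) = reduce (u @ derived_word d @ inv_word u)"
      by blast
    moreover have "u \<otimes>\<^bsub>free_group (fst P)\<^esub> x \<otimes>\<^bsub>free_group (fst P)\<^esub> inv\<^bsub>free_group (fst P)\<^esub> u =
        reduce (u @ derived_word d @ inv_word u)"
      by (simp add: inv_free_group[OF u] d reduce_append_left reduce_append_right)
    ultimately show "u \<otimes>\<^bsub>free_group (fst P)\<^esub> x \<otimes>\<^bsub>free_group (fst P)\<^esub> inv\<^bsub>free_group (fst P)\<^esub> u \<in> M"
      unfolding M_def by (smt (verit) mem_Collect_eq)
  qed
  moreover have "reduce r \<in> M" if "r \<in> set (snd P)" for r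
    using that unfolding M_def
    by (intro CollectI exI[of _ "[([], r)]"]) (simp add: derivation_def derived_word_def)
  ultimately have "relators_closure P \<subseteq> M" by (rule relators_closure_least[OF P])
  moreover assume "word_elem P w = \<one>\<^bsub>presented_group P\<^esub>"
  ultimately have "reduce w \<in> M" using word_elem_eq_one_iff[OF P w] by auto
  then show "\<exists>d. derivation P d \<and> reduce (derived_word d) = reduce w"
    by (auto simp: M_def)
next
  interpret G: group "presented_group P" by (rule group_presented_group[OF P])
  note a = gen_closed[OF P]
  assume "\<exists>d. derivation P d \<and> reduce (derived_word d) = reduce w"
  then obtain d where d: "derivation P d" "reduce (derived_word d) = reduce w" by blast
  have triv: "eval_word (presented_group P) (gen P) r = \<one>\<^bsub>presented_group P\<^esub>" if "r \<in> set (snd P)" for r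
    using relator_trivial[OF P that] that P by (subst word_elem_eval[OF P, symmetric]) (auto simp: presentations_def)
  have "eval_word (presented_group P) (gen P) (derived_word d) = \<one>\<^bsub>presented_group P\<^esub>"
    using d(1)
  proof (induction d)
    case (Cons p d)
    have p: "fst p \<in> words (fst P)" "snd p \<in> words (fst P)" and d: "derivation P d"
      using Cons.prems P words_simps(4)[of "snd p"]
      by (auto simp: derivation_def presentations_def simp del: words_simps(4)) (auto simp: words_def)
    have "eval_word (presented_group P) (gen P) (snd p) = \<one>\<^bsub>presented_group P\<^esub>"
    proof (cases "snd p \<in> set (snd P)")
      case False
      then have "inv_word (snd p) \<in> set (snd P)" using Cons.prems by (auto simp: derivation_def)
      from triv[OF this] show ?thesis
        using p a by (simp add: G.eval_word_inv_word)
    qed (rule triv)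
    with p d Cons.IH a show ?case
      using derivation_words[OF P d]
      by (simp add: derived_word_def G.eval_word_append G.eval_word_inv_word)
  qed (simp add: derived_word_def)
  then have "word_elem P (derived_word d) = \<one>\<^bsub>presented_group P\<^esub>"
    using derivation_words[OF P d(1)] by (simp add: word_elem_eval[OF P])
  then show "word_elem P w = \<one>\<^bsub>presented_group P\<^esub>"
    by (simp add: word_elem_def d(2))
qed

lemma word_elem_subst:
  assumes T: "T \<in> presentations" and u: "\<And>i. i < n \<Longrightarrow> u i \<in> words (fst T)" and w: "w \<in> words n"
  shows "word_elem T (subst u w) = eval_word (presented_group T) (\<lambda>i. word_elem T (u i)) w"
proof -
  have "word_elem T (subst u w) =
      eval_word (presented_group T) (\<lambda>i. eval_word (presented_group T) (gen T) (u i)) w"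
    using group.eval_word_subst[OF group_presented_group[OF T] gen_closed[OF T] u w]
    by (simp add: word_elem_eval[OF T] subst_in_words[OF w u])
  also have "\<dots> = eval_word (presented_group T) (\<lambda>i. word_elem T (u i)) w"
    by (rule eval_word_cong[OF w]) (simp add: word_elem_eval[OF T] u)
  finally show ?thesis .
qed

lemma word_elem_cancel_gen:
  assumes P: "P \<in> presentations" and w: "w \<in> words (fst P)" and i: "i < fst P"
  shows "word_elem P (w @ [(i, True)]) = \<one>\<^bsub>presented_group P\<^esub> \<longleftrightarrow> word_elem P w = gen P i"
proof -
  interpret G: group "presented_group P" by (rule group_presented_group[OF P])
  have g: "gen P i \<in> carrier (presented_group P)" "word_elem P w \<in> carrier (presented_group P)"
    using i w by (auto intro: word_elem_closed[OF P])
  have "word_elem P (w @ [(i, True)]) = word_elem P w \<otimes>\<^bsub>presented_group P\<^esub> inv\<^bsub>presented_group P\<^esub> gen P i"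
    using i w g G.eval_word_append[OF gen_closed[OF P], of w "[(i, True)]"]
    by (simp add: word_elem_eval[OF P, of w] word_elem_eval[OF P, of "w @ [(i, True)]"] eval_letter_def)
  then show ?thesis
    using g G.inv_equality[of "word_elem P w" "inv\<^bsub>presented_group P\<^esub> gen P i"] by auto
qed

lemma presented_hom_subst:
  assumes P: "P \<in> presentations" and T: "T \<in> presentations"
    and u: "\<And>i. i < fst P \<Longrightarrow> u i \<in> words (fst T)"
  shows "(\<exists>h\<in>hom (presented_group P) (presented_group T).
      \<forall>w\<in>words (fst P). h (word_elem P w) = word_elem T (subst u w)) \<longleftrightarrow>
    (\<forall>r\<in>set (snd P). word_elem T (subst u r) = \<one>\<^bsub>presented_group T\<^esub>)"
proof
  have rel: "r \<in> words (fst P)" if "r \<in> set (snd P)" for r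
    using P that by (auto simp: presentations_def)
  show "\<forall>r\<in>set (snd P). word_elem T (subst u r) = \<one>\<^bsub>presented_group T\<^esub>"
    if "\<exists>h\<in>hom (presented_group P) (presented_group T).
      \<forall>w\<in>words (fst P). h (word_elem P w) = word_elem T (subst u w)"
    using that rel relator_trivial[OF P]
      hom_one[OF _ group_presented_group[OF P] group_presented_group[OF T]] by metis
  assume "\<forall>r\<in>set (snd P). word_elem T (subst u r) = \<one>\<^bsub>presented_group T\<^esub>"
  then show "\<exists>h\<in>hom (presented_group P) (presented_group T).
      \<forall>w\<in>words (fst P). h (word_elem P w) = word_elem T (subst u w)"
    using presented_hom[OF P group_presented_group[OF T], of "\<lambda>i. word_elem T (u i)"]
      word_elem_closed[OF T] u rel word_elem_subst[OF T, of "fst P" u] by (metis (no_types, lifting) Pi_I lessThan_iff)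
qed

lemma hom_word_elem:
  assumes P: "P \<in> presentations" and T: "T \<in> presentations"
    and h: "h \<in> hom (presented_group P) (presented_group T)"
    and u: "\<And>i. i < fst P \<Longrightarrow> u i \<in> words (fst T)" "\<And>i. i < fst P \<Longrightarrow> h (gen P i) = word_elem T (u i)"
    and w: "w \<in> words (fst P)"
  shows "h (word_elem P w) = word_elem T (subst u w)"
  using group.hom_eval_word[OF group_presented_group[OF P] h group_presented_group[OF T] gen_closed[OF P] w]
    word_elem_subst[OF T u(1) w]
  by (simp add: word_elem_eval[OF P w]) (auto intro!: eval_word_cong[OF w] simp: u(2))

text \<open>An isomorphism becomes finite data: words for the images of the generators in both
  directions, and a finite list of words that have to be trivial. These express that relators are
  respected and that both composites fix each generator; the latter equation is written as a word
  followed by the inverse generator, so that triviality is the only kind of condition and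
  derivations can certify all of it.\<close>

lemma presented_group_iso_iff:
  assumes P: "P \<in> presentations" and T: "T \<in> presentations"
  shows "presented_group P \<cong> presented_group T \<longleftrightarrow> (\<exists>u v.
    (\<forall>i<fst P. u i \<in> words (fst T)) \<and> (\<forall>i<fst T. v i \<in> words (fst P)) \<and>
    (\<forall>r\<in>set (snd P). word_elem T (subst u r) = \<one>\<^bsub>presented_group T\<^esub>) \<and>
    (\<forall>r\<in>set (snd T). word_elem P (subst v r) = \<one>\<^bsub>presented_group P\<^esub>) \<and>
    (\<forall>i<fst P. word_elem P (subst v (u i) @ [(i, True)]) = \<one>\<^bsub>presented_group P\<^esub>) \<and>
    (\<forall>i<fst T. word_elem T (subst u (v i) @ [(i, True)]) = \<one>\<^bsub>presented_group T\<^esub>))"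
  (is "?L \<longleftrightarrow> (\<exists>u v. ?R u v)")
proof
  interpret G: group "presented_group P" by (rule group_presented_group[OF P])
  interpret H: group "presented_group T" by (rule group_presented_group[OF T])
  have gens: "gen P i \<in> carrier (presented_group P)" if "i < fst P" for i
    using that by (auto intro: word_elem_closed[OF P])
  have gens': "gen T i \<in> carrier (presented_group T)" if "i < fst T" for i
    using that by (auto intro: word_elem_closed[OF T])
  {
    assume ?L
    then obtain h where h: "h \<in> iso (presented_group P) (presented_group T)"
      by (auto simp: is_iso_def)
    define k where "k = inv_into (carrier (presented_group P)) h"
    have k: "k \<in> iso (presented_group T) (presented_group P)"
      unfolding k_def by (rule G.iso_set_sym[OF h])
    have kh: "k (h x) = x" if "x \<in> carrier (presented_group P)" for x
      using h that by (auto simp: k_def iso_def bij_betw_def)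
    have hk: "h (k y) = y" if "y \<in> carrier (presented_group T)" for y
      using h that by (auto simp: k_def iso_def bij_betw_def f_inv_into_f)
    have hom: "h \<in> hom (presented_group P) (presented_group T)" "k \<in> hom (presented_group T) (presented_group P)"
      using h k by (auto simp: iso_def)
    have "\<exists>w. w \<in> words (fst T) \<and> h (gen P i) = word_elem T w" if "i < fst P" for i
      using hom_in_carrier[OF hom(1) gens[OF that]] word_elem_surj[OF T] by metis
    then obtain u where u: "\<And>i. i < fst P \<Longrightarrow> u i \<in> words (fst T)"
      "\<And>i. i < fst P \<Longrightarrow> h (gen P i) = word_elem T (u i)" by metis
    have "\<exists>w. w \<in> words (fst P) \<and> k (gen T i) = word_elem P w" if "i < fst T" for i
      using hom_in_carrier[OF hom(2) gens'[OF that]] word_elem_surj[OF P] by metis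
    then obtain v where v: "\<And>i. i < fst T \<Longrightarrow> v i \<in> words (fst P)"
      "\<And>i. i < fst T \<Longrightarrow> k (gen T i) = word_elem P (v i)" by metis
    have hu: "h (word_elem P w) = word_elem T (subst u w)" if "w \<in> words (fst P)" for w
      by (rule hom_word_elem[OF P T hom(1) u that])
    have kv: "k (word_elem T w) = word_elem P (subst v w)" if "w \<in> words (fst T)" for w
      by (rule hom_word_elem[OF T P hom(2) v that])
    have 1: "\<forall>r\<in>set (snd P). word_elem T (subst u r) = \<one>\<^bsub>presented_group T\<^esub>"
      using presented_hom_subst[OF P T, of u] u(1) hu hom(1) by blast
    have 2: "\<forall>r\<in>set (snd T). word_elem P (subst v r) = \<one>\<^bsub>presented_group P\<^esub>"
      using presented_hom_subst[OF T P, of v] v(1) kv hom(2) by blast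
    have 3: "word_elem P (subst v (u i) @ [(i, True)]) = \<one>\<^bsub>presented_group P\<^esub>" if i: "i < fst P" for i
    proof -
      have "word_elem P (subst v (u i)) = gen P i"
        using kv[OF u(1)[OF i]] u(2)[OF i] kh[OF gens[OF i]] by simp
      then show ?thesis
        using word_elem_cancel_gen[OF P subst_in_words[OF u(1)[OF i], of v] i] v(1) by simp
    qed
    have 4: "word_elem T (subst u (v i) @ [(i, True)]) = \<one>\<^bsub>presented_group T\<^esub>" if i: "i < fst T" for i
    proof -
      have "word_elem T (subst u (v i)) = gen T i"
        using hu[OF v(1)[OF i]] v(2)[OF i] hk[OF gens'[OF i]] by simp
      then show ?thesis
        using word_elem_cancel_gen[OF T subst_in_words[OF v(1)[OF i], of u] i] u(1) by simp
    qed
    show "\<exists>u v. ?R u v" using u(1) v(1) 1 2 3 4 by blast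
  }
  assume "\<exists>u v. ?R u v"
  then obtain u v where R: "?R u v" by blast
  then have u: "\<And>i. i < fst P \<Longrightarrow> u i \<in> words (fst T)" and v: "\<And>i. i < fst T \<Longrightarrow> v i \<in> words (fst P)"
    by auto
  obtain h where h: "h \<in> hom (presented_group P) (presented_group T)"
    "\<And>w. w \<in> words (fst P) \<Longrightarrow> h (word_elem P w) = word_elem T (subst u w)"
    using presented_hom_subst[OF P T, of u] u R by auto
  obtain k where k: "k \<in> hom (presented_group T) (presented_group P)"
    "\<And>w. w \<in> words (fst T) \<Longrightarrow> k (word_elem T w) = word_elem P (subst v w)"
    using presented_hom_subst[OF T P, of v] v R by auto
  have id: "f x = x" if X: "X \<in> presentations" and f: "f \<in> hom (presented_group X) (presented_group X)"
    and fg: "\<And>i. i < fst X \<Longrightarrow> f (gen X i) = gen X i" and x: "x \<in> carrier (presented_group X)" for X f x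
  proof -
    obtain w where "w \<in> words (fst X)" "x = word_elem X w" by (rule word_elem_surj[OF X x])
    with hom_word_elem[OF X X f _ fg, of w] show ?thesis by simp
  qed
  have kh: "(k \<circ> h) x = x" if "x \<in> carrier (presented_group P)" for x
  proof (rule id[OF P Group.hom_compose[OF h(1) k(1)] _ that])
    fix i assume i: "i < fst P"
    have "(k \<circ> h) (gen P i) = word_elem P (subst v (u i))"
      using h(2)[of "[(i, False)]"] k(2)[OF u[OF i]] i by simp
    then show "(k \<circ> h) (gen P i) = gen P i"
      using word_elem_cancel_gen[OF P subst_in_words[OF u[OF i], of v] i] v R i by simp
  qed
  have hk: "(h \<circ> k) x = x" if "x \<in> carrier (presented_group T)" for x
  proof (rule id[OF T Group.hom_compose[OF k(1) h(1)] _ that])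
    fix i assume i: "i < fst T"
    have "(h \<circ> k) (gen T i) = word_elem T (subst u (v i))"
      using k(2)[of "[(i, False)]"] h(2)[OF v[OF i]] i by simp
    then show "(h \<circ> k) (gen T i) = gen T i"
      using word_elem_cancel_gen[OF T subst_in_words[OF v[OF i], of u] i] u R i by simp
  qed
  have "bij_betw h (carrier (presented_group P)) (carrier (presented_group T))"
    by (rule bij_betw_byWitness[where f' = k]) (use kh hk h(1) k(1) in \<open>auto simp: hom_def\<close>)
  with h(1) show ?L by (auto simp: is_iso_def iso_def)
qed

section \<open>Polynomial functions on a group\<close>

text \<open>\<open>fpoly G n f\<close>: the function \<open>f\<close> is a polynomial function of degree less than \<open>n\<close>, that is, it
  vanishes on the \<open>n\<close>-th power of the augmentation ideal of the group ring.\<close>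

primrec fpoly :: "('a, 'b) monoid_scheme \<Rightarrow> nat \<Rightarrow> ('a \<Rightarrow> int) \<Rightarrow> bool" where
  "fpoly G 0 f \<longleftrightarrow> (\<forall>x\<in>carrier G. f x = 0)"
| "fpoly G (Suc n) f \<longleftrightarrow> (\<forall>g\<in>carrier G. fpoly G n (\<lambda>x. f (x \<otimes>\<^bsub>G\<^esub> g) - f x))"

text \<open>A difference along an arbitrary element costs one degree. Here it costs two, as it does
  when \<open>c - 1\<close> lies in the square of the augmentation ideal, for instance for products
  of commutators.\<close>

definition lowers_degree :: "('a, 'b) monoid_scheme \<Rightarrow> 'a \<Rightarrow> bool" where
  "lowers_degree G c \<longleftrightarrow>
    (\<forall>n f. fpoly G (Suc (Suc n)) f \<longrightarrow> fpoly G n (\<lambda>x. f (x \<otimes>\<^bsub>G\<^esub> c) - f x))"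

definition class_function :: "('a, 'b) monoid_scheme \<Rightarrow> ('a \<Rightarrow> int) \<Rightarrow> bool" where
  "class_function G f \<longleftrightarrow>
    (\<forall>x\<in>carrier G. \<forall>g\<in>carrier G. f (g \<otimes>\<^bsub>G\<^esub> x \<otimes>\<^bsub>G\<^esub> inv\<^bsub>G\<^esub> g) = f x)"

definition expsum :: "nat \<Rightarrow> word \<Rightarrow> int" where
  "expsum i w = (\<Sum>l\<leftarrow>w. if fst l = i then if snd l then -1 else 1 else 0)"

lemma expsum_simps [simp]:
  "expsum i [] = 0"
  "expsum i (l # w) = (if fst l = i then if snd l then -1 else 1 else 0) + expsum i w"
  by (simp_all add: expsum_def)

text \<open>A substitute for the torsion-free part of the abelianization: the action of an
  endomorphism on it is described dually, by composition with these functions.\<close>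

definition int_homs :: "('a, 'b) monoid_scheme \<Rightarrow> ('a \<Rightarrow> int) set" where
  "int_homs G = {h. \<forall>x\<in>carrier G. \<forall>y\<in>carrier G. h (x \<otimes>\<^bsub>G\<^esub> y) = h x + h y}"

context group
begin

lemma fpoly_cong: "fpoly G n f \<Longrightarrow> (\<And>x. x \<in> carrier G \<Longrightarrow> f x = g x) \<Longrightarrow> fpoly G n g"
proof (induction n arbitrary: f g)
  case (Suc n)
  show ?case
  proof (simp, rule ballI)
    fix h assume h: "h \<in> carrier G"
    show "fpoly G n (\<lambda>x. g (x \<otimes> h) - g x)"
      by (rule Suc.IH[of "\<lambda>x. f (x \<otimes> h) - f x"]) (use Suc.prems h in auto)
  qed
qed auto

lemma fpoly_zero: "fpoly G n (\<lambda>x. 0)"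
  by (induction n) auto

lemma fpoly_add: "fpoly G n f \<Longrightarrow> fpoly G n g \<Longrightarrow> fpoly G n (\<lambda>x. f x + g x)"
proof (induction n arbitrary: f g)
  case (Suc n)
  then show ?case
    using Suc.IH[of "\<lambda>x. f (x \<otimes> h) - f x" "\<lambda>x. g (x \<otimes> h) - g x" for h] by (simp add: algebra_simps)
qed auto

lemma fpoly_scale: "fpoly G n f \<Longrightarrow> fpoly G n (\<lambda>x. c * f x)"
proof (induction n arbitrary: f)
  case (Suc n)
  then show ?case
    using Suc.IH[of "\<lambda>x. f (x \<otimes> h) - f x" for h] by (simp add: algebra_simps)
qed auto

lemma fpoly_sum: "(\<And>i. i \<in> A \<Longrightarrow> fpoly G n (f i)) \<Longrightarrow> fpoly G n (\<lambda>x. \<Sum>i\<in>A. f i x)"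
  by (induction A rule: infinite_finite_induct) (auto intro: fpoly_add fpoly_zero)

lemma fpoly_Suc: "fpoly G n f \<Longrightarrow> fpoly G (Suc n) f"
proof (induction n arbitrary: f)
  case (Suc n)
  then have "fpoly G (Suc n) (\<lambda>x. f (x \<otimes> g) - f x)" if "g \<in> carrier G" for g
    using that by (auto simp del: fpoly.simps(2) simp: fpoly.simps(2)[of G n f])
  then show ?case unfolding fpoly.simps(2)[of G "Suc n"] by blast
qed auto

lemma fpoly_mono: "n \<le> k \<Longrightarrow> fpoly G n f \<Longrightarrow> fpoly G k f"
  by (induction k rule: dec_induct) (auto intro: fpoly_Suc simp del: fpoly.simps)

lemma fpoly_translate:
  assumes "fpoly G n f" "g \<in> carrier G"
  shows "fpoly G n (\<lambda>x. f (x \<otimes> g))"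
proof -
  have "fpoly G n (\<lambda>x. f (x \<otimes> g) - f x)"
    using fpoly_Suc[OF assms(1)] assms(2) by simp
  from fpoly_add[OF this assms(1)] show ?thesis by simp
qed

text \<open>For \<open>f\<close> of degree less than \<open>n + 2\<close> the difference
  \<open>f (x w) - f x\<close> is additive in \<open>w\<close> up to functions of degree less than
  \<open>n\<close>, the error being a second difference. So it is the sum of the differences along
  the elements \<open>a i\<close>, weighted with the exponent sums, and only the error remains when
  these vanish.\<close>

lemma lowers_degree_word:
  assumes a: "a \<in> {..<k} \<rightarrow> carrier G" and w: "w \<in> words k" and e: "\<And>i. i < k \<Longrightarrow> expsum i w = 0"
  shows "lowers_degree G (eval_word G a w)"
proof -
  have *: "fpoly G n (\<lambda>x. f (x \<otimes> eval_word G a w) - f x - (\<Sum>i<k. expsum i w * (f (x \<otimes> a i) - f x)))"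
    if f: "fpoly G (Suc (Suc n)) f" and w: "w \<in> words k" for w n f
    using w
  proof (induction w)
    case Nil
    show ?case by (rule fpoly_cong[OF fpoly_zero]) simp
  next
    case (Cons l w)
    define g where "g = eval_letter G a l"
    have ai: "a i \<in> carrier G" if "i < k" for i using a that by (auto simp: Pi_def)
    have l: "fst l < k" "w \<in> words k" using Cons.prems by auto
    have g: "g \<in> carrier G" and W: "eval_word G a w \<in> carrier G" using a l by (auto simp: g_def)
    have 1: "fpoly G n (\<lambda>x. (f (x \<otimes> g \<otimes> eval_word G a w) - f (x \<otimes> g)) - (f (x \<otimes> eval_word G a w) - f x))"
      using f g W by simp
    define s :: int where "s = (if snd l then -1 else 1)"
    have 2: "fpoly G n (\<lambda>x. f (x \<otimes> g) - f x - s * (f (x \<otimes> a (fst l)) - f x))"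
    proof (cases "snd l")
      case False
      then show ?thesis by (intro fpoly_cong[OF fpoly_zero]) (simp add: s_def g_def eval_letter_def)
    next
      case True
      have "fpoly G n (\<lambda>x. (f (x \<otimes> g \<otimes> a (fst l)) - f (x \<otimes> g)) - (f (x \<otimes> a (fst l)) - f x))"
        using f g ai[OF l(1)] by simp
      from fpoly_scale[OF this, of "-1"] show ?thesis
        by (rule fpoly_cong) (use True ai[OF l(1)] in \<open>simp add: s_def g_def eval_letter_def m_assoc\<close>)
    qed
    have "(\<Sum>i<k. expsum i (l # w) * (f (x \<otimes> a i) - f x)) =
        s * (f (x \<otimes> a (fst l)) - f x) + (\<Sum>i<k. expsum i w * (f (x \<otimes> a i) - f x))" for x
    proof -
      have "(\<Sum>i<k. expsum i (l # w) * (f (x \<otimes> a i) - f x)) =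
          (\<Sum>i<k. (if fst l = i then s * (f (x \<otimes> a i) - f x) else 0)) +
          (\<Sum>i<k. expsum i w * (f (x \<otimes> a i) - f x))"
        unfolding sum.distrib[symmetric] by (rule sum.cong) (auto simp: s_def algebra_simps)
      with l(1) show ?thesis by simp
    qed
    with fpoly_add[OF fpoly_add[OF Cons.IH[OF l(2)] 1] 2] show ?case
      by (elim fpoly_cong) (use g W in \<open>simp add: g_def[symmetric] m_assoc\<close>)
  qed
  show ?thesis
    unfolding lowers_degree_def
  proof (intro allI impI)
    fix n f assume "fpoly G (Suc (Suc n)) f"
    from *[OF this w] show "fpoly G n (\<lambda>x. f (x \<otimes> eval_word G a w) - f x)" by (simp add: e)
  qed
qed

text \<open>The difference of \<open>f \<circ> \<alpha> - f\<close> along \<open>g\<close> is the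
  sum of two terms. One is \<open>d \<circ> \<alpha> - d\<close> for
  \<open>d x = f (x \<alpha>(g)) - f x\<close>, which is covered by induction. The other is
  \<open>f (x \<alpha>(g)) - f (x g)\<close>, a difference along \<open>g^-1 \<alpha>(g)\<close>,
  which costs two degrees.\<close>

lemma fpoly_endo_diff:
  assumes hom: "\<alpha> \<in> hom G G" and low: "\<And>g. g \<in> carrier G \<Longrightarrow> lowers_degree G (inv g \<otimes> \<alpha> g)"
  shows "fpoly G (Suc n) f \<Longrightarrow> fpoly G n (\<lambda>x. f (\<alpha> x) - f x)"
proof (induction n arbitrary: f)
  have cl: "\<alpha> x \<in> carrier G" if "x \<in> carrier G" for x using hom that by (auto simp: hom_def)
  {
    case 0
    have *: "f x = f \<one>" if "x \<in> carrier G" for x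
    proof -
      have "f (\<one> \<otimes> x) - f \<one> = 0" using 0 that one_closed unfolding fpoly.simps by blast
      with that show ?thesis by simp
    qed
    have "f (\<alpha> x) = f x" if "x \<in> carrier G" for x
      unfolding *[OF that] by (rule *[OF cl[OF that]])
    then show ?case by simp
  next
    case (Suc n)
    show ?case
      unfolding fpoly.simps
    proof
      fix g assume g: "g \<in> carrier G"
      have "fpoly G (Suc n) (\<lambda>x. f (x \<otimes> \<alpha> g) - f x)"
        using Suc.prems cl[OF g] by (simp only: fpoly.simps) blast
      from Suc.IH[OF this]
      have 1: "fpoly G n (\<lambda>x. f (\<alpha> x \<otimes> \<alpha> g) - f (\<alpha> x) - (f (x \<otimes> \<alpha> g) - f x))" .
      have "fpoly G n (\<lambda>x. f (x \<otimes> (inv g \<otimes> \<alpha> g)) - f x)"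
        using low[OF g] Suc.prems unfolding lowers_degree_def by blast
      from fpoly_translate[OF this g]
      have 2: "fpoly G n (\<lambda>x. f (x \<otimes> g \<otimes> (inv g \<otimes> \<alpha> g)) - f (x \<otimes> g))" .
      have g': "x \<otimes> g \<otimes> (inv g \<otimes> \<alpha> g) = x \<otimes> \<alpha> g" if "x \<in> carrier G" for x
        using that g cl[OF g] by (metis inv_closed inv_solve_left m_assoc m_closed)
      show "fpoly G n (\<lambda>x. f (\<alpha> (x \<otimes> g)) - f (x \<otimes> g) - (f (\<alpha> x) - f x))"
        using fpoly_add[OF 1 2] by (rule fpoly_cong) (use g hom in \<open>simp add: g' hom_mult\<close>)
    qed
  }
qed

lemma funpow_hom_closed:
  "\<alpha> \<in> hom G G \<Longrightarrow> x \<in> carrier G \<Longrightarrow> (\<alpha> ^^ n) x \<in> carrier G"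
  by (induction n) (auto simp: hom_def)

text \<open>Passing from \<open>T\<close> to \<open>T \<circ> \<alpha> - T\<close> is nilpotent on polynomial functions, while \<open>T \<mapsto> T \<circ> \<alpha>\<close> has
  finite order on class functions; a unipotent operator of finite order is trivial.\<close>

lemma class_function_invariant:
  assumes hom: "\<alpha> \<in> hom G G" and low: "\<And>g. g \<in> carrier G \<Longrightarrow> lowers_degree G (inv g \<otimes> \<alpha> g)"
    and N: "N > 0" and h: "h \<in> carrier G"
    and inner: "\<And>x. x \<in> carrier G \<Longrightarrow> (\<alpha> ^^ N) x = h \<otimes> x \<otimes> inv h"
  shows "class_function G T \<Longrightarrow> fpoly G n T \<Longrightarrow> x \<in> carrier G \<Longrightarrow> T (\<alpha> x) = T x"
proof (induction n arbitrary: T x)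
  have cl: "\<alpha> x \<in> carrier G" if "x \<in> carrier G" for x using hom that by (auto simp: hom_def)
  {
    case 0
    then show ?case using cl by simp
  next
    case (Suc n)
    define S where "S x = T (\<alpha> x) - T x" for x
    have "class_function G S"
      unfolding class_function_def
    proof (intro ballI)
      fix x g assume xg: "x \<in> carrier G" "g \<in> carrier G"
      interpret a: group_hom G G \<alpha>
        using hom by (simp add: group_hom_def group_hom_axioms_def is_group)
      have "\<alpha> (g \<otimes> x \<otimes> inv g) = \<alpha> g \<otimes> \<alpha> x \<otimes> inv (\<alpha> g)" using xg by simp
      then show "S (g \<otimes> x \<otimes> inv g) = S x"
        using Suc.prems(1) xg cl unfolding S_def class_function_def by simp
    qed
    moreover have "fpoly G n S"
      unfolding S_def by (rule fpoly_endo_diff[OF hom low Suc.prems(2)])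
    ultimately have S: "S (\<alpha> x) = S x" if "x \<in> carrier G" for x
      using that by (rule Suc.IH)
    have S': "S ((\<alpha> ^^ j) x) = S x" if "x \<in> carrier G" for x j
      using that by (induction j) (auto simp: S funpow_hom_closed[OF hom])
    \<comment> \<open>\<open>S\<close> is constant along the orbit, so \<open>T\<close> grows
      linearly with slope \<open>S x\<close>. As \<open>\<alpha>^N\<close> is a conjugation, the
      class function \<open>T\<close> has its old value at \<open>j = N\<close>, and the slope is
      zero.\<close>
    have "T ((\<alpha> ^^ j) x) = T x + int j * S x" if "x \<in> carrier G" for x j
    proof (induction j)
      case (Suc j)
      have "T ((\<alpha> ^^ Suc j) x) = T ((\<alpha> ^^ j) x) + S ((\<alpha> ^^ j) x)" by (simp add: S_def)
      with Suc S'[OF that] show ?case by (simp add: algebra_simps)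
    qed simp
    from this[of x N] inner[of x] have "int N * S x = 0"
      using Suc.prems h by (simp add: class_function_def)
    with N show ?case by (simp add: S_def)
  }
qed

section \<open>Minkowski's lemma\<close>

lemma int_homs_comp: "\<alpha> \<in> hom G G \<Longrightarrow> h \<in> int_homs G \<Longrightarrow> (\<lambda>x. h (\<alpha> x)) \<in> int_homs G"
  by (auto simp: int_homs_def hom_def Pi_def)

lemma int_homs_diff: "h \<in> int_homs G \<Longrightarrow> k \<in> int_homs G \<Longrightarrow> (\<lambda>x. h x - k x) \<in> int_homs G"
  by (auto simp: int_homs_def)

lemma int_homs_divide:
  assumes h: "h \<in> int_homs G" and d: "\<And>x. x \<in> carrier G \<Longrightarrow> d dvd h x"
  shows "(\<lambda>x. h x div d) \<in> int_homs G"
  unfolding int_homs_def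
proof (intro CollectI ballI)
  fix x y assume "x \<in> carrier G" "y \<in> carrier G"
  then show "h (x \<otimes> y) div d = h x div d + h y div d"
    using h d by (simp add: int_homs_def div_plus_div_distrib_dvd_left)
qed

text \<open>A homomorphism with all values divisible by \<open>r\<close> can be divided by
  \<open>r\<close>; the congruence modulo \<open>q\<close>, applied to the quotient, yields the
  second factor.\<close>

lemma congruent_endo_square:
  fixes q :: int
  assumes hom: "\<alpha> \<in> hom G G"
    and q: "\<And>h x. h \<in> int_homs G \<Longrightarrow> x \<in> carrier G \<Longrightarrow> q dvd h (\<alpha> x) - h x"
    and h: "h \<in> int_homs G" and r: "\<And>x. x \<in> carrier G \<Longrightarrow> r dvd h x" and x: "x \<in> carrier G"
  shows "r * q dvd h (\<alpha> x) - h x"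
proof -
  have ax: "\<alpha> x \<in> carrier G" using hom x by (auto simp: hom_def)
  have "q dvd h (\<alpha> x) div r - h x div r"
    by (rule q[OF int_homs_divide[OF h r] x])
  then have "r * q dvd r * (h (\<alpha> x) div r - h x div r)" by (intro mult_dvd_mono) auto
  then show ?thesis using r[OF x] r[OF ax] by (simp add: right_diff_distrib)
qed

text \<open>Every power of \<open>3\<close> divides \<open>h (\<alpha> x) - h x\<close>, which therefore vanishes.\<close>

lemma minkowski_coprime:
  assumes hom: "\<alpha> \<in> hom G G"
    and q: "\<And>h x. h \<in> int_homs G \<Longrightarrow> x \<in> carrier G \<Longrightarrow> 3 dvd h (\<alpha> x) - h x"
    and N: "\<And>h x. h \<in> int_homs G \<Longrightarrow> x \<in> carrier G \<Longrightarrow> h ((\<alpha> ^^ N) x) = h x"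
    and step: "coprime N 3 \<or> N = 3"
    and h: "h \<in> int_homs G" and x: "x \<in> carrier G"
  shows "h (\<alpha> x) = h x"
proof -
  have cl: "\<alpha> x \<in> carrier G" if "x \<in> carrier G" for x using hom that by (auto simp: hom_def)
  define D where "D = (\<lambda>(h :: 'a \<Rightarrow> int) x. h (\<alpha> x) - h x)"
  have D: "D h \<in> int_homs G" if "h \<in> int_homs G" for h
    using int_homs_diff[OF int_homs_comp[OF hom that] that] by (simp add: D_def)
  have *: "3 ^ Suc s dvd D h x" if "h \<in> int_homs G" "x \<in> carrier G" for h x s
    using that
  proof (induction s arbitrary: h x)
    case 0
    then show ?case using q by (simp add: D_def)
  next
    case (Suc s)
    note hx = Suc.prems
    let ?q = "3 ^ Suc s :: int"
    \<comment> \<open>\<open>D\<close> is composition with \<open>\<alpha>\<close> minus the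
      identity. Every further application of \<open>D\<close> contributes one more factor
      \<open>?q\<close>.\<close>
    have d1: "?q dvd D h y" if "h \<in> int_homs G" "y \<in> carrier G" for h y
      using Suc.IH that by blast
    have d2: "?q * ?q dvd D (D h) y" if "h \<in> int_homs G" "y \<in> carrier G" for h y
      apply (subst D_def)
      by (rule congruent_endo_square[OF hom _ D[OF that(1)] d1[OF that(1)] that(2)])
        (use d1 in \<open>auto simp: D_def\<close>)
    have d3: "(?q * ?q) * ?q dvd D (D (D h)) y" if "h \<in> int_homs G" "y \<in> carrier G" for h y
      apply (subst D_def)
      by (rule congruent_endo_square[OF hom _ D[OF D[OF that(1)]] d2[OF that(1)] that(2)])
        (use d1 in \<open>auto simp: D_def\<close>)
    have q9: "3 * ?q dvd ?q * ?q" by (simp add: mult_dvd_mono)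
    show ?case
    proof (cases "N = 3")
      case True
      \<comment> \<open>The expansion of \<open>(1 + D)^3\<close>. Since \<open>\<alpha>^3\<close>
        acts trivially, \<open>3 D h\<close> equals the negative of the terms of higher order. They
        are divisible by \<open>9 q\<close>, where \<open>q = 3 ^ Suc s\<close>: the quadratic term
        through \<open>3 q^2\<close> and the cubic term through \<open>q^3\<close>, because
        \<open>3\<close> divides \<open>q\<close>. This gives \<open>D h\<close> one more factor
        \<open>3\<close>.\<close>
      have "h ((\<alpha> ^^ 3) x) = h x + 3 * D h x + 3 * D (D h) x + D (D (D h)) x"
        by (simp add: D_def numeral_3_eq_3)
      then have e: "3 * D h x = - (3 * D (D h) x) - D (D (D h)) x"
        using N[OF Suc.prems] True by simp
      have "3 * (3 * ?q) dvd 3 * D (D h) x"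
        using dvd_trans[OF q9 d2[OF Suc.prems]] by (intro mult_dvd_mono) auto
      moreover have "3 * (3 * ?q) dvd D (D (D h)) x"
      proof -
        have "3 * (3 * ?q) dvd (?q * ?q) * ?q"
        proof -
          have "(3 * ?q) * 3 dvd (?q * ?q) * ?q" by (intro mult_dvd_mono q9) simp
          then show ?thesis by (simp add: mult.commute)
        qed
        then show ?thesis using d3[OF Suc.prems] by (rule dvd_trans)
      qed
      ultimately have "3 * (3 * ?q) dvd 3 * D h x" unfolding e by (simp only: dvd_diff dvd_minus_iff)
      then have "3 * ?q dvd D h x" by (simp only: dvd_mult_cancel_left) simp
      then show ?thesis by (simp only: power_Suc)
    next
      case False
      \<comment> \<open>Modulo \<open>q^2\<close>, where \<open>q = 3 ^ Suc s\<close>, the function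
        \<open>D h\<close> is constant along orbits, so \<open>h (\<alpha>^N x) - h x\<close> is
        \<open>N D h x\<close>. It is zero, \<open>3 q\<close> divides \<open>q^2\<close>, and
        \<open>N\<close> is prime to \<open>3\<close>; hence \<open>3 q\<close> divides
        \<open>D h x\<close>.\<close>
      have D': "?q * ?q dvd D h ((\<alpha> ^^ j) x) - D h x" for j
      proof (induction j)
        case (Suc j)
        have "D h ((\<alpha> ^^ Suc j) x) - D h x = D (D h) ((\<alpha> ^^ j) x) + (D h ((\<alpha> ^^ j) x) - D h x)"
          by (simp add: D_def)
        then show ?case
          using dvd_add[OF d2[OF hx(1) funpow_hom_closed[OF hom hx(2)]] Suc] by (simp only:)
      qed simp
      have "?q * ?q dvd h ((\<alpha> ^^ j) x) - h x - int j * D h x" for j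
      proof (induction j)
        case (Suc j)
        have "h ((\<alpha> ^^ Suc j) x) - h x - int (Suc j) * D h x =
          (h ((\<alpha> ^^ j) x) - h x - int j * D h x) + (D h ((\<alpha> ^^ j) x) - D h x)"
          by (simp add: D_def algebra_simps)
        then show ?case using dvd_add[OF Suc D'[of j]] by (simp only:)
      qed simp
      from this[of N] have "?q * ?q dvd int N * D h x"
        using N[OF Suc.prems] by simp
      with q9 have "3 * ?q dvd int N * D h x" by (rule dvd_trans)
      moreover have "coprime (3 * ?q) (int N)"
      proof -
        have "coprime 3 (int N)"
          using step False coprime_int_iff[of 3 N] by (simp add: coprime_commute)
        then have "coprime (3 ^ Suc (Suc s)) (int N)" by (simp only: coprime_power_left_iff) simp
        then show ?thesis by (simp only: power_Suc)
      qed
      ultimately have "3 * ?q dvd D h x" by (simp only: coprime_dvd_mult_right_iff)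
      then show ?thesis by (simp only: power_Suc)
    qed
  qed
  have "D h x = 0"
  proof (rule ccontr)
    assume "D h x \<noteq> 0"
    define n where "n = nat \<bar>D h x\<bar>"
    have "(3::int) ^ Suc n \<le> \<bar>D h x\<bar>"
      using *[OF h x, of n] \<open>D h x \<noteq> 0\<close> by (meson dvd_imp_le_int order.trans abs_ge_self)
    moreover have "int n < 2 ^ n" using less_exp[of n] by (metis of_nat_less_iff of_nat_numeral of_nat_power)
    moreover have "(2::int) ^ n \<le> 3 ^ n" by (rule power_mono) auto
    moreover have "(3::int) ^ n \<le> 3 ^ Suc n" by simp
    moreover have "int n = \<bar>D h x\<bar>" by (simp add: n_def)
    ultimately show False by linarith
  qed
  then show ?thesis by (simp add: D_def)
qed

lemma funpow_hom: "\<alpha> \<in> hom G G \<Longrightarrow> \<alpha> ^^ n \<in> hom G G"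
  by (induction n) (auto simp: hom_def Pi_def)

text \<open>Factors \<open>3\<close> of \<open>N\<close> are removed one at a time:
  \<open>\<alpha>^(N/3)\<close> is again congruent to the identity and its third power acts
  trivially, so by \<open>minkowski_coprime\<close> it acts trivially itself, and \<open>N/3\<close>
  takes the place of \<open>N\<close>.\<close>

lemma minkowski:
  assumes "\<alpha> \<in> hom G G"
    and "\<And>h x. h \<in> int_homs G \<Longrightarrow> x \<in> carrier G \<Longrightarrow> 3 dvd h (\<alpha> x) - h x"
    and "\<And>h x. h \<in> int_homs G \<Longrightarrow> x \<in> carrier G \<Longrightarrow> h ((\<alpha> ^^ N) x) = h x"
    and "N > 0" "h \<in> int_homs G" "x \<in> carrier G"
  shows "h (\<alpha> x) = h x"
  using assms
proof (induction N arbitrary: h x rule: less_induct)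
  case (less N)
  show ?case
  proof (cases "3 dvd N")
    case False
    have "coprime N 3"
    proof (rule coprimeI)
      fix d assume d: "d dvd N" "d dvd (3::nat)"
      have "d \<le> 3" by (rule dvd_imp_le[OF d(2)]) simp
      then have "d = 0 \<or> d = 1 \<or> d = 2 \<or> d = 3" by arith
      with d False show "is_unit d" by auto
    qed
    with less.prems show ?thesis by (intro minkowski_coprime[of \<alpha> N]) auto
  next
    case True
    then obtain k where k: "N = k * 3" by (auto simp: dvd_def mult.commute)
    have q: "3 dvd h ((\<alpha> ^^ j) x) - h x" if "h \<in> int_homs G" "x \<in> carrier G" for h x j
    proof (induction j)
      case (Suc j)
      have "h ((\<alpha> ^^ Suc j) x) - h x = (h (\<alpha> ((\<alpha> ^^ j) x)) - h ((\<alpha> ^^ j) x)) + (h ((\<alpha> ^^ j) x) - h x)"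
        by simp
      with Suc less.prems(2)[OF that(1) funpow_hom_closed[OF less.prems(1) that(2)]] show ?case
        by (metis dvd_add)
    qed simp
    have "h ((\<alpha> ^^ k) x) = h x" if "h \<in> int_homs G" "x \<in> carrier G" for h x
      by (rule minkowski_coprime[of "\<alpha> ^^ k" 3])
        (use that q less.prems(3) funpow_hom[OF less.prems(1)] in \<open>auto simp: funpow_mult k\<close>)
    then show ?thesis
      using less.prems k by (intro less.IH[of k]) auto
  qed
qed

end

section \<open>Magnus coefficients\<close>

text \<open>\<open>mag w u\<close> is the coefficient of the monomial \<open>u\<close> in the image of \<open>w\<close> under the Magnus embedding
  \<open>x\<^sub>i \<mapsto> 1 + X\<^sub>i\<close> into the power series in noncommuting variables.\<close>

primrec conv :: "(nat list \<Rightarrow> int) \<Rightarrow> (nat list \<Rightarrow> int) \<Rightarrow> nat list \<Rightarrow> int" where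
  "conv p q [] = p [] * q []"
| "conv p q (a # u) = p [] * q (a # u) + conv (\<lambda>u. p (a # u)) q u"

definition conv_unit :: "nat list \<Rightarrow> int" where
  "conv_unit u = of_bool (u = [])"

text \<open>The series \<open>1 + X\<close> for a generator and \<open>1 - X + X^2 - ...\<close> for
  its inverse.\<close>

definition letter_series :: "letter \<Rightarrow> nat list \<Rightarrow> int" where
  "letter_series l u = (if snd l then of_bool (\<forall>a\<in>set u. a = fst l) * (-1) ^ length u
     else of_bool (u = [] \<or> u = [fst l]))"

definition mag :: "word \<Rightarrow> nat list \<Rightarrow> int" where
  "mag w = foldr (\<lambda>l. conv (letter_series l)) w conv_unit"

lemma conv_zero [simp]: "conv (\<lambda>_. 0) q u = 0"
  by (induction u) auto

lemma conv_add_left: "conv (\<lambda>u. p u + p' u) q u = conv p q u + conv p' q u"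
  by (induction u arbitrary: p p') (auto simp: algebra_simps)

lemma conv_scale_left: "conv (\<lambda>u. c * p u) q u = c * conv p q u"
  by (induction u arbitrary: p) (auto simp: algebra_simps)

lemma conv_assoc: "conv (conv p q) r = conv p (conv q r)"
proof
  show "conv (conv p q) r u = conv p (conv q r) u" for u
    by (induction u arbitrary: p q) (auto simp: conv_add_left conv_scale_left algebra_simps)
qed

lemma conv_unit_left [simp]: "conv conv_unit q = q"
proof
  show "conv conv_unit q u = q u" for u
    by (cases u) (auto simp: conv_unit_def)
qed

lemma conv_unit_right [simp]: "conv p conv_unit = p"
proof
  show "conv p conv_unit u = p u" for u
    by (induction u arbitrary: p) (auto simp: conv_unit_def)
qed

lemma conv_eq_sum: "conv p q u = (\<Sum>k\<le>length u. p (take k u) * q (drop k u))"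
proof (induction u arbitrary: p)
  case (Cons a u)
  have "(\<Sum>k\<le>Suc (length u). p (take k (a # u)) * q (drop k (a # u))) =
      p [] * q (a # u) + (\<Sum>k\<le>length u. p (a # take k u) * q (drop k u))"
    by (subst sum.atMost_Suc_shift) simp
  with Cons show ?case by simp
qed simp

lemma letter_series_pos: "conv (letter_series (i, False)) q u =
    q u + (if u \<noteq> [] \<and> hd u = i then q (tl u) else 0)"
proof (cases u)
  case (Cons a v)
  have "(\<lambda>u. letter_series (i, False) (a # u)) = (if a = i then conv_unit else (\<lambda>_. 0))"
    by (auto simp: letter_series_def conv_unit_def)
  with Cons show ?thesis by (simp add: letter_series_def)
qed (simp add: letter_series_def)

lemma letter_series_neg: "conv (letter_series (i, True)) q u =
    q u - (if u \<noteq> [] \<and> hd u = i then conv (letter_series (i, True)) q (tl u) else 0)"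
proof (cases u)
  case (Cons a v)
  have "(\<lambda>u. letter_series (i, True) (a # u)) =
      (if a = i then (\<lambda>u. -1 * letter_series (i, True) u) else (\<lambda>_. 0))"
    by (auto simp: letter_series_def)
  moreover have "conv (\<lambda>u. -1 * letter_series (i, True) u) q v = -1 * conv (letter_series (i, True)) q v"
    by (rule conv_scale_left)
  ultimately show ?thesis using Cons by (simp add: letter_series_def)
qed (simp add: letter_series_def)

text \<open>This makes \<open>mag\<close> invariant under free reduction, hence a function on the
  free group.\<close>

lemma letter_series_inverse: "conv (letter_series (inv_letter l)) (conv (letter_series l) q) = q"
proof
  obtain i b where l: "l = (i, b)" by (cases l)
  define P where "P = conv (letter_series (i, False)) q"
  have P: "P u = q u + (if u \<noteq> [] \<and> hd u = i then q (tl u) else 0)" for u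
    by (simp add: P_def letter_series_pos)
  have "conv (letter_series (i, True)) P u = q u" for u
  proof (induction u)
    case Nil
    show ?case by (simp add: letter_series_def P)
  next
    case (Cons a u)
    then show ?case
      by (subst letter_series_neg) (simp add: P[of "a # u"] del: conv.simps)
  qed
  then have "conv (letter_series (i, True)) (conv (letter_series (i, False)) q) u = q u" for u
    by (simp add: P_def)
  moreover have "conv (letter_series (i, False)) (conv (letter_series (i, True)) q) u = q u" for u
    using letter_series_neg[of i q u] by (auto simp: letter_series_pos)
  ultimately show "conv (letter_series (inv_letter l)) (conv (letter_series l) q) u = q u" for u
    by (cases b) (auto simp: l inv_letter_def)
qed

lemma mag_simps [simp]: "mag [] = conv_unit" "mag (l # w) = conv (letter_series l) (mag w)"
  by (simp_all add: mag_def)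

lemma mag_append: "mag (w @ w') = conv (mag w) (mag w')"
proof (induction w)
  case (Cons l w)
  then show ?case by (auto simp: conv_assoc)
qed simp

lemma mag_reduce [simp]: "mag (reduce w) = mag w"
proof (induction w)
  case (Cons l w)
  have "mag (cons_reduce l u) = conv (letter_series l) (mag u)" for u
    using letter_series_inverse[of "inv_letter l"] by (cases u) (auto simp: inv_letter_def)
  with Cons show ?case by (simp add: reduce_Cons)
qed simp

lemma mag_Nil [simp]: "mag w [] = 1"
  by (induction w) (auto simp: conv_unit_def letter_series_def)

lemma mag_single: "mag w [i] = expsum i w"
  by (induction w) (auto simp: conv_unit_def letter_series_def)

lemma expsum_reduce [simp]: "expsum i (reduce w) = expsum i w"
  by (simp flip: mag_single)

lemma expsum_append [simp]: "expsum i (u @ v) = expsum i u + expsum i v"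
  by (simp add: expsum_def)

section \<open>Conjugation-invariant Magnus coefficients\<close>

definition cyc_mag :: "nat list \<Rightarrow> word \<Rightarrow> int" where
  "cyc_mag u w = (\<Sum>j<length u. mag w (rotate j u))"

lemma cyc_mag_reduce [simp]: "cyc_mag u (reduce w) = cyc_mag u w"
  by (simp add: cyc_mag_def)

text \<open>The coefficient of a product at \<open>u\<close> is a sum over the cuts of
  \<open>u\<close> into a prefix and a suffix. Cutting a rotation of \<open>u\<close> at
  \<open>k\<close> and exchanging the two pieces amounts to cutting the rotation by \<open>k\<close>
  more places at \<open>length u - k\<close>. Summed over all rotations, the expression is symmetric
  in the two factors, like a trace.\<close>

lemma cyc_mag_commute: "cyc_mag u (v @ w) = cyc_mag u (w @ v)"
proof -
  let ?n = "length u"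
  \<comment> \<open>A sum over a full period of rotations may start anywhere: a shift by one place
    drops the first summand and adds an equal one at the end.\<close>
  have rot: "(\<Sum>j<?n. f (rotate (j + k) u)) = (\<Sum>j<?n. f (rotate j u))" for f :: "nat list \<Rightarrow> int" and k
  proof (induction k)
    case (Suc k)
    have "(\<Sum>j<?n. f (rotate (j + Suc k) u)) = (\<Sum>j<?n. f (rotate (Suc j + k) u))" by simp
    also have "\<dots> = (\<Sum>j<Suc ?n. f (rotate (j + k) u)) - f (rotate k u)"
      by (subst sum.lessThan_Suc_shift) simp
    also have "rotate (?n + k) u = rotate k u"
      by (metis mod_add_self1 rotate_conv_mod)
    then have "(\<Sum>j<Suc ?n. f (rotate (j + k) u)) - f (rotate k u) = (\<Sum>j<?n. f (rotate (j + k) u))"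
      by simp
    finally show ?case using Suc by simp
  qed simp
  have split: "take k u = drop (length u - k) (rotate k u) \<and> drop k u = take (length u - k) (rotate k u)"
    if "k \<le> length u" for k and u :: "nat list"
  proof -
    have "rotate (length (take k u)) (take k u @ drop k u) = drop k u @ take k u"
      by (rule rotate_append)
    then have "rotate k u = drop k u @ take k u" using that by simp
    then show ?thesis using that by simp
  qed
  have "cyc_mag u (v @ w) = (\<Sum>j<?n. \<Sum>k\<le>?n. mag v (take k (rotate j u)) * mag w (drop k (rotate j u)))"
    by (simp add: cyc_mag_def mag_append conv_eq_sum)
  also have "\<dots> = (\<Sum>k\<le>?n. \<Sum>j<?n. mag v (take k (rotate j u)) * mag w (drop k (rotate j u)))"
    by (rule sum.swap)
  also have "\<dots> = (\<Sum>k\<le>?n. \<Sum>j<?n. mag w (take (?n - k) (rotate (j + k) u)) * mag v (drop (?n - k) (rotate (j + k) u)))"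
  proof (intro sum.cong refl)
    fix k j assume "k \<in> {..?n}" "j \<in> {..<?n}"
    then have "k \<le> length (rotate j u)" by simp
    from split[OF this] show "mag v (take k (rotate j u)) * mag w (drop k (rotate j u)) =
        mag w (take (?n - k) (rotate (j + k) u)) * mag v (drop (?n - k) (rotate (j + k) u))"
      by (simp add: rotate_rotate add.commute[of j k])
  qed
  also have "\<dots> = (\<Sum>k\<le>?n. \<Sum>j<?n. mag w (take (?n - k) (rotate j u)) * mag v (drop (?n - k) (rotate j u)))"
    by (intro sum.cong refl rot[of "\<lambda>r. mag w (take (?n - k) r) * mag v (drop (?n - k) r)" for k])
  also have "\<dots> = (\<Sum>k\<le>?n. \<Sum>j<?n. mag w (take k (rotate j u)) * mag v (drop k (rotate j u)))"
    by (rule sum.reindex_bij_witness[where i = "\<lambda>k. ?n - k" and j = "\<lambda>k. ?n - k"]) auto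
  also have "\<dots> = (\<Sum>j<?n. \<Sum>k\<le>?n. mag w (take k (rotate j u)) * mag v (drop k (rotate j u)))"
    by (rule sum.swap)
  also have "\<dots> = cyc_mag u (w @ v)"
    by (simp add: cyc_mag_def mag_append conv_eq_sum)
  finally show ?thesis .
qed

lemma cyc_mag_conj: "cyc_mag u (v @ w @ inv_word v) = cyc_mag u w"
proof -
  have "cyc_mag u (v @ w @ inv_word v) = cyc_mag u ((w @ inv_word v) @ v)" by (rule cyc_mag_commute)
  also have "\<dots> = cyc_mag u (reduce (w @ reduce (inv_word v @ v)))"
    by (simp add: reduce_append_right)
  also have "\<dots> = cyc_mag u w" by (simp add: reduce_inv_word)
  finally show ?thesis .
qed

text \<open>The constant term of a Magnus series is \<open>1\<close>, so translation by
  \<open>g\<close> changes the coefficient at \<open>u\<close> by a combination of coefficients at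
  proper prefixes of \<open>u\<close>, with constants depending only on \<open>g\<close>. Induction
  on the length of \<open>u\<close> bounds the degree.\<close>

lemma (in group) fpoly_mag:
  assumes hom: "\<pi> \<in> hom G (free_group m)"
  shows "fpoly G (Suc (length u)) (\<lambda>x. mag (\<pi> x) u)"
proof (induction "length u" arbitrary: u rule: less_induct)
  case less
  show ?case
    unfolding fpoly.simps
  proof
    fix g assume g: "g \<in> carrier G"
    have "fpoly G (length u) (\<lambda>x. \<Sum>k<length u. mag (\<pi> g) (drop k u) * mag (\<pi> x) (take k u))"
    proof (intro fpoly_sum fpoly_scale)
      fix k assume k: "k \<in> {..<length u}"
      then have "fpoly G (Suc (length (take k u))) (\<lambda>x. mag (\<pi> x) (take k u))"
        by (intro less) auto
      then show "fpoly G (length u) (\<lambda>x. mag (\<pi> x) (take k u))"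
        by (rule fpoly_mono[rotated]) (use k in auto)
    qed
    then show "fpoly G (length u) (\<lambda>x. mag (\<pi> (x \<otimes> g)) u - mag (\<pi> x) u)"
    proof (rule fpoly_cong)
      fix x assume x: "x \<in> carrier G"
      have "mag (\<pi> (x \<otimes> g)) u = conv (mag (\<pi> x)) (mag (\<pi> g)) u"
        using hom_mult[OF hom x g] by (simp add: mag_append)
      then show "(\<Sum>k<length u. mag (\<pi> g) (drop k u) * mag (\<pi> x) (take k u)) =
          mag (\<pi> (x \<otimes> g)) u - mag (\<pi> x) u"
        by (simp add: conv_eq_sum mult.commute flip: lessThan_Suc_atMost)
    qed
  qed
qed

lemma (in group) fpoly_cyc_mag:
  "\<pi> \<in> hom G (free_group m) \<Longrightarrow> fpoly G (Suc (length u)) (\<lambda>x. cyc_mag u (\<pi> x))"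
  unfolding cyc_mag_def by (intro fpoly_sum) (metis fpoly_mag length_rotate)

lemma (in group) class_function_cyc_mag:
  assumes hom: "\<pi> \<in> hom G (free_group m)"
  shows "class_function G (\<lambda>x. cyc_mag u (\<pi> x))"
  unfolding class_function_def
proof (intro ballI)
  interpret h: group_hom G "free_group m" \<pi>
    using hom by (simp add: group_hom_def group_hom_axioms_def is_group group_free_group)
  fix x g assume "x \<in> carrier G" "g \<in> carrier G"
  then have "\<pi> (g \<otimes> x \<otimes> inv g) = reduce (\<pi> g @ \<pi> x @ inv_word (\<pi> g))"
    by (simp add: inv_free_group reduce_append_left reduce_append_right)
  then show "cyc_mag u (\<pi> (g \<otimes> x \<otimes> inv g)) = cyc_mag u (\<pi> x)"
    by (simp add: cyc_mag_conj)
qed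

section \<open>Syllables and leading Magnus coefficients\<close>

definition skeleton :: "word \<Rightarrow> nat list" where
  "skeleton w = remdups_adj (map fst w)"

text \<open>A monomial without equal neighbours meets only the constant and the linear term of the
  series of a letter; for such monomials an inverse generator acts like
  \<open>1 - X\<close>.\<close>

lemma mag_Cons_distinct_adj:
  assumes "distinct_adj u"
  shows "mag (l # w) u = mag w u +
    (if u \<noteq> [] \<and> hd u = fst l then (if snd l then -1 else 1) * mag w (tl u) else 0)"
proof -
  obtain i b where l: "l = (i, b)" by (cases l)
  have "conv (letter_series (i, True)) (mag w) u =
      mag w u - (if u \<noteq> [] \<and> hd u = i then mag w (tl u) else 0)"
  proof (cases "u \<noteq> [] \<and> hd u = i")
    case True
    then have "(tl u \<noteq> [] \<and> hd (tl u) = i) = False"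
      using assms by (cases u; cases "tl u") auto
    then show ?thesis
      using letter_series_neg[of i "mag w" u] letter_series_neg[of i "mag w" "tl u"] True
      by (auto simp del: conv.simps)
  qed (use letter_series_neg[of i "mag w" u] in \<open>auto simp del: conv.simps\<close>)
  then show ?thesis
    by (cases b) (auto simp: l letter_series_pos simp del: conv.simps)
qed

lemma mag_replicate_append:
  assumes "distinct_adj u"
  shows "mag (replicate k l @ w) u = mag w u +
    (if u \<noteq> [] \<and> hd u = fst l then int k * (if snd l then -1 else 1) * mag w (tl u) else 0)"
  using assms
proof (induction k arbitrary: u)
  case (Suc k)
  show ?case
  proof (cases "u \<noteq> [] \<and> hd u = fst l")
    case True
    then have "distinct_adj (tl u)" "(tl u \<noteq> [] \<and> hd (tl u) = fst l) = False"
      using Suc.prems by (cases u; cases "tl u"; auto)+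
    then show ?thesis
      using True Suc.IH[of u] Suc.IH[of "tl u"] Suc.prems
      by (auto simp add: mag_Cons_distinct_adj algebra_simps simp del: mag_simps)
  next
    case False
    then show ?thesis
      using Suc.IH[of u] Suc.prems by (auto simp: mag_Cons_distinct_adj simp del: mag_simps)
  qed
qed simp

lemma reduced_append_iff:
  "reduced (u @ v) \<longleftrightarrow> reduced u \<and> reduced v \<and> (u = [] \<or> v = [] \<or> hd v \<noteq> inv_letter (last u))"
  by (auto simp: reduced_def successively_append_iff)

lemma reduced_replicate [simp]: "reduced (replicate k a)"
  using inv_letter_neq[of a, symmetric] by (induction k) (auto simp: reduced_def successively_Cons)

lemma reduced_inv_word: "reduced w \<Longrightarrow> reduced (inv_word w)"
proof (induction w)
  case (Cons a w)
  then have "reduced w" "w = [] \<or> hd w \<noteq> inv_letter a"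
    using reduced_append_iff[of "[a]" w] by auto
  moreover have "last (inv_word w) = inv_letter (hd w)" if "w \<noteq> []"
    using that by (cases w) (auto simp: inv_word_def)
  moreover have "inv_word w = [] \<longleftrightarrow> w = []" by (simp add: inv_word_def)
  ultimately show ?case
    using Cons.IH by (auto simp: reduced_append_iff)
qed simp

lemma same_index: "fst a = fst b \<Longrightarrow> a = b \<or> a = inv_letter b"
  by (cases a; cases b) (auto simp: inv_letter_def)

lemma distinct_adj_skeleton: "distinct_adj (skeleton w)"
  by (simp add: skeleton_def distinct_adj_remdups_adj)

lemma skeleton_Nil [simp]: "skeleton [] = []"
  by (simp add: skeleton_def)

lemma skeleton_eq_Nil [simp]: "skeleton w = [] \<longleftrightarrow> w = []"
  by (simp add: skeleton_def)

lemma hd_skeleton: "w \<noteq> [] \<Longrightarrow> hd (skeleton w) = fst (hd w)"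
  by (simp add: skeleton_def hd_map)

lemma last_skeleton: "w \<noteq> [] \<Longrightarrow> last (skeleton w) = fst (last w)"
  by (simp add: skeleton_def last_map)

lemma skeleton_append:
  "u = [] \<or> v = [] \<or> fst (last u) \<noteq> fst (hd v) \<Longrightarrow> skeleton (u @ v) = skeleton u @ skeleton v"
  unfolding skeleton_def map_append by (rule remdups_adj_append') (auto simp: last_map hd_map)

text \<open>In a reduced word neighbouring letters of the same index are equal, so each syllable is
  a power of a single letter and the skeleton has one entry per syllable.\<close>

lemma first_run:
  assumes "reduced (a # w)"
  obtains k g where "a # w = replicate (Suc k) a @ g" "reduced g"
    "skeleton (a # w) = fst a # skeleton g" "g = [] \<or> fst (hd g) \<noteq> fst a"
proof -
  define g where "g = dropWhile (\<lambda>x. x = a) w"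
  define k where "k = length (takeWhile (\<lambda>x. x = a) w)"
  have "takeWhile (\<lambda>x. x = a) w = replicate k a"
    unfolding k_def using set_takeWhileD[of _ "\<lambda>x. x = a" w]
    by (intro replicate_length_same[symmetric]) auto
  then have w: "a # w = replicate (Suc k) a @ g"
    using takeWhile_dropWhile_id[of "\<lambda>x. x = a" w] by (simp add: g_def)
  have red: "reduced g" "g = [] \<or> hd g \<noteq> inv_letter a"
    using assms unfolding w reduced_append_iff by (auto simp: last_replicate simp del: replicate_Suc)
  have "g = [] \<or> hd g \<noteq> a"
    unfolding g_def using hd_dropWhile[of "\<lambda>x. x = a" w] by auto
  then have hd: "g = [] \<or> fst (hd g) \<noteq> fst a"
    using red(2) same_index by blast
  have "skeleton (a # w) = remdups_adj (replicate (Suc k) (fst a) @ map fst g)"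
    unfolding w skeleton_def by (simp add: map_replicate_const)
  also have "\<dots> = fst a # skeleton g"
  proof (cases g)
    case Nil
    then show ?thesis using remdups_adj_replicate[of "Suc k" "fst a"] by (simp add: skeleton_def)
  next
    case (Cons b g')
    then have "remdups_adj (replicate (Suc k) (fst a) @ map fst g) = fst a # remdups_adj (map fst g)"
      using hd by (induction k) auto
    then show ?thesis by (simp add: skeleton_def)
  qed
  finally show ?thesis using w red(1) hd that by blast
qed

text \<open>On monomials without equal neighbours a syllable of exponent \<open>e\<close> acts like
  \<open>1 + e X\<close>. A monomial at least as long as the number of syllables needs the linear
  term of every syllable, so only the skeleton survives, and its coefficient is the product of the
  nonzero exponents.\<close>

lemma mag_skeleton:
  assumes "reduced w" "distinct_adj u" "length (skeleton w) \<le> length u"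
  shows "mag w u \<noteq> 0 \<longleftrightarrow> u = skeleton w"
  using assms
proof (induction "length w" arbitrary: w u rule: less_induct)
  case less
  show ?case
  proof (cases w)
    case Nil
    then show ?thesis by (simp add: conv_unit_def)
  next
    case (Cons a v)
    obtain k g where g: "w = replicate (Suc k) a @ g" "reduced g" "skeleton w = fst a # skeleton g"
      using first_run[of a v] less.prems(1) Cons by metis
    have shorter: "length g < length w" by (simp add: g(1))
    have "mag g u = 0"
      using less.hyps[OF shorter g(2) less.prems(2)] less.prems(3) g(3) by auto
    then have *: "mag w u = (if u \<noteq> [] \<and> hd u = fst a
        then int (Suc k) * (if snd a then -1 else 1) * mag g (tl u) else 0)"
      unfolding g(1) by (simp only: mag_replicate_append[OF less.prems(2)] add_0)
    show ?thesis
    proof (cases u)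
      case (Cons b u')
      have "mag g u' \<noteq> 0 \<longleftrightarrow> u' = skeleton g"
        using less.prems less.hyps[OF shorter g(2), of u'] g(3) Cons by (cases u') auto
      then show ?thesis using * Cons by (auto simp: g(3))
    qed (use * g(3) in auto)
  qed
qed

lemma distinct_adj_rotate:
  assumes "distinct_adj u" "hd u \<noteq> last u"
  shows "distinct_adj (rotate j u)"
proof -
  let ?k = "j mod length u"
  have u: "distinct_adj (take ?k u @ drop ?k u)" using assms by simp
  show ?thesis
  proof (cases "?k = 0 \<or> u = []")
    case False
    then have "?k < length u" by simp
    then have "last (drop ?k u) \<noteq> hd (take ?k u)"
      using assms(2) False by (simp add: last_drop hd_take)
    with u show ?thesis
      unfolding rotate_drop_take distinct_adj_append_iff by auto
  qed (use assms in \<open>auto simp: rotate_drop_take\<close>)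
qed

text \<open>As the ends of the skeleton differ, its rotations have no equal neighbours either. Each
  rotation therefore contributes zero or, if it equals the skeleton, the same nonzero coefficient,
  and nothing cancels.\<close>

lemma cyc_mag_skeleton:
  assumes "reduced w" "w \<noteq> []" "hd (skeleton w) \<noteq> last (skeleton w)"
  shows "cyc_mag (skeleton w) w \<noteq> 0"
proof -
  let ?u = "skeleton w"
  have "mag w (rotate j ?u) = (if rotate j ?u = ?u then mag w ?u else 0)" for j
    using mag_skeleton[OF assms(1) distinct_adj_rotate[OF distinct_adj_skeleton assms(3)], of j] by auto
  then have "cyc_mag ?u w = (\<Sum>j<length ?u. if rotate j ?u = ?u then mag w ?u else 0)"
    by (simp add: cyc_mag_def)
  also have "\<dots> = int (card {j. j < length ?u \<and> rotate j ?u = ?u}) * mag w ?u"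
    by (simp add: sum.If_cases lessThan_def Collect_conj_eq Int_commute)
  also have "\<dots> \<noteq> 0"
  proof -
    have "0 \<in> {j. j < length ?u \<and> rotate j ?u = ?u}" using assms(2) by auto
    moreover have "finite {j. j < length ?u \<and> rotate j ?u = ?u}" by simp
    ultimately have "card {j. j < length ?u \<and> rotate j ?u = ?u} \<noteq> 0" by (metis card_eq_0_iff empty_iff)
    moreover have "mag w ?u \<noteq> 0"
      using mag_skeleton[OF assms(1) distinct_adj_skeleton] by auto
    ultimately show ?thesis by simp
  qed
  finally show ?thesis .
qed

lemma cyc_mag_long:
  assumes "reduced w" "distinct_adj u" "hd u \<noteq> last u" "length (skeleton w) < length u"
  shows "cyc_mag u w = 0"
  unfolding cyc_mag_def
proof (rule sum.neutral, rule ballI)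
  fix j
  show "mag w (rotate j u) = 0"
    using mag_skeleton[OF assms(1) distinct_adj_rotate[OF assms(2,3)], of j] assms(4)
    by (metis length_rotate less_imp_le less_irrefl)
qed

section \<open>Recognition of conjugacy classes\<close>

lemma remdups_adj_append_last: "xs \<noteq> [] \<Longrightarrow> remdups_adj (xs @ replicate k (last xs)) = remdups_adj xs"
proof (induction k)
  case (Suc k)
  have "remdups_adj (xs @ replicate (Suc k) (last xs)) =
      remdups_adj (butlast xs @ last xs # last xs # replicate k (last xs))"
    using Suc.prems by (metis append_Cons append_Nil append_assoc append_butlast_last_id replicate_Suc)
  also have "\<dots> = remdups_adj (butlast xs @ last xs # replicate k (last xs))"
    by (subst (1 2) remdups_adj_append) simp
  also have "butlast xs @ last xs # replicate k (last xs) = xs @ replicate k (last xs)"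
    using Suc.prems by (metis append_Cons append_Nil append_assoc append_butlast_last_id)
  finally show ?case using Suc by simp
qed simp

lemma length_remdups_adj_append: "length (remdups_adj xs) \<le> length (remdups_adj (xs @ ys))"
  by (induction xs rule: remdups_adj.induct) (auto simp: Suc_leI)

text \<open>More than the usual cyclic reduction is required: the first and the last syllable must
  belong to different generators. If they belong to the same one, either the outer letters agree,
  and moving the first syllable to the end merges it with the last, which saves a syllable; or the
  outer letters are inverse, and dropping both saves length. Hence the measure.\<close>

lemma cyclic_reduction:
  assumes "reduced w" "w \<in> words m"
  shows "\<exists>v w'. v \<in> words m \<and> w' \<in> words m \<and> reduced w' \<and> w = reduce (v @ w' @ inv_word v) \<and>
    (length (skeleton w') \<le> 1 \<or> hd (skeleton w') \<noteq> last (skeleton w'))"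
  using assms
proof (induction "length w + length (skeleton w)" arbitrary: w rule: less_induct)
  case less
  show ?case
  proof (cases "length (skeleton w) \<le> 1 \<or> hd (skeleton w) \<noteq> last (skeleton w)")
    case True
    then show ?thesis
      using less.prems by (intro exI[of _ "[]"] exI[of _ w]) (simp add: reduce_reduced)
  next
    case False
    then obtain a v where w: "w = a # v" by (cases w) auto
    obtain k g where g: "w = replicate (Suc k) a @ g" "reduced g" "skeleton w = fst a # skeleton g"
      using first_run[of a v] less.prems(1) w by metis
    have "g \<noteq> []" using False g(3) by auto
    have "fst (last w) = fst a" using False w by (simp add: hd_skeleton last_skeleton)
    then consider "last w = a" | "last w = inv_letter a" using same_index by blast
    then show ?thesis
    proof cases
      case 1
      let ?w = "g @ replicate (Suc k) a"
      have lg: "last g = a" using 1 g(1) \<open>g \<noteq> []\<close> by simp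
      have red: "reduced ?w"
        using g(2) lg \<open>g \<noteq> []\<close> unfolding reduced_append_iff by (metis hd_replicate inv_letter_neq nat.distinct(1) reduced_replicate)
      have "skeleton ?w = skeleton g"
        using remdups_adj_append_last[of "map fst g" "Suc k"] \<open>g \<noteq> []\<close> lg
        by (simp add: skeleton_def last_map)
      moreover have "length ?w = length w" by (simp add: g(1))
      ultimately have "length ?w + length (skeleton ?w) < length w + length (skeleton w)"
        by (simp only: g(3)) simp
      moreover have mem: "?w \<in> words m" using less.prems(2) by (simp add: g(1) del: replicate_Suc)
      ultimately obtain v w' where IH: "v \<in> words m" "w' \<in> words m" "reduced w'"
        "?w = reduce (v @ w' @ inv_word v)" "length (skeleton w') \<le> 1 \<or> hd (skeleton w') \<noteq> last (skeleton w')"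
        using less.hyps[OF _ red] by blast
      let ?r = "replicate (Suc k) a"
      have "w = reduce (?r @ reduce (?w @ inv_word ?r))"
      proof -
        have "reduce (?w @ inv_word ?r) = g"
          using reduce_append_right[of g "?r @ inv_word ?r"] g(2)
          by (simp add: reduce_inv_word' reduce_reduced del: replicate_Suc)
        then show ?thesis using less.prems(1) g(1) by (simp only: reduce_reduced)
      qed
      also have "\<dots> = reduce ((?r @ v) @ w' @ inv_word (?r @ v))"
        unfolding IH(4) by (simp add: reduce_append_left reduce_append_right del: replicate_Suc)
      finally have e: "w = reduce ((?r @ v) @ w' @ inv_word (?r @ v))" .
      have "?r @ v \<in> words m" using mem IH(1) by (simp del: replicate_Suc)
      with e IH(2,3,5) show ?thesis by blast
    next
      case 2
      then have "v \<noteq> []" using w inv_letter_neq[of a, symmetric] by auto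
      define c where "c = butlast v"
      have v: "v = c @ [inv_letter a]"
        using 2 w \<open>v \<noteq> []\<close> by (simp add: c_def) (metis append_butlast_last_id)
      have red: "reduced c"
        using less.prems(1) reduced_append_iff[of "[a]" v] by (simp add: w v reduced_append_iff)
      have "length (skeleton c) \<le> length (skeleton w)"
      proof -
        have "length (skeleton c) \<le> length (skeleton v)"
          unfolding skeleton_def v by (simp add: length_remdups_adj_append)
        also have "\<dots> \<le> length (skeleton w)"
          unfolding skeleton_def w by (cases v) auto
        finally show ?thesis .
      qed
      then have "length c + length (skeleton c) < length w + length (skeleton w)"
        by (simp add: w v)
      moreover have mem: "c \<in> words m" "fst a < m" using less.prems(2) by (auto simp: w v)
      ultimately obtain v' w' where IH: "v' \<in> words m" "w' \<in> words m" "reduced w'"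
        "c = reduce (v' @ w' @ inv_word v')" "length (skeleton w') \<le> 1 \<or> hd (skeleton w') \<noteq> last (skeleton w')"
        using less.hyps[OF _ red] by blast
      have "w = reduce ([a] @ reduce (c @ [inv_letter a]))"
        using less.prems(1) by (simp add: reduce_append_right w v reduce_reduced del: append_Cons)
          (simp add: reduce_reduced)
      also have "\<dots> = reduce ((a # v') @ w' @ inv_word (a # v'))"
        unfolding IH(4) reduce_append_left by (simp add: reduce_append_right del: append_Cons) 
          (metis append_Cons append_Nil reduce_append_right)
      finally show ?thesis
        using IH mem by (intro exI[of _ "a # v'"] exI[of _ w']) auto
    qed
  qed
qed

lemma cyc_mag_single_run:
  assumes "reduced w" "w \<noteq> []" "length (skeleton w) \<le> 1"
  obtains k a where "w = replicate (Suc k) a"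
    "cyc_mag [fst a] w = int (Suc k) * (if snd a then -1 else 1)"
proof -
  obtain a v where w: "w = a # v" using assms(2) by (cases w) auto
  obtain k g where g: "w = replicate (Suc k) a @ g" "skeleton w = fst a # skeleton g"
    using first_run[of a v] assms(1) w by metis
  then have k: "w = replicate (Suc k) a" using assms(3) by (simp del: replicate_Suc)
  moreover have "cyc_mag [fst a] w = int (Suc k) * (if snd a then -1 else 1)"
    using mag_replicate_append[of "[fst a]" "Suc k" a "[]"]
    by (simp add: cyc_mag_def k conv_unit_def del: replicate_Suc mag_simps(2))
  ultimately show ?thesis using that by blast
qed

text \<open>A nontrivial word is conjugate to one that is seen by the coefficient at its own
  skeleton, or to a power of a generator, which is seen in degree one.\<close>

lemma cyc_mag_eq_zero_imp:
  assumes w: "reduced w" and z: "\<And>u. u \<noteq> [] \<Longrightarrow> cyc_mag u w = 0"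
  shows "w = []"
proof -
  have "w \<in> words (Suc (Max (fst ` set w)))"
    by (auto simp: words_def less_Suc_eq_le)
  then obtain v w' where w': "reduced w'" "w = reduce (v @ w' @ inv_word v)"
    "length (skeleton w') \<le> 1 \<or> hd (skeleton w') \<noteq> last (skeleton w')"
    using cyclic_reduction[OF w] by blast
  have z': "cyc_mag u w' = 0" if "u \<noteq> []" for u
    using z[OF that] by (simp add: w'(2) cyc_mag_conj)
  have "w' = []"
  proof (rule ccontr)
    assume ne: "w' \<noteq> []"
    then have "length (skeleton w') \<le> 1"
      using w'(3) cyc_mag_skeleton[OF w'(1) ne] z'[of "skeleton w'"] by auto
    from cyc_mag_single_run[OF w'(1) ne this] obtain k a
      where "cyc_mag [fst a] w' = int (Suc k) * (if snd a then -1 else 1)" by blast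
    then show False using z'[of "[fst a]"] by (simp split: if_splits)
  qed
  then show ?thesis using w' by (simp add: reduce_inv_word')
qed

text \<open>A syllable-reduced conjugate with several syllables would have a nonzero coefficient at
  its skeleton, which is too long for a generator. So there is one syllable, and the coefficients of
  degree one determine its generator and exponent.\<close>

lemma conjugate_to_generator:
  assumes w: "w \<in> words m" and z: "\<And>u. cyc_mag u w = cyc_mag u [(i, False)]"
  obtains v where "v \<in> words m" "reduce w = reduce (v @ [(i, False)] @ inv_word v)"
proof -
  obtain v w' where v: "v \<in> words m" and w': "reduced w'" "reduce w = reduce (v @ w' @ inv_word v)"
    "length (skeleton w') \<le> 1 \<or> hd (skeleton w') \<noteq> last (skeleton w')"
    using cyclic_reduction[OF reduced_reduce reduce_in_words[OF w]] by blast
  have z': "cyc_mag u w' = cyc_mag u [(i, False)]" for u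
    using z[of u] cyc_mag_reduce[of u w] unfolding w'(2) cyc_mag_reduce cyc_mag_conj by simp
  have one: "cyc_mag [j] [(i, False)] = of_bool (i = j)" for j
    by (simp add: cyc_mag_def mag_single del: mag_simps)
  have ne: "w' \<noteq> []"
    using z'[of "[i]"] one[of i] by (auto simp: cyc_mag_def conv_unit_def simp del: mag_simps(2))
  have "length (skeleton w') \<le> 1"
  proof (rule ccontr)
    assume *: "\<not> length (skeleton w') \<le> 1"
    then have "hd (skeleton w') \<noteq> last (skeleton w')" using w'(3) by blast
    moreover from this have "cyc_mag (skeleton w') [(i, False)] = 0"
      by (intro cyc_mag_long) (use * in \<open>auto simp: distinct_adj_skeleton skeleton_def\<close>)
    ultimately show False using cyc_mag_skeleton[OF w'(1) ne] z' by auto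
  qed
  from cyc_mag_single_run[OF w'(1) ne this] obtain k a where
    k: "w' = replicate (Suc k) a" "cyc_mag [fst a] w' = int (Suc k) * (if snd a then -1 else 1)" .
  then have "int (Suc k) * (if snd a then -1 else 1) = of_bool (i = fst a)"
    using one[of "fst a"] z' by simp
  then have "k = 0 \<and> a = (i, False)"
    by (cases a; cases "i = fst a") (auto split: if_splits)
  then have "w' = [(i, False)]" using k(1) by simp
  with v w'(2) that show ?thesis by simp
qed

lemma commute_with_generator:
  "(\<And>l. l \<in> set p \<Longrightarrow> fst l = i) \<Longrightarrow> reduce (p @ [(i, False)] @ inv_word p) = [(i, False)]"
proof (induction p)
  case (Cons l p)
  have "reduce ((l # p) @ [(i, False)] @ inv_word (l # p)) =
      reduce ([l] @ reduce (p @ [(i, False)] @ inv_word p) @ [inv_letter l])"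
    by (metis (no_types) append_Cons append_Nil append_assoc inv_word_simps(4)
        reduce_append_left reduce_append_right)
  also have "\<dots> = reduce [l, (i, False), inv_letter l]"
    using Cons by simp
  also have "\<dots> = [(i, False)]"
    using Cons.prems[of l] by (cases l) (auto simp: reduce_Cons inv_letter_def)
  finally show ?case .
qed simp

text \<open>Letters of index \<open>i\<close> at the beginning of \<open>h\<close> can be stripped,
  since this only conjugates the product; letters of index \<open>j\<close> at its end commute with
  the generator of index \<open>j\<close>. If anything remains, the product is reduced, its outer
  syllables belong to different generators and it has more than two syllables, so the coefficient at
  its skeleton separates it from the product of the two generators.\<close>

lemma conjugate_pair:
  assumes "i \<noteq> j" "h \<in> words m" "reduced h"
    and "\<And>u. cyc_mag u ([(i, False)] @ h @ [(j, False)] @ inv_word h) = cyc_mag u [(i, False), (j, False)]"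
  shows "\<exists>p\<in>words m. (\<forall>l\<in>set p. fst l = i) \<and>
    reduce (h @ [(j, False)] @ inv_word h) = reduce (p @ [(j, False)] @ inv_word p)"
  using assms(2-)
proof (induction "length h" arbitrary: h rule: less_induct)
  case less
  let ?x = "(i, False)" and ?y = "(j, False)"
  consider "h = []" | l h' where "h = l # h'" "fst l = i" | l h' where "h = h' @ [l]" "fst l = j"
    | "h \<noteq> []" "fst (hd h) \<noteq> i" "fst (last h) \<noteq> j"
    by (metis append_butlast_last_id list.collapse)
  then show ?case
  proof cases
    case 1
    then show ?thesis by (intro bexI[of _ "[]"]) auto
  next
    \<comment> \<open>\<open>l\<close> commutes with the generator of index \<open>i\<close>, so
      removing it from \<open>h\<close> conjugates the whole product by \<open>l\<close>. It
      reappears in front of \<open>p\<close>.\<close>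
    case (2 l h')
    have "cyc_mag u ([?x] @ h' @ [?y] @ inv_word h') = cyc_mag u [?x, ?y]" for u
    proof -
      have "reduce ([l] @ ([?x] @ h' @ [?y] @ inv_word h') @ inv_word [l]) =
          reduce ([?x] @ h @ [?y] @ inv_word h)"
      proof -
        have "reduce ([l] @ [?x] @ v) = reduce ([?x] @ [l] @ v)" for v
          using 2(2) reduce_cancel(1)[of "[?x]" v] reduce_cancel(3)[of "[?x]" v]
          by (cases l; cases "snd l") (auto simp: inv_letter_def simp del: reduce_cancel)
        from this[of "h' @ [?y] @ inv_word h' @ inv_word [l]"] show ?thesis by (simp add: 2(1))
      qed
      then have "cyc_mag u ([l] @ ([?x] @ h' @ [?y] @ inv_word h') @ inv_word [l]) =
          cyc_mag u ([?x] @ h @ [?y] @ inv_word h)"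
        by (metis cyc_mag_reduce)
      with less.prems(3)[of u] show ?thesis unfolding cyc_mag_conj by simp
    qed
    moreover have "reduced h'" "h' \<in> words m"
      using less.prems 2 reduced_append_iff[of "[l]" h'] by auto
    ultimately obtain p where p: "p \<in> words m" "\<forall>l\<in>set p. fst l = i"
      "reduce (h' @ [?y] @ inv_word h') = reduce (p @ [?y] @ inv_word p)"
      using less.hyps[of h'] 2(1) by auto
    have "reduce (h @ [?y] @ inv_word h) = reduce ([l] @ reduce (h' @ [?y] @ inv_word h') @ inv_word [l])"
      by (metis (no_types) "2"(1) append_Cons append_Nil append_assoc inv_word_simps(2)
          reduce_append_left reduce_append_right)
    also have "\<dots> = reduce ((l # p) @ [?y] @ inv_word (l # p))"
      unfolding p(3)
      by (metis (no_types) append_Cons append_Nil append_assoc inv_word_simps(2)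
          reduce_append_left reduce_append_right)
    finally show ?thesis
      using p 2 less.prems(1) by (intro bexI[of _ "l # p"]) auto
  next
    case (3 l h')
    have e: "reduce (h @ [?y] @ inv_word h) = reduce (h' @ [?y] @ inv_word h')"
    proof -
      have "reduce (h @ [?y] @ inv_word h) = reduce (h' @ reduce ([l] @ [?y] @ inv_word [l]) @ inv_word h')"
        by (metis (no_types) "3"(1) append_assoc inv_word_simps(2) reduce_append_left reduce_append_right)
      also have "reduce ([l] @ [?y] @ inv_word [l]) = [?y]"
        by (rule commute_with_generator) (simp add: 3(2))
      finally show ?thesis .
    qed
    have "cyc_mag u ([?x] @ h' @ [?y] @ inv_word h') = cyc_mag u [?x, ?y]" for u
      using less.prems(3)[of u] e by (metis cyc_mag_reduce reduce_append_right)
    moreover have "reduced h'" "h' \<in> words m"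
      using less.prems 3 by (auto simp: reduced_append_iff)
    ultimately show ?thesis
      using less.hyps[of h'] 3(1) e by auto
  next
    case 4
    let ?w = "[?x] @ h @ [?y] @ inv_word h"
    have inv_ne: "inv_word h \<noteq> []" using 4(1) by (simp add: inv_word_def)
    have hd_inv: "fst (hd (inv_word h)) = fst (last h)"
      using 4(1) by (simp add: inv_word_def hd_rev last_map)
    have last_inv: "fst (last (inv_word h)) = fst (hd h)"
      using 4(1) by (simp add: inv_word_def last_rev hd_map)
    have red: "reduced ?w"
    proof -
      have ne: "a \<noteq> inv_letter b" if "fst a \<noteq> fst b" for a b using that by auto
      have "reduced ([?y] @ inv_word h)"
        unfolding reduced_append_iff using reduced_inv_word[OF less.prems(2)] hd_inv 4(3)
        by (auto intro!: ne)
      then have "reduced (h @ [?y] @ inv_word h)"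
        unfolding reduced_append_iff[of h] using less.prems(2) 4(3) by (auto intro!: ne)
      then show ?thesis
        unfolding reduced_append_iff[of "[?x]"] using 4 by (auto intro!: ne)
    qed
    have "hd (skeleton ?w) = i" "last (skeleton ?w) = fst (hd h)"
      using last_inv inv_ne by (auto simp: hd_skeleton last_skeleton)
    then have hl: "hd (skeleton ?w) \<noteq> last (skeleton ?w)" using 4(2) by auto
    have "skeleton ?w = skeleton [?x] @ skeleton (h @ [?y] @ inv_word h)"
      by (rule skeleton_append) (use 4 in auto)
    also have "skeleton (h @ [?y] @ inv_word h) = skeleton h @ skeleton ([?y] @ inv_word h)"
      by (rule skeleton_append) (use 4 in auto)
    also have "skeleton ([?y] @ inv_word h) = skeleton [?y] @ skeleton (inv_word h)"
      by (rule skeleton_append) (use 4 hd_inv in auto)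
    finally have "length (skeleton ?w) = 2 + length (skeleton h) + length (skeleton (inv_word h))"
      by (simp add: skeleton_def)
    moreover have "length (skeleton h) > 0" using 4(1) by simp
    ultimately have "length (skeleton ?w) > 2" by linarith
    moreover have "skeleton [?x, ?y] = [i, j]" using assms(1) by (simp add: skeleton_def)
    ultimately have "cyc_mag (skeleton ?w) [?x, ?y] = 0"
      by (intro cyc_mag_long) (use assms(1) hl in \<open>auto simp: distinct_adj_skeleton reduced_def inv_letter_def\<close>)
    moreover have "cyc_mag (skeleton ?w) ?w \<noteq> 0"
      by (rule cyc_mag_skeleton[OF red _ hl]) simp
    ultimately show ?thesis using less.prems(3) by metis
  qed
qed

section \<open>Simultaneous conjugacy to a basis\<close>

lemma single_index_trivial:
  assumes "\<And>l. l \<in> set p \<Longrightarrow> fst l = i" "expsum i p = 0"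
  shows "reduce p = []"
proof (rule ccontr)
  assume ne: "reduce p \<noteq> []"
  have "\<forall>a\<in>set (map fst (reduce p)). a = i"
    using assms(1) set_reduce[of p] by auto
  then have "map fst (reduce p) = replicate (length (reduce p)) i"
    by (metis length_map replicate_length_same)
  then have "length (skeleton (reduce p)) \<le> 1"
    unfolding skeleton_def by (simp add: remdups_adj_replicate)
  from cyc_mag_single_run[OF reduced_reduce ne this] obtain k a where
    "reduce p = replicate (Suc k) a" "cyc_mag [fst a] (reduce p) = int (Suc k) * (if snd a then -1 else 1)" .
  moreover from this have "fst a = i" using assms(1) set_reduce[of p] by auto
  moreover have "cyc_mag [i] (reduce p) = 0"
    using assms(2) by (simp add: cyc_mag_def mag_single del: mag_simps)
  ultimately show False
    by (simp split: if_splits)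
qed

text \<open>The commutator involves a single generator, with exponent sum zero.\<close>

lemma commute_one_generator:
  assumes "f \<in> words 1" "g \<in> words 1"
  shows "reduce (f @ g) = reduce (g @ f)"
proof -
  have "reduce (f @ g @ inv_word f @ inv_word g) = []"
  proof (rule single_index_trivial)
    show "fst l = 0" if "l \<in> set (f @ g @ inv_word f @ inv_word g)" for l
    proof -
      have "f @ g @ inv_word f @ inv_word g \<in> words 1" using assms by simp
      with that show ?thesis unfolding words_def by fastforce
    qed
    have "expsum 0 (inv_word v) = - expsum 0 v" for v
      using expsum_reduce[of 0 "inv_word v @ v"] by (simp add: reduce_inv_word)
    then show "expsum 0 (f @ g @ inv_word f @ inv_word g) = 0" by simp
  qed
  then have "reduce (reduce (f @ g @ inv_word f @ inv_word g) @ g @ f) = reduce (g @ f)"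
    by simp
  then have "reduce (g @ f) = reduce ((f @ g @ inv_word f) @ inv_word g @ g @ f)"
    by (simp add: reduce_append_left)
  also have "\<dots> = reduce ((f @ g) @ reduce (inv_word f @ f))"
    unfolding reduce_cancel(2) reduce_append_right by simp
  also have "\<dots> = reduce (f @ g)" by (simp add: reduce_inv_word)
  finally show ?thesis by simp
qed

lemma mag_two: "mag (u @ v) [a, b] = mag u [a, b] + expsum a u * expsum b v + mag v [a, b]"
  by (simp add: mag_append conv_eq_sum numeral_2_eq_2 flip: mag_single)

lemma expsum_zero: "(\<And>l. l \<in> set p \<Longrightarrow> fst l \<noteq> i) \<Longrightarrow> expsum i p = 0"
  by (induction p) auto

lemma mag_two_zero:
  assumes "a \<noteq> b" "(\<forall>l\<in>set p. fst l \<noteq> a) \<or> (\<forall>l\<in>set p. fst l \<noteq> b)"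
  shows "mag p [a, b] = 0"
  using assms(2)
proof (induction p)
  case (Cons l p)
  have "mag [l] [a, b] = 0"
    using assms(1) mag_Cons_distinct_adj[of "[a, b]" l "[]"] by (simp add: conv_unit_def)
  moreover have "expsum a [l] * expsum b p = 0"
    using Cons.prems expsum_zero[of p b] expsum_zero[of "[l]" a] by auto
  ultimately show ?case
    using mag_two[of "[l]" p a b] Cons by auto
qed (simp add: conv_unit_def)

lemma fst_set_inv_word: "fst ` set (inv_word w) = fst ` set w"
  by (auto simp: inv_word_def image_image)

lemma conjugate_cancel: "reduce w = reduce (v @ (inv_word v @ w @ v) @ inv_word v)"
proof -
  have "reduce (v @ (inv_word v @ w @ v) @ inv_word v) = reduce (w @ v @ inv_word v)"
    by simp
  also have "\<dots> = reduce w"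
    using reduce_append_right[of w "v @ inv_word v"] by (simp add: reduce_inv_word')
  finally show ?thesis by simp
qed

text \<open>One conjugation makes \<open>y 0\<close> the generator of index \<open>0\<close>, and a
  further one by a power of that generator takes care of \<open>y 1\<close>. Any other
  \<open>y j\<close> is now a conjugate of its generator both by a power \<open>p\<close> of the
  generator of index \<open>0\<close> and by a power of the one of index \<open>1\<close>. The
  coefficient at \<open>[0, j]\<close> is the exponent of \<open>p\<close> by the first description
  and zero by the second, so \<open>p\<close> is trivial.\<close>

lemma simultaneous_conjugation:
  assumes y: "\<And>i. i < m \<Longrightarrow> y i \<in> words m"
    and one: "\<And>i u. i < m \<Longrightarrow> cyc_mag u (y i) = cyc_mag u [(i, False)]"
    and two: "\<And>i j u. i < m \<Longrightarrow> j < m \<Longrightarrow> i \<noteq> j \<Longrightarrow>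
      cyc_mag u (y i @ y j) = cyc_mag u [(i, False), (j, False)]"
  shows "\<exists>f\<in>words m. \<forall>i<m. reduce (y i) = reduce (f @ [(i, False)] @ inv_word f)"
proof -
  have one': "cyc_mag u (inv_word v @ y i @ v) = cyc_mag u [(i, False)]" if "i < m" for i u v
    using one[OF that] cyc_mag_conj[of u "inv_word v" "y i"] by simp
  \<comment> \<open>Once \<open>v\<close> normalizes \<open>y i\<close>, the class of
    \<open>y i @ y j\<close> is that of the generator of index \<open>i\<close> times a conjugate of
    the generator of index \<open>j\<close>, which is the situation of
    \<open>conjugate_pair\<close>.\<close>
  have pair: "\<exists>p\<in>words m. (\<forall>l\<in>set p. fst l = i) \<and>
      reduce (inv_word v @ y j @ v) = reduce (p @ [(j, False)] @ inv_word p)"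
    if ij: "i < m" "j < m" "i \<noteq> j" and v: "v \<in> words m"
      and yi: "reduce (inv_word v @ y i @ v) = [(i, False)]" for v i j
  proof -
    have "inv_word v @ y j @ v \<in> words m" using ij v y by auto
    from conjugate_to_generator[OF this one'[OF ij(2)]]
    obtain h0 where h0: "h0 \<in> words m"
      "reduce (inv_word v @ y j @ v) = reduce (h0 @ [(j, False)] @ inv_word h0)" by blast
    define h where "h = reduce h0"
    have inv_h: "reduce (inv_word h) = reduce (inv_word h0)"
    proof -
      have "reduce (inv_word h) = reduce (inv_word h @ h0 @ inv_word h0)"
        using reduce_append_right[of "inv_word h" "h0 @ inv_word h0"] by (simp add: reduce_inv_word')
      also have "\<dots> = reduce (reduce (inv_word h @ reduce h0) @ inv_word h0)"
        unfolding reduce_append_left reduce_append_right by (metis append_assoc reduce_append_left reduce_append_right)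
      also have "\<dots> = reduce (inv_word h0)" by (simp add: h_def reduce_inv_word)
      finally show ?thesis .
    qed
    have h: "reduce (inv_word v @ y j @ v) = reduce (h @ [(j, False)] @ inv_word h)"
      unfolding h0(2) by (metis h_def inv_h reduce_append_left reduce_append_right)
    have "cyc_mag u ([(i, False)] @ h @ [(j, False)] @ inv_word h) = cyc_mag u [(i, False), (j, False)]" for u
    proof -
      have "reduce ([(i, False)] @ h @ [(j, False)] @ inv_word h) =
          reduce (reduce (inv_word v @ y i @ v) @ reduce (inv_word v @ y j @ v))"
        unfolding yi h by (simp add: reduce_append_right del: append_Cons)
      also have "\<dots> = reduce (inv_word v @ (y i @ y j) @ v)"
      proof -
        have "reduce (reduce (inv_word v @ y i @ v) @ reduce (inv_word v @ y j @ v)) =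
            reduce ((inv_word v @ y i) @ inv_word (inv_word v) @ inv_word v @ y j @ v)"
          by (simp add: reduce_append_left reduce_append_right)
        also have "\<dots> = reduce ((inv_word v @ y i) @ y j @ v)"
          using reduce_append_right[of "inv_word v @ y i" "inv_word (inv_word v) @ inv_word v @ y j @ v"]
            reduce_append_right[of "inv_word v @ y i" "y j @ v"] reduce_cancel(1)[of "inv_word v" "y j @ v"]
          by metis
        finally show ?thesis by simp
      qed
      finally have "cyc_mag u ([(i, False)] @ h @ [(j, False)] @ inv_word h) =
          cyc_mag u (inv_word v @ (y i @ y j) @ v)"
        by (metis cyc_mag_reduce)
      also have "\<dots> = cyc_mag u (y i @ y j)" using cyc_mag_conj[of u "inv_word v" "y i @ y j"] by simp
      finally show ?thesis using two[OF ij] by simp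
    qed
    moreover have "h \<in> words m" "reduced h" using h0(1) by (auto simp: h_def reduce_in_words reduced_reduce)
    ultimately show ?thesis
      using conjugate_pair[OF ij(3), of h] unfolding h by blast
  qed
  consider "m = 0" | "m = 1" | "m \<ge> 2" by linarith
  then show ?thesis
  proof cases
    case 1
    then show ?thesis by (intro bexI[of _ "[]"]) auto
  next
    case 2
    then obtain v where "v \<in> words m" "reduce (y 0) = reduce (v @ [(0, False)] @ inv_word v)"
      using conjugate_to_generator[OF y one, of 0] by auto
    with 2 show ?thesis by auto
  next
    case 3
    then obtain f0 where f0: "f0 \<in> words m" "reduce (y 0) = reduce (f0 @ [(0, False)] @ inv_word f0)"
      using conjugate_to_generator[OF y one, of 0] by auto
    have conj: "reduce (inv_word v @ w @ v) = reduce w'" if "reduce w = reduce (v @ w' @ inv_word v)" for v w w'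
    proof -
      have "reduce (inv_word v @ w @ v) = reduce (inv_word v @ reduce w @ v)"
        by (metis reduce_append_left reduce_append_right)
      also have "\<dots> = reduce (inv_word v @ (v @ w' @ inv_word v) @ v)"
        unfolding that by (metis reduce_append_left reduce_append_right)
      also have "\<dots> = reduce w'"
        using conjugate_cancel[of w' "inv_word v"] by simp
      finally show ?thesis .
    qed
    have y0: "reduce (inv_word f0 @ y 0 @ f0) = [(0, False)]"
      using conj[OF f0(2)] by simp
    obtain p where p: "p \<in> words m" "\<forall>l\<in>set p. fst l = 0"
      "reduce (inv_word f0 @ y 1 @ f0) = reduce (p @ [(1, False)] @ inv_word p)"
      using pair[of 0 1 f0] 3 f0(1) y0 by auto
    \<comment> \<open>Conjugation by \<open>p\<close> does not disturb the generator of index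
      \<open>0\<close>, because \<open>p\<close> commutes with it.\<close>
    define f where "f = f0 @ p"
    have f: "f \<in> words m" using f0 p by (simp add: f_def)
    have f_conj: "reduce (inv_word f @ w @ f) = reduce (inv_word p @ (inv_word f0 @ w @ f0) @ p)" for w
      by (simp add: f_def)
    have z0: "reduce (inv_word f @ y 0 @ f) = [(0, False)]"
    proof -
      have "reduce (inv_word f0 @ y 0 @ f0) = reduce (p @ [(0, False)] @ inv_word p)"
        using y0 commute_with_generator[of p 0] p(2) by simp
      from conj[OF this] show ?thesis by (simp add: f_conj)
    qed
    have z1: "reduce (inv_word f @ y 1 @ f) = [(1, False)]"
      using conj[OF p(3)] by (simp add: f_conj)
    have "reduce (inv_word f @ y j @ f) = [(j, False)]" if j: "j < m" for j
    proof (cases "j < 2")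
      case True
      then have "j = 0 \<or> j = 1" by auto
      with z0 z1 show ?thesis by auto
    next
      case False
      obtain p where p: "p \<in> words m" "\<forall>l\<in>set p. fst l = 0"
        "reduce (inv_word f @ y j @ f) = reduce (p @ [(j, False)] @ inv_word p)"
        using pair[of 0 j f] 3 f z0 j False by auto
      obtain q where q: "q \<in> words m" "\<forall>l\<in>set q. fst l = 1"
        "reduce (inv_word f @ y j @ f) = reduce (q @ [(j, False)] @ inv_word q)"
        using pair[of 1 j f] 3 f z1 j False by auto
      have inv: "\<forall>l\<in>set (inv_word p). fst l = 0" "\<forall>l\<in>set (inv_word q). fst l = 1"
        using p(2) q(2) fst_set_inv_word[of p] fst_set_inv_word[of q] by (metis (no_types) image_iff)+
      have "expsum j (inv_word p) = 0" by (rule expsum_zero) (use inv False in auto)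
      moreover have "mag p [0, j] = 0" "mag (inv_word p) [0, j] = 0" "mag [(j, False)] [0, j] = 0"
        by (rule mag_two_zero; use p inv False in auto)+
      ultimately have "mag (p @ [(j, False)] @ inv_word p) [0, j] = expsum 0 p"
        using False unfolding mag_two by (simp del: mag_simps)
      moreover have "expsum 0 q = 0" by (rule expsum_zero) (use q in auto)
      moreover have "mag q [0, j] = 0" "mag (inv_word q) [0, j] = 0" "mag [(j, False)] [0, j] = 0"
        by (rule mag_two_zero; use q inv False in auto)+
      ultimately have "mag (q @ [(j, False)] @ inv_word q) [0, j] = 0"
        "mag (p @ [(j, False)] @ inv_word p) [0, j] = expsum 0 p"
        using False unfolding mag_two by (simp_all del: mag_simps)
      then have "expsum 0 p = 0" using p(3) q(3) by (metis mag_reduce)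
      then have "reduce p = []" using p(2) by (intro single_index_trivial) auto
      then have "reduce (p @ [(j, False)] @ inv_word p) = reduce ([(j, False)] @ inv_word p)"
        by (metis append_Nil reduce_append_left)
      also have "reduce (inv_word p) = []"
        using \<open>reduce p = []\<close> reduce_append_right[of "inv_word p" p] reduce_inv_word[of p] by simp
      then have "reduce ([(j, False)] @ inv_word p) = [(j, False)]"
        by (metis append_Nil2 reduce_append_right reduce_singleton(1))
      finally show ?thesis using p(3) by simp
    qed
    then have "reduce (y j) = reduce (f @ [(j, False)] @ inv_word f)" if "j < m" for j
      using that conjugate_cancel[of "y j" f] by (metis reduce_append_left reduce_append_right)
    with f show ?thesis by blast
  qed
qed

text \<open>Take a generator \<open>x\<close> whose index differs from that of the first letter of
  \<open>f\<close>. Then \<open>x f\<close> is reduced, whereas \<open>f x\<close> either is reduced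
  and begins with a different letter or reduces to something shorter than \<open>f\<close>.\<close>

lemma free_group_centre:
  assumes f: "reduced f" and m: "\<And>i. i < 2 \<Longrightarrow> reduce (f @ [(i, False)]) = reduce ([(i, False)] @ f)"
  shows "f = []"
proof (rule ccontr)
  assume ne: "f \<noteq> []"
  define i :: nat where "i = (if fst (hd f) = 0 then 1 else 0)"
  have i: "fst (hd f) \<noteq> i" "i < 2" by (auto simp: i_def)
  then have "reduced ([(i, False)] @ f)"
    using f unfolding reduced_append_iff by (auto simp: inv_letter_def)
  then have e: "reduce (f @ [(i, False)]) = (i, False) # f"
    using m[OF i(2)] by (simp add: reduce_reduced)
  show False
  proof (cases "reduced (f @ [(i, False)])")
    case True
    then show ?thesis using e i(1) ne by (cases f) (auto simp: reduce_reduced)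
  next
    case False
    then have "(i, False) = inv_letter (last f)"
      using f ne unfolding reduced_append_iff by simp
    then have "last f = inv_letter (i, False)" by simp
    then obtain g where g: "f = g @ [inv_letter (i, False)]" using ne by (metis append_butlast_last_id)
    then have "reduced g" using f by (simp add: reduced_append_iff)
    then have "reduce (f @ [(i, False)]) = g"
      using reduce_cancel(2)[of g "[(i, False)]" "[]"] by (simp add: g reduce_reduced)
    with e have "length g = Suc (length f)" by simp
    then show ?thesis by (simp add: g)
  qed
qed

section \<open>Automorphisms of finite order of a free-by-cyclic group\<close>

lemma (in group) inv_cancel:
  assumes "g \<in> carrier G" "x \<in> carrier G"
  shows "g \<otimes> (inv g \<otimes> x) = x" "inv g \<otimes> (g \<otimes> x) = x"
  using assms by (simp_all add: m_assoc[symmetric])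

lemma (in group) int_pow_commute:
  assumes x: "x \<in> carrier G" and y: "y \<in> carrier G" and c: "x \<otimes> y = y \<otimes> x"
  shows "x \<otimes> y [^] (n::int) = y [^] n \<otimes> x"
proof -
  have nat: "x \<otimes> y [^] n = y [^] n \<otimes> x" for n :: nat
  proof (induction n)
    case (Suc n)
    then show ?case using x y c by (simp add: m_assoc[symmetric]) (simp add: m_assoc)
  qed (use x in simp)
  have inv: "x \<otimes> inv w = inv w \<otimes> x" if "w \<in> carrier G" "x \<otimes> w = w \<otimes> x" for w
    using that x by (metis inv_closed inv_solve_left inv_solve_right m_assoc m_closed)
  show ?thesis
    using y by (cases n rule: int_cases2) (auto simp: int_pow_int int_pow_neg nat inv)
qed

text \<open>The extension is described without a stable letter: an embedding of the free group, a
  homomorphism \<open>\<tau>\<close> to the integers whose kernel is its image, and a central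
  \<open>z\<close> with positive \<open>\<tau>\<close>. Such data are carried along isomorphisms, so
  they become available for an arbitrary presentation of the group.\<close>

locale free_by_cyclic = group G for G (structure) +
  fixes m :: nat and \<iota> :: "word \<Rightarrow> 'a" and \<tau> :: "'a \<Rightarrow> int" and z :: 'a and k :: int
  assumes iota_hom: "\<iota> \<in> hom (free_group m) G"
    and iota_inj: "inj_on \<iota> (carrier (free_group m))"
    and tau_mult: "\<And>x y. x \<in> carrier G \<Longrightarrow> y \<in> carrier G \<Longrightarrow> \<tau> (x \<otimes> y) = \<tau> x + \<tau> y"
    and tau_kernel: "\<And>x. x \<in> carrier G \<Longrightarrow> \<tau> x = 0 \<Longrightarrow> x \<in> \<iota> ` carrier (free_group m)"
    and tau_iota: "\<And>w. w \<in> carrier (free_group m) \<Longrightarrow> \<tau> (\<iota> w) = 0"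
    and z_closed [simp]: "z \<in> carrier G"
    and z_central: "\<And>x. x \<in> carrier G \<Longrightarrow> x \<otimes> z = z \<otimes> x"
    and tau_z: "\<tau> z = k" and k_pos: "k > 0" and m_pos: "m \<ge> 1"
begin

sublocale F: group "free_group m" by (rule group_free_group)

sublocale iota: group_hom "free_group m" G \<iota>
  by unfold_locales (rule iota_hom)

lemma iota_closed [simp]: "w \<in> carrier (free_group m) \<Longrightarrow> \<iota> w \<in> carrier G"
  by (rule iota.hom_closed)

lemma iota_reduce_append:
  "u \<in> words m \<Longrightarrow> v \<in> words m \<Longrightarrow> \<iota> (reduce (u @ v)) = \<iota> (reduce u) \<otimes> \<iota> (reduce v)"
  using iota.hom_mult[of "reduce u" "reduce v"] by (simp add: reduce_append_left reduce_append_right)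

lemma iota_inv_word: "w \<in> words m \<Longrightarrow> \<iota> (reduce (inv_word w)) = inv \<iota> (reduce w)"
proof -
  assume w: "w \<in> words m"
  have "\<iota> (reduce (inv_word w)) \<otimes> \<iota> (reduce w) = \<one>"
    using w iota_reduce_append[of "inv_word w" w] iota.hom_one by (simp add: reduce_inv_word)
  from inv_equality[OF this] show ?thesis using w by simp
qed

lemma tau_one: "\<tau> \<one> = 0"
  using tau_mult[of \<one> \<one>] by simp

lemma tau_inv: "x \<in> carrier G \<Longrightarrow> \<tau> (inv x) = - \<tau> x"
  using tau_mult[of x "inv x"] by (simp add: tau_one)

lemma tau_nat_pow: "x \<in> carrier G \<Longrightarrow> \<tau> (x [^] (n::nat)) = int n * \<tau> x"
  by (induction n) (auto simp: tau_one tau_mult algebra_simps)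

lemma tau_z_pow: "\<tau> (z [^] (n::int)) = n * k"
  by (cases n rule: int_cases2) (auto simp: int_pow_int int_pow_neg tau_inv tau_nat_pow tau_z)

lemma z_pow_central: "x \<in> carrier G \<Longrightarrow> x \<otimes> z [^] (n::int) = z [^] n \<otimes> x"
  by (rule int_pow_commute) (auto intro: z_central)

definition HH where "HH = {x \<in> carrier G. k dvd \<tau> x}"

definition zc :: "'a \<Rightarrow> int" where "zc x = \<tau> x div k"

text \<open>On \<open>HH\<close>, the internal direct product of the free group and the powers of
  \<open>z\<close>, this is the projection to the free factor. Its values elsewhere have no
  meaning.\<close>

definition \<pi> :: "'a \<Rightarrow> word" where
  "\<pi> x = inv_into (carrier (free_group m)) \<iota> (x \<otimes> z [^] (- zc x))"

lemma HH_closed: "x \<in> HH \<Longrightarrow> x \<in> carrier G"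
  by (simp add: HH_def)

lemma HH_subgroup: "subgroup HH G"
  by (rule subgroupI) (auto simp: HH_def tau_inv tau_mult tau_one intro!: exI[of _ \<one>])

lemma HH_decomp:
  assumes "x \<in> HH"
  shows "\<pi> x \<in> carrier (free_group m)" "x = \<iota> (\<pi> x) \<otimes> z [^] zc x"
proof -
  have x: "x \<in> carrier G" "\<tau> x = zc x * k" using assms by (auto simp: HH_def zc_def)
  then have "x \<otimes> z [^] (- zc x) \<in> \<iota> ` carrier (free_group m)"
    by (intro tau_kernel) (auto simp: tau_mult tau_z_pow)
  then show "\<pi> x \<in> carrier (free_group m)" "x = \<iota> (\<pi> x) \<otimes> z [^] zc x"
    using x by (auto simp: \<pi>_def inv_into_into f_inv_into_f m_assoc int_pow_mult[symmetric])
qed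

lemma HH_elem:
  assumes w: "w \<in> carrier (free_group m)"
  shows "\<iota> w \<otimes> z [^] (n::int) \<in> HH" "zc (\<iota> w \<otimes> z [^] n) = n" "\<pi> (\<iota> w \<otimes> z [^] n) = w"
proof -
  have t: "\<tau> (\<iota> w \<otimes> z [^] n) = n * k"
    using w by (simp add: tau_mult tau_iota tau_z_pow)
  then show "\<iota> w \<otimes> z [^] n \<in> HH" "zc (\<iota> w \<otimes> z [^] n) = n"
    using w k_pos by (auto simp: HH_def zc_def)
  then show "\<pi> (\<iota> w \<otimes> z [^] n) = w"
    using w iota_inj by (simp add: \<pi>_def m_assoc int_pow_mult[symmetric])
qed

lemma iota_HH: 
  assumes "w \<in> carrier (free_group m)"
  shows "\<iota> w \<in> HH" "zc (\<iota> w) = 0" "\<pi> (\<iota> w) = w"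
  using HH_elem[OF assms, of 0] assms by auto

lemma z_HH: "z \<in> HH" "zc z = 1" "\<pi> z = []"
  using HH_elem[of "[]" 1] iota.hom_one by (auto simp: carrier_free_group)

lemma HH_eqI: "x \<in> HH \<Longrightarrow> y \<in> HH \<Longrightarrow> \<pi> x = \<pi> y \<Longrightarrow> zc x = zc y \<Longrightarrow> x = y"
  by (metis HH_decomp(2))

lemma HH_mult:
  assumes "x \<in> HH" "y \<in> HH"
  shows "x \<otimes> y \<in> HH" "zc (x \<otimes> y) = zc x + zc y" "\<pi> (x \<otimes> y) = reduce (\<pi> x @ \<pi> y)"
proof -
  have c: "\<iota> (\<pi> x) \<in> carrier G" "\<iota> (\<pi> y) \<in> carrier G" using HH_decomp(1) assms by auto
  have "x \<otimes> y = \<iota> (\<pi> x) \<otimes> z [^] zc x \<otimes> (\<iota> (\<pi> y) \<otimes> z [^] zc y)"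
    using HH_decomp(2) assms by metis
  also have "\<dots> = \<iota> (\<pi> x) \<otimes> (z [^] zc x \<otimes> \<iota> (\<pi> y)) \<otimes> z [^] zc y"
    using c by (simp add: m_assoc)
  also have "\<dots> = \<iota> (\<pi> x) \<otimes> \<iota> (\<pi> y) \<otimes> z [^] (zc x + zc y)"
    using c unfolding z_pow_central[OF c(2), symmetric] by (simp add: m_assoc int_pow_mult)
  also have "\<dots> = \<iota> (reduce (\<pi> x @ \<pi> y)) \<otimes> z [^] (zc x + zc y)"
    using HH_decomp(1) assms iota.hom_mult by simp
  finally have e: "x \<otimes> y = \<iota> (reduce (\<pi> x @ \<pi> y)) \<otimes> z [^] (zc x + zc y)" .
  have "reduce (\<pi> x @ \<pi> y) \<in> carrier (free_group m)"
    using HH_decomp(1)[OF assms(1)] HH_decomp(1)[OF assms(2)] by (simp add: carrier_free_group reduced_reduce reduce_in_words)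
  from HH_elem[OF this] show "x \<otimes> y \<in> HH" "zc (x \<otimes> y) = zc x + zc y" "\<pi> (x \<otimes> y) = reduce (\<pi> x @ \<pi> y)"
    unfolding e by auto
qed

abbreviation K where "K \<equiv> G\<lparr>carrier := HH\<rparr>"

sublocale K: group K
  by (rule subgroup.subgroup_is_group[OF HH_subgroup is_group])

lemma K_inv: "x \<in> HH \<Longrightarrow> inv\<^bsub>K\<^esub> x = inv x"
  by (rule m_inv_consistent[OF HH_subgroup])

lemma pi_hom: "\<pi> \<in> hom K (free_group m)"
  by (rule homI) (simp_all add: HH_decomp(1) HH_mult)

abbreviation gn :: "nat \<Rightarrow> 'a" where "gn i \<equiv> \<iota> [(i, False)]"

lemma gn_mem: "i < m \<Longrightarrow> [(i, False)] \<in> carrier (free_group m)"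
  by (simp add: carrier_free_group)

lemma iota_eval: "w \<in> words m \<Longrightarrow> \<iota> (reduce w) = eval_word G gn w"
  using F.hom_eval_word[OF iota_hom is_group free_gen_closed, of w] by (simp add: eval_word_free)

lemma K_eval: "w \<in> words m \<Longrightarrow> eval_word K gn w = eval_word G gn w"
proof (induction w)
  case (Cons l w)
  have "eval_letter K gn l = eval_letter G gn l"
    using Cons.prems by (auto simp: eval_letter_def K_inv iota_HH gn_mem)
  with Cons show ?case by simp
qed simp

section \<open>Integer homomorphisms of the direct product
  \<open>F \<times> \<langle>z\<rangle>\<close>\<close>

lemma int_hom_one: "h \<in> int_homs K \<Longrightarrow> h \<one> = 0"
  using HH_subgroup subgroup.one_closed[OF HH_subgroup] by (force simp: int_homs_def dest: bspec[of HH _ \<one>])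

lemma int_hom_inv: "h \<in> int_homs K \<Longrightarrow> x \<in> HH \<Longrightarrow> h (inv x) = - h x"
proof -
  assume h: "h \<in> int_homs K" and x: "x \<in> HH"
  then have "h (x \<otimes> inv x) = h x + h (inv x)"
    using subgroup.m_inv_closed[OF HH_subgroup x] by (simp add: int_homs_def)
  with x int_hom_one[OF h] show ?thesis by (simp add: HH_closed)
qed

lemma int_hom_conj:
  "h \<in> int_homs K \<Longrightarrow> x \<in> HH \<Longrightarrow> g \<in> HH \<Longrightarrow> h (g \<otimes> x \<otimes> inv g) = h x"
  using int_hom_inv[of h g] subgroup.m_inv_closed[OF HH_subgroup, of g] HH_mult(1)
  by (simp add: int_homs_def)

lemma int_hom_iota:
  assumes h: "h \<in> int_homs K" and w: "w \<in> words m"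
  shows "h (\<iota> (reduce w)) = (\<Sum>i<m. expsum i w * h (gn i))"
  using w
proof (induction w)
  case Nil
  have "\<iota> [] = \<one>" using iota.hom_one by simp
  then show ?case using int_hom_one[OF h] by simp
next
  case (Cons l w)
  then have l: "fst l < m" "w \<in> words m" by auto
  define s :: int where "s = (if snd l then -1 else 1)"
  have le: "eval_letter G gn l \<in> HH"
    using l subgroup.m_inv_closed[OF HH_subgroup] by (auto simp: eval_letter_def iota_HH gn_mem)
  have we: "eval_word G gn w \<in> HH"
    using l iota_HH(1)[of "reduce w"] by (simp add: iota_eval)
  have "h (eval_letter G gn l) = s * h (gn (fst l))"
    using l int_hom_inv[OF h] by (auto simp: eval_letter_def s_def iota_HH gn_mem)
  then have "h (\<iota> (reduce (l # w))) = s * h (gn (fst l)) + h (\<iota> (reduce w))"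
    using h le we Cons.prems l by (simp add: iota_eval int_homs_def)
  moreover have "(\<Sum>i<m. expsum i (l # w) * h (gn i)) =
      (\<Sum>i<m. (if fst l = i then s * h (gn i) else 0)) + (\<Sum>i<m. expsum i w * h (gn i))"
    unfolding sum.distrib[symmetric] by (rule sum.cong) (auto simp: s_def algebra_simps)
  ultimately show ?case using Cons.IH l by simp
qed

lemma int_hom_zpow: "h \<in> int_homs K \<Longrightarrow> h (z [^] (n::int)) = n * h z"
proof -
  assume h: "h \<in> int_homs K"
  have zn: "z [^] (n::int) \<in> HH" for n
    using HH_elem(1)[of "[]" n] iota.hom_one by (simp add: carrier_free_group)
  have nat: "h (z [^] n) = int n * h z" for n :: nat
  proof (induction n)
    case (Suc n)
    have "h (z [^] n \<otimes> z) = h (z [^] n) + h z"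
      using h z_HH(1) zn[of "int n"] by (simp add: int_homs_def int_pow_int)
    with Suc show ?case by (simp add: algebra_simps)
  qed (simp add: int_hom_one[OF h])
  show ?thesis
    using int_hom_inv[OF h] zn[of "int _"]
    by (cases n rule: int_cases2) (auto simp: int_pow_int int_pow_neg nat)
qed

text \<open>The exponent sums and \<open>zc\<close> are coordinates of the abelianization of
  \<open>HH\<close>. If all of them are divisible by \<open>6\<close> at some element, then so is
  the value of every integer homomorphism there.\<close>

lemma int_hom_expand:
  assumes h: "h \<in> int_homs K" and x: "x \<in> HH"
  shows "h x = (\<Sum>i<m. expsum i (\<pi> x) * h (gn i)) + zc x * h z"
proof -
  have p: "\<pi> x \<in> carrier (free_group m)" by (rule HH_decomp(1)[OF x])
  then have "h (\<iota> (\<pi> x)) = (\<Sum>i<m. expsum i (\<pi> x) * h (gn i))"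
    using int_hom_iota[OF h, of "\<pi> x"] by (simp add: carrier_free_group reduce_reduced)
  moreover have "h x = h (\<iota> (\<pi> x)) + h (z [^] zc x)"
    using HH_decomp(2)[OF x] h iota_HH(1)[OF p] HH_elem(1)[of "[]" "zc x"] iota.hom_one
    by (simp add: int_homs_def carrier_free_group) metis
  ultimately show ?thesis by (simp add: int_hom_zpow[OF h])
qed

lemma zc_int_hom: "zc \<in> int_homs K"
  by (simp add: int_homs_def HH_mult)

lemma expsum_int_hom: "(\<lambda>x. expsum i (\<pi> x)) \<in> int_homs K"
  by (simp add: int_homs_def HH_mult)

definition congruence_subgroup :: "'a set" where
  "congruence_subgroup = {x \<in> HH. 6 dvd zc x \<and> (\<forall>i<m. 6 dvd expsum i (\<pi> x))}"

lemma inner_on_HH: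
  assumes aut: "\<alpha> \<in> auto G"
    and cong: "\<And>x. x \<in> carrier G \<Longrightarrow> inv x \<otimes> \<alpha> x \<in> congruence_subgroup"
    and n: "n > 0" and g: "g \<in> carrier G"
    and inner: "\<And>x. x \<in> carrier G \<Longrightarrow> (\<alpha> ^^ n) x = g \<otimes> x \<otimes> inv g"
  obtains f where "f \<in> carrier (free_group m)" "\<And>x. x \<in> HH \<Longrightarrow> \<alpha> x = \<iota> f \<otimes> x \<otimes> inv \<iota> f"
proof -
  have hom: "\<alpha> \<in> hom G G" using aut by (simp add: auto_def)
  interpret a: group_hom G G \<alpha> by unfold_locales (rule hom)
  have cH: "inv x \<otimes> \<alpha> x \<in> HH" if "x \<in> carrier G" for x
    using cong[OF that] by (simp add: congruence_subgroup_def)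
  have ax: "\<alpha> x = x \<otimes> (inv x \<otimes> \<alpha> x)" if "x \<in> carrier G" for x
    using that by (simp add: m_assoc[symmetric])
  have aH: "\<alpha> x \<in> HH" if "x \<in> HH" for x
    using ax[OF HH_closed[OF that]] HH_mult(1)[OF that cH[OF HH_closed[OF that]]] by simp
  have homK: "\<alpha> \<in> hom K K" by (rule homI) (auto simp: aH HH_closed)
  \<comment> \<open>The conjugator \<open>g\<close> may lie outside \<open>HH\<close>, but
    \<open>g^k\<close> lies in it. With \<open>n k\<close> instead of \<open>n\<close> the power of
    \<open>\<alpha>\<close> is inner on \<open>K\<close> itself, and so preserves the class
    functions and the integer homomorphisms of \<open>K\<close>.\<close>
  define N where "N = n * nat k"
  define h where "h = g [^] nat k"
  have "\<tau> h = int (nat k) * \<tau> g" unfolding h_def by (rule tau_nat_pow[OF g])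
  then have h: "h \<in> HH" using g k_pos by (simp add: HH_def) (simp add: h_def)
  have N: "N > 0" using n k_pos by (simp add: N_def)
  have inner': "(\<alpha> ^^ N) x = h \<otimes> x \<otimes> inv h" if x: "x \<in> HH" for x
  proof -
    have "((\<alpha> ^^ n) ^^ j) x = g [^] j \<otimes> x \<otimes> inv (g [^] j)" for j
    proof (induction j)
      case (Suc j)
      have "((\<alpha> ^^ n) ^^ Suc j) x = g \<otimes> (g [^] j \<otimes> x \<otimes> inv (g [^] j)) \<otimes> inv g"
        using Suc inner[of "g [^] j \<otimes> x \<otimes> inv (g [^] j)"] g x by (simp add: HH_closed)
      also have "\<dots> = (g \<otimes> g [^] j) \<otimes> x \<otimes> inv (g \<otimes> g [^] j)"
        using g x by (simp add: inv_mult_group m_assoc HH_closed)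
      also have "g \<otimes> g [^] j = g [^] Suc j" using g by (simp add: nat_pow_Suc2[symmetric])
      finally show ?case .
    qed (use x in \<open>simp add: HH_closed\<close>)
    from this[of "nat k"] show ?thesis
      unfolding N_def h_def funpow_mult by (simp only: mult.commute)
  qed
  have mink: "\<phi> (\<alpha> x) = \<phi> x" if \<phi>: "\<phi> \<in> int_homs K" and x: "x \<in> HH" for \<phi> x
  proof (rule K.minkowski[OF homK _ _ N \<phi>])
    fix \<psi> x assume \<psi>: "\<psi> \<in> int_homs K" and "x \<in> carrier K"
    then have x: "x \<in> HH" by simp
    let ?c = "inv x \<otimes> \<alpha> x"
    have c: "?c \<in> HH" using cH x HH_closed by blast
    have "\<psi> (x \<otimes> ?c) = \<psi> x + \<psi> ?c"
      using x \<psi> c by (simp add: int_homs_def)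
    then have "\<psi> (\<alpha> x) = \<psi> x + \<psi> ?c"
      by (simp only: ax[OF HH_closed[OF x], symmetric])
    moreover have "6 dvd \<psi> ?c"
      unfolding int_hom_expand[OF \<psi> c] using cong[of x] x
      by (intro dvd_add dvd_sum dvd_mult2) (auto simp: congruence_subgroup_def HH_closed)
    then have "3 dvd \<psi> ?c" by (rule dvd_trans[rotated]) simp
    ultimately show "3 dvd \<psi> (\<alpha> x) - \<psi> x" by simp
    show "\<psi> ((\<alpha> ^^ N) x) = \<psi> x"
      using inner'[OF x] int_hom_conj[OF \<psi> x h] by simp
  qed (use x in auto)
  \<comment> \<open>By \<open>mink\<close> every integer homomorphism kills
    \<open>x^-1 \<alpha>(x)\<close>. So this element has no \<open>z\<close> part and is given by a
    word in the generators with all exponent sums zero.\<close>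
  have low: "lowers_degree K (inv\<^bsub>K\<^esub> x \<otimes>\<^bsub>K\<^esub> \<alpha> x)" if "x \<in> carrier K" for x
  proof -
    have x: "x \<in> HH" using that by simp
    let ?c = "inv x \<otimes> \<alpha> x"
    have c: "?c \<in> HH" using cH x HH_closed by blast
    have zero: "\<phi> ?c = 0" if "\<phi> \<in> int_homs K" for \<phi>
    proof -
      have "\<phi> (x \<otimes> ?c) = \<phi> x + \<phi> ?c"
        using x that c by (simp add: int_homs_def)
      then have "\<phi> (\<alpha> x) = \<phi> x + \<phi> ?c"
        by (simp only: ax[OF HH_closed[OF x], symmetric])
      with mink[OF that x] show ?thesis by simp
    qed
    have p: "\<pi> ?c \<in> words m" "reduced (\<pi> ?c)" using HH_decomp(1)[OF c] by (auto simp: carrier_free_group)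
    have "?c = \<iota> (\<pi> ?c)" using HH_decomp[OF c] zero[OF zc_int_hom] by simp
    also have "\<dots> = eval_word K gn (\<pi> ?c)"
      using p iota_eval[of "\<pi> ?c"] by (simp add: K_eval reduce_reduced)
    finally have c_eq: "?c = eval_word K gn (\<pi> ?c)" .
    have "lowers_degree K (eval_word K gn (\<pi> ?c))"
      by (rule K.lowers_degree_word[of _ m]) (use p zero[OF expsum_int_hom] in \<open>auto simp: iota_HH gn_mem\<close>)
    with c_eq x show ?thesis by (simp add: K_inv)
  qed
  have cyc: "cyc_mag u (\<pi> (\<alpha> x)) = cyc_mag u (\<pi> x)" if "x \<in> HH" for x u
    by (rule K.class_function_invariant[OF homK low N, of h _ "Suc (length u)"])
      (use h that inner' K.class_function_cyc_mag[OF pi_hom] K.fpoly_cyc_mag[OF pi_hom] in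
        \<open>auto simp: K_inv simp del: fpoly.simps\<close>)
  \<comment> \<open>The exponent of \<open>z\<close> is preserved, and the free part has the same
    cyclic coefficients as the empty word.\<close>
  have az: "\<alpha> z = z"
  proof (rule HH_eqI[OF aH[OF z_HH(1)] z_HH(1)])
    show "zc (\<alpha> z) = zc z" by (rule mink[OF zc_int_hom z_HH(1)])
    have "\<pi> (\<alpha> z) = []"
    proof (rule cyc_mag_eq_zero_imp)
      show "reduced (\<pi> (\<alpha> z))" using HH_decomp(1)[OF aH[OF z_HH(1)]] by (simp add: carrier_free_group)
      show "cyc_mag u (\<pi> (\<alpha> z)) = 0" if "u \<noteq> []" for u
        using cyc[OF z_HH(1), of u] that by (simp add: z_HH cyc_mag_def conv_unit_def)
    qed
    then show "\<pi> (\<alpha> z) = \<pi> z" by (simp add: z_HH)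
  qed
  have gnH: "gn i \<in> HH" if "i < m" for i using iota_HH(1)[OF gn_mem[OF that]] .
  have "\<exists>f\<in>words m. \<forall>i<m. reduce (\<pi> (\<alpha> (gn i))) = reduce (f @ [(i, False)] @ inv_word f)"
  proof (rule simultaneous_conjugation)
    fix i assume i: "i < m"
    show "\<pi> (\<alpha> (gn i)) \<in> words m"
      using HH_decomp(1)[OF aH[OF gnH[OF i]]] by (simp add: carrier_free_group)
    show "cyc_mag u (\<pi> (\<alpha> (gn i))) = cyc_mag u [(i, False)]" for u
      using cyc[OF gnH[OF i]] by (simp add: iota_HH gn_mem i)
    fix j u assume j: "j < m" "i \<noteq> j"
    have "\<pi> (\<alpha> (gn i \<otimes> gn j)) = reduce (\<pi> (\<alpha> (gn i)) @ \<pi> (\<alpha> (gn j)))"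
      using HH_mult(3)[OF aH[OF gnH[OF i]] aH[OF gnH[OF j(1)]]] i j gn_mem by simp
    then have "cyc_mag u (\<pi> (\<alpha> (gn i)) @ \<pi> (\<alpha> (gn j))) = cyc_mag u (\<pi> (gn i \<otimes> gn j))"
      using cyc[OF HH_mult(1)[OF gnH[OF i] gnH[OF j(1)]], of u] by simp
    also have "\<dots> = cyc_mag u ([(i, False)] @ [(j, False)])"
      using HH_mult(3)[OF gnH[OF i] gnH[OF j(1)]] i j by (simp add: iota_HH gn_mem del: append_Cons)
    finally show "cyc_mag u (\<pi> (\<alpha> (gn i)) @ \<pi> (\<alpha> (gn j))) = cyc_mag u [(i, False), (j, False)]" by simp
  qed
  then obtain f where f: "f \<in> words m" "\<And>i. i < m \<Longrightarrow> reduce (\<pi> (\<alpha> (gn i))) = reduce (f @ [(i, False)] @ inv_word f)"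
    by blast
  let ?f = "\<iota> (reduce f)"
  have fc: "?f \<in> carrier G" using f by simp
  have gen: "\<alpha> (gn i) = ?f \<otimes> gn i \<otimes> inv ?f" if i: "i < m" for i
  proof -
    have "\<pi> (\<alpha> (gn i)) = reduce (f @ [(i, False)] @ inv_word f)"
      using f(2)[OF i] HH_decomp(1)[OF aH[OF gnH[OF i]]] by (simp add: carrier_free_group reduce_reduced)
    moreover have "zc (\<alpha> (gn i)) = 0"
      using mink[OF zc_int_hom gnH[OF i]] by (simp add: iota_HH gn_mem i)
    ultimately have "\<alpha> (gn i) = \<iota> (reduce (f @ [(i, False)] @ inv_word f))"
      using HH_decomp(2)[OF aH[OF gnH[OF i]]] f i by simp
    also have "\<dots> = ?f \<otimes> (\<iota> (reduce [(i, False)]) \<otimes> \<iota> (reduce (inv_word f)))"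
      using f(1) i by (subst iota_reduce_append, simp, simp, subst iota_reduce_append) auto
    finally show ?thesis using f(1) i gn_mem[OF i] by (simp add: iota_inv_word m_assoc)
  qed
  \<comment> \<open>The conjugator is known to be right on the generators only. Undoing it leaves an
    endomorphism that fixes the generators and \<open>z\<close>, hence all of
    \<open>HH\<close>.\<close>
  define \<beta> where "\<beta> = (\<lambda>x. inv ?f \<otimes> \<alpha> x \<otimes> ?f)"
  have homb: "\<beta> \<in> hom G G"
    by (rule homI) (use fc in \<open>auto simp: \<beta>_def m_assoc inv_cancel\<close>)
  have bgen: "\<beta> (gn i) = gn i" if "i < m" for i
    using gen[OF that] fc gn_mem[OF that] by (simp add: \<beta>_def m_assoc inv_cancel)
  have bz: "\<beta> z = z"
    using az fc z_central[OF fc, symmetric] by (simp add: \<beta>_def m_assoc inv_cancel)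
  interpret b: group_hom G G \<beta> by unfold_locales (rule homb)
  have biota: "\<beta> (\<iota> w) = \<iota> w" if "w \<in> carrier (free_group m)" for w
  proof -
    have w: "w \<in> words m" "reduce w = w" using that by (auto simp: carrier_free_group reduce_reduced)
    have "\<beta> (eval_word G gn w) = eval_word G (\<lambda>i. \<beta> (gn i)) w"
      by (rule hom_eval_word[OF homb is_group _ w(1)]) (auto simp: gn_mem)
    also have "\<dots> = eval_word G gn w" using bgen by (intro eval_word_cong[OF w(1)])
    finally show ?thesis using iota_eval[OF w(1)] w(2) by simp
  qed
  have "\<beta> x = x" if x: "x \<in> HH" for x
  proof -
    have "\<beta> (z [^] j) = z [^] j" for j :: int
      using bz hom_int_pow[OF homb z_closed is_group is_group] by simp
    then show ?thesis
      using HH_decomp[OF x] biota b.hom_mult[of "\<iota> (\<pi> x)" "z [^] zc x"] by simp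
  qed
  then have "\<alpha> x = ?f \<otimes> x \<otimes> inv ?f" if x: "x \<in> HH" for x
    using x fc HH_closed[OF x] a.hom_closed[OF HH_closed[OF x]] 
    by (metis \<beta>_def inv_closed inv_inv inv_solve_left inv_solve_right m_assoc m_closed)
  then show ?thesis using f(1) that[of "reduce f"] by simp
qed

section \<open>Passage from the subgroup of finite index to the whole group\<close>

lemma tau_fixes:
  assumes hom: "\<alpha> \<in> hom G G" and id: "\<And>x. x \<in> HH \<Longrightarrow> \<alpha> x = x" and x: "x \<in> carrier G"
  shows "\<alpha> x [^] nat k = x [^] nat k" "\<tau> (inv x \<otimes> \<alpha> x) = 0"
proof -
  interpret a: group_hom G G \<alpha> by unfold_locales (rule hom)
  have t: "\<tau> (y [^] nat k) = int (nat k) * \<tau> y" if "y \<in> carrier G" for y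
    by (rule tau_nat_pow[OF that])
  have "x [^] nat k \<in> HH" using x t[OF x] k_pos nat_pow_closed[OF x, of "nat k"] by (auto simp: HH_def)
  then show e: "\<alpha> x [^] nat k = x [^] nat k"
    using id[of "x [^] nat k"] hom_nat_pow[OF hom x is_group is_group, of "nat k"] by simp
  then have "\<tau> (\<alpha> x) = \<tau> x"
    using t[OF x] t[of "\<alpha> x"] x k_pos by simp
  then show "\<tau> (inv x \<otimes> \<alpha> x) = 0" using x by (simp add: tau_mult tau_inv)
qed

text \<open>Let \<open>c = x^-1 \<alpha>(x)\<close>. Since \<open>\<alpha>\<close> fixes
  \<open>x^k\<close>, \<open>\<tau>\<close> vanishes on \<open>c\<close>, so \<open>c\<close> lies
  in the free group. Since \<open>\<alpha>\<close> fixes both \<open>y\<close> and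
  \<open>x y x^-1\<close> for \<open>y\<close> in \<open>HH\<close>, \<open>c\<close> commutes with
  \<open>y\<close>. The centre of a free group of rank at least two is trivial.\<close>

lemma identity_on_HH:
  assumes m: "m \<ge> 2" and hom: "\<alpha> \<in> hom G G" and id: "\<And>x. x \<in> HH \<Longrightarrow> \<alpha> x = x"
    and x: "x \<in> carrier G"
  shows "\<alpha> x = x"
proof -
  interpret a: group_hom G G \<alpha> by unfold_locales (rule hom)
  let ?c = "inv x \<otimes> \<alpha> x"
  have c: "?c \<in> carrier G" using x by simp
  obtain w where w: "w \<in> carrier (free_group m)" "?c = \<iota> w"
    using tau_kernel[OF c tau_fixes(2)[OF hom id x]] by blast
  have comm: "?c \<otimes> y = y \<otimes> ?c" if y: "y \<in> HH" for y
  proof -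
    have yc: "y \<in> carrier G" using y by (rule HH_closed)
    have "x \<otimes> y \<otimes> inv x \<in> HH"
      using y x yc by (simp add: HH_def tau_mult tau_inv)
    then have "\<alpha> x \<otimes> y \<otimes> inv \<alpha> x = x \<otimes> y \<otimes> inv x"
      using id[of "x \<otimes> y \<otimes> inv x"] id[OF y] x yc by simp
    then have "inv x \<otimes> (\<alpha> x \<otimes> y \<otimes> inv \<alpha> x) \<otimes> \<alpha> x = inv x \<otimes> (x \<otimes> y \<otimes> inv x) \<otimes> \<alpha> x" by simp
    then show ?thesis using x yc by (simp add: m_assoc inv_cancel)
  qed
  have "w = []"
  proof (rule free_group_centre)
    show "reduced w" using w(1) by (simp add: carrier_free_group)
    fix i :: nat assume "i < 2"
    then have i: "[(i, False)] \<in> carrier (free_group m)" using m by (auto simp: carrier_free_group)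
    have "\<iota> (reduce (w @ [(i, False)])) = \<iota> (reduce ([(i, False)] @ w))"
      using comm[OF iota_HH(1)[OF i]] iota.hom_mult[OF w(1) i] iota.hom_mult[OF i w(1)] w(2) by simp
    then show "reduce (w @ [(i, False)]) = reduce ([(i, False)] @ w)"
      by (rule inj_onD[OF iota_inj]) (use w(1) i in \<open>auto simp: carrier_free_group reduced_reduce intro!: reduce_in_words\<close>)
  qed
  then have "?c = \<one>" using w(2) iota.hom_one by simp
  then show ?thesis using x by (metis a.hom_closed inv_closed inv_inv inv_equality)
qed

text \<open>Let \<open>X\<close> be the generator of the free group. Every element commutes with
  \<open>X\<close> or inverts it, and \<open>x^-1 \<alpha>(x)\<close> is an even power of
  \<open>X\<close>. Elements commuting with \<open>X\<close> are fixed, because their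
  \<open>k\<close>-th powers are and \<open>X\<close> has infinite order. If \<open>g\<close>
  inverts \<open>X\<close>, then \<open>\<alpha>(g) = g X^(2s) = X^(-s) g X^s\<close>, and
  conjugation by \<open>X^(-s)\<close> is right everywhere, since any other inverting element is
  \<open>g\<close> times one that commutes with \<open>X\<close>.\<close>

lemma inner_if_one_generator:
  assumes m: "m = 1" and hom: "\<alpha> \<in> hom G G" and id: "\<And>x. x \<in> HH \<Longrightarrow> \<alpha> x = x"
    and cong: "\<And>x. x \<in> carrier G \<Longrightarrow> inv x \<otimes> \<alpha> x \<in> congruence_subgroup"
  shows "\<exists>f\<in>carrier G. \<forall>x\<in>carrier G. \<alpha> x = f \<otimes> x \<otimes> inv f"
proof -
  interpret a: group_hom G G \<alpha> by unfold_locales (rule hom)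
  let ?X = "gn 0"
  have g0: "[(0, False)] \<in> carrier (free_group m)" using m by (simp add: carrier_free_group)
  have X: "?X \<in> carrier G" using g0 by simp
  have pow: "\<iota> (reduce w) = ?X [^] expsum 0 w" if "w \<in> words m" for w
    using that
  proof (induction w)
    case Nil
    then show ?case using iota.hom_one by simp
  next
    case (Cons l w)
    then have "fst l = 0" using m by auto
    then have "eval_letter G gn l = ?X [^] (if snd l then -1 else 1 :: int)"
      using X int_pow_neg[OF X, of 1] by (auto simp: eval_letter_def)
    with Cons \<open>fst l = 0\<close> X show ?case
      by (simp add: iota_eval int_pow_mult)
  qed
  have fix_pow: "?X [^] (j::int) = \<one> \<Longrightarrow> j = 0" for j
  proof -
    assume *: "?X [^] j = \<one>"
    define w where "w = replicate (nat \<bar>j\<bar>) (0 :: nat, j < 0)"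
    have "expsum 0 w = j" by (simp add: w_def expsum_def sum_list_replicate)
    moreover have w: "w \<in> words m" using m by (auto simp: w_def words_def)
    ultimately have "\<iota> (reduce w) = \<iota> []" using pow[OF w] * iota.hom_one by simp
    then have "reduce w = []"
      by (rule inj_onD[OF iota_inj]) (use w in \<open>auto simp: carrier_free_group reduced_reduce intro: reduce_in_words\<close>)
    then have "expsum 0 w = 0" using expsum_reduce[of 0 w] by simp
    with \<open>expsum 0 w = j\<close> show "j = 0" by simp
  qed
  have kerX: "\<exists>j::int. y = ?X [^] j" if y: "y \<in> carrier G" "\<tau> y = 0" for y
  proof -
    obtain w where "w \<in> carrier (free_group m)" "y = \<iota> w" using tau_kernel[OF y] by blast
    then show ?thesis using pow[of w] by (auto simp: carrier_free_group reduce_reduced)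
  qed
  have c: "\<exists>s::int. inv x \<otimes> \<alpha> x = ?X [^] (2 * s)" if x: "x \<in> carrier G" for x
  proof -
    have H: "inv x \<otimes> \<alpha> x \<in> HH" "6 dvd expsum 0 (\<pi> (inv x \<otimes> \<alpha> x))"
      using cong[OF x] m_pos unfolding congruence_subgroup_def by auto
    have "zc (inv x \<otimes> \<alpha> x) = 0" using tau_fixes(2)[OF hom id x] by (simp add: zc_def)
    then have "inv x \<otimes> \<alpha> x = \<iota> (\<pi> (inv x \<otimes> \<alpha> x))" using HH_decomp[OF H(1)] by simp
    also have "\<dots> = ?X [^] expsum 0 (\<pi> (inv x \<otimes> \<alpha> x))"
      using pow[of "\<pi> (inv x \<otimes> \<alpha> x)"] HH_decomp(1)[OF H(1)] by (simp add: carrier_free_group reduce_reduced)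
    finally show ?thesis using H(2) by (metis dvd_def mult.assoc mult_2 numeral_Bit0 mult_numeral_1)
  qed
  have ax: "\<alpha> x = x \<otimes> (inv x \<otimes> \<alpha> x)" if "x \<in> carrier G" for x
    using that by (simp add: inv_cancel)
  have Xpow_comm: "x \<otimes> ?X [^] (j::int) = ?X [^] j \<otimes> x" if "x \<in> carrier G" "x \<otimes> ?X = ?X \<otimes> x" for x j
    using int_pow_commute[OF that(1) X that(2)] .
  have fixed: "\<alpha> x = x" if x: "x \<in> carrier G" and xX: "x \<otimes> ?X = ?X \<otimes> x" for x
  proof -
    obtain s :: int where s: "inv x \<otimes> \<alpha> x = ?X [^] (2 * s)" using c[OF x] by blast
    have e: "\<alpha> x = x \<otimes> ?X [^] (2 * s)" using ax[OF x] s by simp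
    have "(x \<otimes> ?X [^] (2 * s)) [^] nat k = x [^] nat k \<otimes> (?X [^] (2 * s)) [^] nat k"
      using x X by (intro pow_mult_distrib Xpow_comm xX) auto
    with tau_fixes(1)[OF hom id x] e x X have "(?X [^] (2 * s)) [^] nat k = \<one>"
      by (metis int_pow_closed l_cancel_one nat_pow_closed)
    then have "?X [^] (2 * s * int (nat k)) = \<one>"
      using X by (simp add: int_pow_pow int_pow_int[symmetric])
    then have "s = 0" using fix_pow k_pos by fastforce
    then show ?thesis using e x by simp
  qed
  show ?thesis
  proof (cases "\<forall>x\<in>carrier G. x \<otimes> ?X = ?X \<otimes> x")
    case True
    then show ?thesis using fixed by (intro bexI[of _ \<one>]) auto
  next
    case False
    then obtain g where g: "g \<in> carrier G" "g \<otimes> ?X \<noteq> ?X \<otimes> g" by blast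
    \<comment> \<open>Conjugation by \<open>x\<close> and by its inverse takes \<open>X\<close> to
      powers with exponents \<open>p\<close> and \<open>q\<close>, where \<open>p q = 1\<close>.
      Hence \<open>p\<close> is \<open>1\<close> or \<open>-1\<close>.\<close>
    have invert: "x \<otimes> ?X = inv ?X \<otimes> x" if x: "x \<in> carrier G" "x \<otimes> ?X \<noteq> ?X \<otimes> x" for x
    proof -
      have t: "\<tau> (y \<otimes> ?X \<otimes> inv y) = 0" if "y \<in> carrier G" for y
        using that X tau_iota[OF g0] by (simp add: tau_mult tau_inv)
      obtain p :: int where p: "x \<otimes> ?X \<otimes> inv x = ?X [^] p"
        using kerX[OF _ t[OF x(1)]] x X by auto
      obtain q :: int where q: "inv x \<otimes> ?X \<otimes> inv (inv x) = ?X [^] q"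
        using kerX[OF _ t[of "inv x"]] x X by auto
      have conjpow: "x \<otimes> ?X [^] j \<otimes> inv x = (x \<otimes> ?X \<otimes> inv x) [^] j" for j :: int
      proof -
        have "inner_aut G x \<in> hom G G" using inner_aut_in_auto[OF x(1)] by (simp add: auto_def)
        from hom_int_pow[OF this X is_group is_group, of j] show ?thesis using X by (simp add: inner_aut_def)
      qed
      have "?X = x \<otimes> (inv x \<otimes> ?X \<otimes> inv (inv x)) \<otimes> inv x"
        using x X by (simp add: m_assoc inv_cancel)
      also have "\<dots> = ?X [^] (p * q)"
        unfolding q conjpow p using X by (simp add: int_pow_pow)
      finally have "?X [^] (p * q - 1) = \<one>"
        using X by (simp add: int_pow_diff)
      then have "p * q = 1" using fix_pow by fastforce
      then have "p = 1 \<or> p = -1" by (simp add: zmult_eq_1_iff) auto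
      moreover have "x \<otimes> ?X = ?X [^] p \<otimes> x"
        using x X p by (metis inv_closed inv_solve_right m_closed int_pow_closed)
      ultimately show ?thesis using x X int_pow_neg[OF X, of 1] by auto
    qed
    obtain s :: int where s: "inv g \<otimes> \<alpha> g = ?X [^] (2 * s)" using c[OF g(1)] by blast
    have ag: "\<alpha> g = g \<otimes> ?X [^] (2 * s)" using ax[OF g(1)] s by simp
    have gpow: "g \<otimes> ?X [^] j = ?X [^] (- j) \<otimes> g" for j :: int
    proof -
      have "inner_aut G g \<in> hom G G" using inner_aut_in_auto[OF g(1)] by (simp add: auto_def)
      from hom_int_pow[OF this X is_group is_group, of j]
      have "g \<otimes> ?X [^] j \<otimes> inv g = (g \<otimes> ?X \<otimes> inv g) [^] j" using X by (simp add: inner_aut_def)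
      also have "g \<otimes> ?X \<otimes> inv g = inv ?X"
        using invert[OF g] g(1) X by (simp add: m_assoc)
      also have "inv ?X [^] j = ?X [^] (- j)"
        using X by (simp add: int_pow_inv int_pow_neg)
      finally show ?thesis using g(1) X by (metis inv_closed inv_solve_right m_closed int_pow_closed)
    qed
    let ?f = "?X [^] (- s)"
    have fc: "?f \<in> carrier G" using X by simp
    have "\<alpha> x = ?f \<otimes> x \<otimes> inv ?f" if x: "x \<in> carrier G" for x
    proof (cases "x \<otimes> ?X = ?X \<otimes> x")
      case True
      have "?f \<otimes> x \<otimes> inv ?f = x"
        using Xpow_comm[OF x True, of "- s"] x fc by (metis inv_closed m_assoc r_inv r_one)
      then show ?thesis using fixed[OF x True] by simp
    next
      case False
      let ?y = "inv g \<otimes> x"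
      have y: "?y \<in> carrier G" using x g by simp
      have "g \<otimes> (?y \<otimes> ?X) = x \<otimes> ?X"
        using x g(1) X by (simp add: m_assoc inv_cancel)
      also have "\<dots> = inv ?X \<otimes> x" by (rule invert[OF x False])
      also have "\<dots> = inv ?X \<otimes> (g \<otimes> ?y)"
        using x g(1) by (simp add: inv_cancel)
      also have "\<dots> = inv ?X \<otimes> g \<otimes> ?y" using x g(1) X by (simp add: m_assoc)
      also have "\<dots> = g \<otimes> ?X \<otimes> ?y" by (simp only: invert[OF g])
      also have "\<dots> = g \<otimes> (?X \<otimes> ?y)" using x g(1) X by (simp add: m_assoc)
      finally have "g \<otimes> (?y \<otimes> ?X) = g \<otimes> (?X \<otimes> ?y)" .
      then have yX: "?y \<otimes> ?X = ?X \<otimes> ?y" using y g(1) X by simp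
      have xy: "x = g \<otimes> ?y" using x g(1) by (simp add: inv_cancel)
      have "\<alpha> (g \<otimes> ?y) = \<alpha> g \<otimes> ?y"
        unfolding a.hom_mult[OF g(1) y] fixed[OF y yX] ..
      also have "\<dots> = g \<otimes> ?X [^] s \<otimes> (?X [^] s \<otimes> ?y)"
      proof -
        have "?X [^] (2 * s) = ?X [^] s \<otimes> ?X [^] s" 
          using int_pow_mult[OF X, of s s] by (simp only: mult_2)
        then show ?thesis using g(1) X y by (simp add: ag m_assoc)
      qed
      also have "\<dots> = ?f \<otimes> g \<otimes> (?y \<otimes> ?X [^] s)"
        unfolding gpow Xpow_comm[OF y yX] ..
      also have "\<dots> = ?f \<otimes> (g \<otimes> ?y) \<otimes> inv ?f"
        using X g(1) y by (simp add: m_assoc int_pow_neg)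
      finally show ?thesis by (simp only: xy[symmetric])
    qed
    then show ?thesis using fc by blast
  qed
qed

text \<open>In rank at least two the conjugation found on \<open>HH\<close> is undone and the rest
  is the identity. In rank one \<open>HH\<close> is abelian, so that conjugation is trivial on
  \<open>HH\<close> and \<open>\<alpha>\<close> itself fixes \<open>HH\<close>; the congruence,
  known for \<open>\<alpha>\<close>, then remains available.\<close>

theorem inner_if_congruent:
  assumes aut: "\<alpha> \<in> auto G"
    and cong: "\<And>x. x \<in> carrier G \<Longrightarrow> inv x \<otimes> \<alpha> x \<in> congruence_subgroup"
    and n: "n > 0" and g: "g \<in> carrier G"
    and inner: "\<And>x. x \<in> carrier G \<Longrightarrow> (\<alpha> ^^ n) x = g \<otimes> x \<otimes> inv g"
  shows "\<exists>f\<in>carrier G. \<forall>x\<in>carrier G. \<alpha> x = f \<otimes> x \<otimes> inv f"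
proof -
  have hom: "\<alpha> \<in> hom G G" using aut by (simp add: auto_def)
  interpret a: group_hom G G \<alpha> by unfold_locales (rule hom)
  obtain f where f: "f \<in> carrier (free_group m)" "\<And>x. x \<in> HH \<Longrightarrow> \<alpha> x = \<iota> f \<otimes> x \<otimes> inv \<iota> f"
    using inner_on_HH[OF aut cong n g inner] by blast
  have fc: "\<iota> f \<in> carrier G" using f(1) by simp
  define \<beta> where "\<beta> = (\<lambda>x. inv \<iota> f \<otimes> \<alpha> x \<otimes> \<iota> f)"
  have homb: "\<beta> \<in> hom G G"
    by (rule homI) (use fc in \<open>auto simp: \<beta>_def m_assoc inv_cancel\<close>)
  have idb: "\<beta> x = x" if "x \<in> HH" for x
    using f(2)[OF that] fc HH_closed[OF that] by (simp add: \<beta>_def m_assoc inv_cancel)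
  have ab: "\<alpha> x = \<iota> f \<otimes> \<beta> x \<otimes> inv \<iota> f" if "x \<in> carrier G" for x
    using that fc by (simp add: \<beta>_def m_assoc inv_cancel)
  show ?thesis
  proof (cases "m = 1")
    case False
    then have "\<beta> x = x" if "x \<in> carrier G" for x
      using identity_on_HH[OF _ homb idb that] m_pos by auto
    with ab fc show ?thesis by metis
  next
    case True
    have "\<alpha> x = x" if x: "x \<in> HH" for x
    proof -
      have "\<iota> f \<otimes> \<iota> (\<pi> x) = \<iota> (\<pi> x) \<otimes> \<iota> f"
      proof -
        have "f \<in> words 1" "\<pi> x \<in> words 1"
          using f(1) HH_decomp(1)[OF x] unfolding True by (auto simp: carrier_free_group)
        then have "reduce (f @ \<pi> x) = reduce (\<pi> x @ f)" by (rule commute_one_generator)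
        then show ?thesis
          using iota.hom_mult[OF f(1) HH_decomp(1)[OF x]] iota.hom_mult[OF HH_decomp(1)[OF x] f(1)] by simp
      qed
      then have "\<iota> f \<otimes> x = x \<otimes> \<iota> f"
        using HH_decomp[OF x] fc z_pow_central[OF fc, of "zc x"]
        by (metis iota_closed int_pow_closed m_assoc z_closed)
      then have "\<iota> f \<otimes> x \<otimes> inv \<iota> f = x"
        using fc HH_closed[OF x] by (simp add: m_assoc)
      then show ?thesis using f(2)[OF x] by simp
    qed
    then show ?thesis using inner_if_one_generator[OF True hom _ cong] by blast
  qed
qed

end

section \<open>Congruences separating torsion\<close>

context group
begin

text \<open>Elements of equal signature lie in one coset, so the cosets are an image of the set of
  signatures. The signature consists of residues for the congruence subgroup, and of the values in
  all tables for the kernel of the actions.\<close>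

lemma card_rcosets_le:
  assumes S: "subgroup S G" and R: "finite R" "sig ` carrier G \<subseteq> R"
    and sig: "\<And>x y. x \<in> carrier G \<Longrightarrow> y \<in> carrier G \<Longrightarrow> sig x = sig y \<Longrightarrow> x \<otimes> inv y \<in> S"
  shows "finite (rcosets S)" "card (rcosets S) \<le> card R"
proof -
  have eq: "S #> x = S #> y" if xy: "x \<in> carrier G" "y \<in> carrier G" "sig x = sig y" for x y
  proof -
    have "x \<in> S #> y"
      using xy sig[OF xy] by (auto simp: r_coset_def m_assoc intro!: bexI[of _ "x \<otimes> inv y"])
    then show ?thesis using repr_independence[OF _ xy(2) S] by blast
  qed
  define g where "g r = S #> (SOME x. x \<in> carrier G \<and> sig x = r)" for r
  have "S #> x = g (sig x)" if "x \<in> carrier G" for x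
    using someI[of "\<lambda>x'. x' \<in> carrier G \<and> sig x' = sig x" x] that unfolding g_def by (intro eq) auto
  then have "rcosets S = g ` sig ` carrier G"
    by (auto simp: RCOSETS_def image_image)
  moreover have "finite (sig ` carrier G)" "card (sig ` carrier G) \<le> card R"
    using finite_subset[OF R(2,1)] card_mono[OF R] by auto
  ultimately show "finite (rcosets S)" "card (rcosets S) \<le> card R"
    using card_image_le[of "sig ` carrier G" g] by auto
qed

lemma autE:
  assumes "\<alpha> \<in> auto G"
  shows "\<alpha> \<in> hom G G" "bij_betw \<alpha> (carrier G) (carrier G)" "\<alpha> \<in> extensional (carrier G)"
  using assms by (auto simp: auto_def Bij_def)

lemma AutoGroup_simps [simp]:
  "carrier (AutoGroup G) = auto G" "\<one>\<^bsub>AutoGroup G\<^esub> = (\<lambda>x\<in>carrier G. x)"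
  "\<alpha> \<in> auto G \<Longrightarrow> \<beta> \<in> auto G \<Longrightarrow> \<alpha> \<otimes>\<^bsub>AutoGroup G\<^esub> \<beta> = compose (carrier G) \<alpha> \<beta>"
  by (auto simp: AutoGroup_def BijGroup_def auto_def)

lemma AutoGroup_nat_pow:
  assumes "\<alpha> \<in> auto G" "x \<in> carrier G"
  shows "(\<alpha> [^]\<^bsub>AutoGroup G\<^esub> (n::nat)) x = (\<alpha> ^^ n) x"
proof -
  interpret A: group "AutoGroup G" by (rule AutoGroup)
  show ?thesis
  proof (induction n)
    case (Suc n)
    have "\<alpha> [^]\<^bsub>AutoGroup G\<^esub> Suc n = \<alpha> \<otimes>\<^bsub>AutoGroup G\<^esub> (\<alpha> [^]\<^bsub>AutoGroup G\<^esub> n)"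
      using assms(1) by (intro A.nat_pow_Suc2) simp
    also have "\<dots> = compose (carrier G) \<alpha> (\<alpha> [^]\<^bsub>AutoGroup G\<^esub> n)"
      using assms(1) A.nat_pow_closed[of \<alpha> n] by simp
    finally show ?case using Suc assms(2) by (simp add: compose_def)
  qed (use assms in simp)
qed

lemma inner_aut_hom: "inner_aut G \<in> hom G (AutoGroup G)"
proof (rule homI)
  fix g h assume gh: "g \<in> carrier G" "h \<in> carrier G"
  have "inner_aut G (g \<otimes> h) = compose (carrier G) (inner_aut G g) (inner_aut G h)"
    using gh by (auto simp: inner_aut_def compose_def inv_mult_group m_assoc)
  then show "inner_aut G (g \<otimes> h) = inner_aut G g \<otimes>\<^bsub>AutoGroup G\<^esub> inner_aut G h"
    using gh by (simp add: inner_aut_in_auto)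
qed (simp add: inner_aut_in_auto)

lemma Inn_normal: "Inn G \<lhd> AutoGroup G"
proof -
  interpret A: group "AutoGroup G" by (rule AutoGroup)
  interpret i: group_hom G "AutoGroup G" "inner_aut G"
    by unfold_locales (rule inner_aut_hom)
  show ?thesis
  proof (rule A.normal_invI)
    show "subgroup (Inn G) (AutoGroup G)"
      unfolding Inn_def by (rule i.img_is_subgroup)
    fix \<alpha> \<beta> assume a: "\<alpha> \<in> carrier (AutoGroup G)" and "\<beta> \<in> Inn G"
    then obtain g where g: "g \<in> carrier G" "\<beta> = inner_aut G g" by (auto simp: Inn_def)
    interpret a: group_hom G G \<alpha> by unfold_locales (use a autE in simp)
    have "compose (carrier G) \<alpha> (inner_aut G g) = compose (carrier G) (inner_aut G (\<alpha> g)) \<alpha>"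
      using g by (auto simp: compose_def inner_aut_def)
    then have e: "\<alpha> \<otimes>\<^bsub>AutoGroup G\<^esub> \<beta> = inner_aut G (\<alpha> g) \<otimes>\<^bsub>AutoGroup G\<^esub> \<alpha>"
      using a g by (simp add: inner_aut_in_auto)
    have "\<alpha> \<otimes>\<^bsub>AutoGroup G\<^esub> \<beta> \<otimes>\<^bsub>AutoGroup G\<^esub> inv\<^bsub>AutoGroup G\<^esub> \<alpha> = inner_aut G (\<alpha> g)"
      unfolding e using a g i.hom_closed[of "\<alpha> g"] A.inv_closed[OF a]
        A.m_assoc[of "inner_aut G (\<alpha> g)" \<alpha> "inv\<^bsub>AutoGroup G\<^esub> \<alpha>"] A.r_inv[OF a]
        A.r_one[of "inner_aut G (\<alpha> g)"]
      by (simp del: AutoGroup_simps(2,3))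
    then show "\<alpha> \<otimes>\<^bsub>AutoGroup G\<^esub> \<beta> \<otimes>\<^bsub>AutoGroup G\<^esub> inv\<^bsub>AutoGroup G\<^esub> \<alpha> \<in> Inn G"
      using g by (auto simp: Inn_def)
  qed
qed

lemma Out_one [simp]: "\<one>\<^bsub>Out G\<^esub> = Inn G"
  by (simp add: Out_def)

lemma carrier_Out: "carrier (Out G) = out_class G ` auto G"
proof -
  interpret N: normal "Inn G" "AutoGroup G" by (rule Inn_normal)
  show ?thesis by (auto simp: Out_def out_class_def FactGroup_def RCOSETS_def)
qed

lemma out_class_eq_one_iff: "\<alpha> \<in> auto G \<Longrightarrow> out_class G \<alpha> = Inn G \<longleftrightarrow> \<alpha> \<in> Inn G"
proof -
  interpret A: group "AutoGroup G" by (rule AutoGroup)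
  interpret N: normal "Inn G" "AutoGroup G" by (rule Inn_normal)
  show "\<alpha> \<in> auto G \<Longrightarrow> out_class G \<alpha> = Inn G \<longleftrightarrow> \<alpha> \<in> Inn G"
    unfolding out_class_def using A.coset_join1[OF _ _ N.subgroup_axioms, of \<alpha>]
      A.coset_join2[OF _ N.subgroup_axioms, of \<alpha>] by auto
qed

lemma out_class_hom: "out_class G \<in> hom (AutoGroup G) (Out G)"
proof -
  interpret N: normal "Inn G" "AutoGroup G" by (rule Inn_normal)
  show ?thesis using N.r_coset_hom_Mod by (simp add: Out_def out_class_def[abs_def])
qed

lemma group_Out: "group (Out G)"
proof -
  interpret N: normal "Inn G" "AutoGroup G" by (rule Inn_normal)
  show ?thesis unfolding Out_def by (rule N.factorgroup_is_group)
qed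

lemma finite_order_Out_iff:
  assumes a: "\<alpha> \<in> auto G"
  shows "finite_order (Out G) (out_class G \<alpha>) \<longleftrightarrow>
    (\<exists>n>0. \<exists>g\<in>carrier G. \<forall>x\<in>carrier G. (\<alpha> ^^ n) x = g \<otimes> x \<otimes> inv g)"
proof -
  interpret A: group "AutoGroup G" by (rule AutoGroup)
  have "out_class G \<alpha> [^]\<^bsub>Out G\<^esub> n = \<one>\<^bsub>Out G\<^esub> \<longleftrightarrow>
      (\<exists>g\<in>carrier G. \<forall>x\<in>carrier G. (\<alpha> ^^ n) x = g \<otimes> x \<otimes> inv g)" for n :: nat
  proof -
    have an: "\<alpha> [^]\<^bsub>AutoGroup G\<^esub> n \<in> auto G" using A.nat_pow_closed[of \<alpha> n] a by simp
    have "out_class G \<alpha> [^]\<^bsub>Out G\<^esub> n = out_class G (\<alpha> [^]\<^bsub>AutoGroup G\<^esub> n)"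
      using a hom_nat_pow[OF out_class_hom _ AutoGroup group_Out, of \<alpha> n] by simp
    then have "out_class G \<alpha> [^]\<^bsub>Out G\<^esub> n = \<one>\<^bsub>Out G\<^esub> \<longleftrightarrow> \<alpha> [^]\<^bsub>AutoGroup G\<^esub> n \<in> Inn G"
      using out_class_eq_one_iff[OF an] by simp
    also have "\<dots> \<longleftrightarrow> (\<exists>g\<in>carrier G. \<forall>x\<in>carrier G. (\<alpha> [^]\<^bsub>AutoGroup G\<^esub> n) x = g \<otimes> x \<otimes> inv g)"
    proof
      assume "\<exists>g\<in>carrier G. \<forall>x\<in>carrier G. (\<alpha> [^]\<^bsub>AutoGroup G\<^esub> n) x = g \<otimes> x \<otimes> inv g"
      then obtain g where g: "g \<in> carrier G" "\<forall>x\<in>carrier G. (\<alpha> [^]\<^bsub>AutoGroup G\<^esub> n) x = g \<otimes> x \<otimes> inv g" by blast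
      have "\<alpha> [^]\<^bsub>AutoGroup G\<^esub> n = inner_aut G g"
        by (rule extensionalityI[of _ "carrier G"]) (use g autE(3)[OF an] in \<open>auto simp: inner_aut_def\<close>)
      then show "\<alpha> [^]\<^bsub>AutoGroup G\<^esub> n \<in> Inn G" using g by (simp add: Inn_def)
    qed (auto simp: Inn_def inner_aut_def)
    finally show ?thesis using AutoGroup_nat_pow[OF a] by simp
  qed
  then show ?thesis by (simp add: finite_order_def)
qed

text \<open>A class in the kernel induces conjugation by some coset \<open>N g\<close> on the
  quotient. Composing a representative with conjugation by \<open>g^-1\<close> does not change its
  class and makes it trivial on the quotient, that is, \<open>x^-1 \<beta>(x)\<close> lies in
  \<open>N\<close>. This reduces the claim to single automorphisms.\<close>

lemma congruence_separates_torsionI: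
  assumes char: "characteristic N G" and fin: "finite (rcosets N)"
    and key: "\<And>\<alpha> n g. \<alpha> \<in> auto G \<Longrightarrow> (\<And>x. x \<in> carrier G \<Longrightarrow> inv x \<otimes> \<alpha> x \<in> N) \<Longrightarrow> n > 0 \<Longrightarrow>
      g \<in> carrier G \<Longrightarrow> (\<And>x. x \<in> carrier G \<Longrightarrow> (\<alpha> ^^ n) x = g \<otimes> x \<otimes> inv g) \<Longrightarrow>
      \<exists>f\<in>carrier G. \<forall>x\<in>carrier G. \<alpha> x = f \<otimes> x \<otimes> inv f"
  shows "congruence_separates_torsion G N"
proof -
  interpret A: group "AutoGroup G" by (rule AutoGroup)
  interpret I: normal "Inn G" "AutoGroup G" by (rule Inn_normal)
  interpret N: normal N G by (rule characteristic_normal[OF char])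
  interpret Q: group "G Mod N" by (rule N.factorgroup_is_group)
  let ?K = "kernel (Out G) (Out (G Mod N)) (induced_out G N)"
  have "c = \<one>\<^bsub>Out G\<^esub>" if c: "c \<in> ?K" and tors: "finite_order ((Out G)\<lparr>carrier := ?K\<rparr>) c" for c
  proof -
    have pow: "c [^]\<^bsub>(Out G)\<lparr>carrier := ?K\<rparr>\<^esub> (n::nat) = c [^]\<^bsub>Out G\<^esub> n" for n
      by (simp add: nat_pow_def)
    obtain \<alpha> where a: "\<alpha> \<in> auto G" "c = out_class G \<alpha>"
      using c by (auto simp: kernel_def carrier_Out)
    have "induced_out G N c = Inn (G Mod N)" using c by (simp add: kernel_def)
    then have "induced_aut G N \<alpha> \<in> Inn (G Mod N)"
      using induced_out_class[OF char a(1)] a(2) Q.out_class_eq_one_iff[OF induced_aut_in_auto[OF char a(1)]] by simp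
    then obtain g where g: "g \<in> carrier G" "induced_aut G N \<alpha> = inner_aut (G Mod N) (N #> g)"
      by (auto simp: Inn_def carrier_FactGroup)
    have val: "N #> \<alpha> x = N #> (g \<otimes> x \<otimes> inv g)" if x: "x \<in> carrier G" for x
    proof -
      have "N #> \<alpha> x = induced_aut G N \<alpha> (N #> x)"
        using x image_coset[OF char a(1) x] by (simp add: induced_aut_def carrier_FactGroup)
      also have "\<dots> = N #> (g \<otimes> x \<otimes> inv g)"
        unfolding g(2) using x g(1)
        by (simp add: inner_aut_def carrier_FactGroup N.rcos_sum N.inv_FactGroup N.rcos_inv)
      finally show ?thesis .
    qed
    define \<beta> where "\<beta> = compose (carrier G) (inner_aut G (inv g)) \<alpha>"
    have ig: "inner_aut G (inv g) \<in> auto G" using g by (simp add: inner_aut_in_auto)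
    have \<beta>: "\<beta> = inner_aut G (inv g) \<otimes>\<^bsub>AutoGroup G\<^esub> \<alpha>" using ig a by (simp add: \<beta>_def)
    have b: "\<beta> \<in> auto G" using A.m_closed[of "inner_aut G (inv g)" \<alpha>] ig a(1) by (simp add: \<beta>)
    have "out_class G (inner_aut G (inv g)) = Inn G"
      using g by (subst out_class_eq_one_iff[OF ig]) (simp add: Inn_def)
    then have "out_class G \<beta> = \<one>\<^bsub>Out G\<^esub> \<otimes>\<^bsub>Out G\<^esub> out_class G \<alpha>"
      using hom_mult[OF out_class_hom, of "inner_aut G (inv g)" \<alpha>] ig a(1) by (simp add: \<beta>)
    then have cb: "c = out_class G \<beta>"
      using group.is_monoid[OF group_Out] a by (simp add: monoid.l_one carrier_Out del: Out_one)
    have bx: "\<beta> x = inv g \<otimes> \<alpha> x \<otimes> g" if "x \<in> carrier G" for x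
      using that g hom_in_carrier[OF autE(1)[OF a(1)] that] by (simp add: \<beta>_def compose_def inner_aut_def)
    have trivial: "inv x \<otimes> \<beta> x \<in> N" if x: "x \<in> carrier G" for x
    proof -
      have ax: "\<alpha> x \<in> carrier G" using hom_in_carrier[OF autE(1)[OF a(1)] x] .
      have "\<alpha> x \<in> N #> (g \<otimes> x \<otimes> inv g)"
        using val[OF x] rcos_self[OF ax N.subgroup_axioms] by simp
      then obtain n where n: "n \<in> N" "\<alpha> x = n \<otimes> (g \<otimes> x \<otimes> inv g)" by (auto simp: r_coset_def)
      have nc: "n \<in> carrier G" using n(1) by (rule N.mem_carrier)
      have "inv x \<otimes> \<beta> x = inv (g \<otimes> x) \<otimes> n \<otimes> (g \<otimes> x)"
        using x g(1) nc by (simp add: bx n(2) m_assoc inv_mult_group)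
      then show ?thesis
        using N.inv_op_closed1[of "g \<otimes> x" n] x g(1) n(1) by simp
    qed
    obtain n h where n: "n > (0::nat)" "h \<in> carrier G"
      "\<And>x. x \<in> carrier G \<Longrightarrow> (\<beta> ^^ n) x = h \<otimes> x \<otimes> inv h"
    proof -
      have "finite_order (Out G) c" using tors pow by (simp add: finite_order_def)
      then show ?thesis using that finite_order_Out_iff[OF b] unfolding cb by auto
    qed
    from key[OF b trivial n] obtain f where f: "f \<in> carrier G" "\<forall>x\<in>carrier G. \<beta> x = f \<otimes> x \<otimes> inv f" by blast
    have "\<beta> = inner_aut G f"
      by (rule extensionalityI[of _ "carrier G"]) (use f autE(3)[OF b] in \<open>auto simp: inner_aut_def\<close>)
    then have "\<beta> \<in> Inn G" using f by (simp add: Inn_def)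
    then show ?thesis using cb out_class_eq_one_iff[OF b] by simp
  qed
  then show ?thesis
    using char fin by (auto simp: congruence_separates_torsion_def torsion_free_def)
qed

end

section \<open>The index of the congruence subgroup\<close>

context free_by_cyclic
begin

lemma HH_inv:
  assumes "x \<in> HH"
  shows "inv x \<in> HH" "zc (inv x) = - zc x" "expsum i (\<pi> (inv x)) = - expsum i (\<pi> x)"
  using subgroup.m_inv_closed[OF HH_subgroup assms] int_hom_inv[OF zc_int_hom assms]
    int_hom_inv[OF expsum_int_hom assms] by auto

lemma congruence_subgroup_subgroup: "subgroup congruence_subgroup G"
proof (rule subgroupI)
  have "\<one> \<in> congruence_subgroup"
    using int_hom_one[OF zc_int_hom] int_hom_one[OF expsum_int_hom] subgroup.one_closed[OF HH_subgroup]
    by (simp add: congruence_subgroup_def)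
  then show "congruence_subgroup \<noteq> {}" by auto
qed (auto simp: congruence_subgroup_def HH_closed HH_inv HH_mult)

lemma card_rcosets_congruence_subgroup:
  "finite (rcosets congruence_subgroup)" "card (rcosets congruence_subgroup) \<le> nat k * 6 ^ Suc m"
proof -
  \<comment> \<open>A representative for each residue modulo \<open>k\<close> that
    \<open>\<tau>\<close> attains. Dividing by it moves an element into \<open>HH\<close>, where the
    coordinates modulo \<open>6\<close> are recorded.\<close>
  define s where "s a = (SOME y. y \<in> carrier G \<and> \<tau> y mod k = a)" for a
  have s: "s (\<tau> x mod k) \<in> carrier G" "\<tau> (s (\<tau> x mod k)) mod k = \<tau> x mod k" if "x \<in> carrier G" for x
    using someI[of "\<lambda>y. y \<in> carrier G \<and> \<tau> y mod k = \<tau> x mod k" x] that by (auto simp: s_def)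
  define y where "y x = x \<otimes> inv s (\<tau> x mod k)" for x
  have y: "y x \<in> HH" if "x \<in> carrier G" for x
    using s[OF that] that by (simp add: HH_def y_def tau_mult tau_inv mod_eq_dvd_iff dvd_diff_commute)
  define sig where "sig x = (\<tau> x mod k, map (\<lambda>c. c mod 6) (zc (y x) # map (\<lambda>i. expsum i (\<pi> (y x))) [0..<m]))" for x
  define R where "R = {0..<k} \<times> {xs. set xs \<subseteq> {0..<6::int} \<and> length xs = Suc m}"
  have R: "finite R" "card R = nat k * 6 ^ Suc m"
    unfolding R_def using finite_lists_length_eq[of "{0..<6::int}" "Suc m"]
    by (simp_all add: card_cartesian_product card_lists_length_eq)
  have sub: "sig ` carrier G \<subseteq> R"
    using k_pos by (auto simp: sig_def R_def)
  have key: "x \<otimes> inv x' \<in> congruence_subgroup"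
    if x: "x \<in> carrier G" "x' \<in> carrier G" and e: "sig x = sig x'" for x x'
  proof -
    have t: "\<tau> x mod k = \<tau> x' mod k" and zc: "zc (y x) mod 6 = zc (y x') mod 6"
      and ex: "\<And>i. i < m \<Longrightarrow> expsum i (\<pi> (y x)) mod 6 = expsum i (\<pi> (y x')) mod 6"
      using e by (auto simp: sig_def)
    have "x \<otimes> inv x' = y x \<otimes> inv y x'"
      using x s[OF x(1)] s[OF x(2)] t by (simp add: y_def inv_mult_group m_assoc inv_cancel)
    also have "\<dots> \<in> congruence_subgroup"
      using y[OF x(1)] y[OF x(2)] zc ex
      by (auto simp: congruence_subgroup_def HH_mult HH_inv mod_eq_dvd_iff)
    finally show ?thesis .
  qed
  have c: "finite (rcosets congruence_subgroup) \<and> card (rcosets congruence_subgroup) \<le> card R"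
    by (rule conjI; rule card_rcosets_le[OF congruence_subgroup_subgroup R(1) sub]; rule key)
  then show "finite (rcosets congruence_subgroup)" "card (rcosets congruence_subgroup) \<le> nat k * 6 ^ Suc m"
    unfolding R(2) by (rule conjunct1, rule conjunct2)
qed

end

section \<open>The structure of mapping tori\<close>

text \<open>\<open>\<phi>\<close> commutes with its powers, so conjugation by \<open>g\<close> and
  by \<open>\<phi>(g)\<close> agree and \<open>g^-1 \<phi>(g)\<close> is central. In rank at least
  two it is therefore trivial; in smaller rank all conjugations are trivial and the empty word
  serves. A fixed \<open>r\<close> is wanted because \<open>t\<^sup>k r\<close> has to commute with
  \<open>t\<close>.\<close>

lemma finite_order_fixed_conjugator:
  assumes a: "\<phi> \<in> auto (free_group m)" and fin: "finite_order (Out (free_group m)) (out_class (free_group m) \<phi>)"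
  obtains k r where "k > (0::nat)" "r \<in> carrier (free_group m)" "\<phi> r = r"
    "\<And>f. f \<in> carrier (free_group m) \<Longrightarrow> (\<phi> ^^ k) f = reduce (r @ f @ inv_word r)"
proof -
  interpret F: group "free_group m" by (rule group_free_group)
  interpret a: group_hom "free_group m" "free_group m" \<phi> by unfold_locales (rule F.autE(1)[OF a])
  obtain n g where n: "n > 0" "g \<in> carrier (free_group m)" and
    e: "\<And>x. x \<in> carrier (free_group m) \<Longrightarrow> (\<phi> ^^ n) x = reduce (g @ x @ inv_word g)"
  proof -
    obtain n g where "n > 0" "g \<in> carrier (free_group m)" "\<forall>x\<in>carrier (free_group m).
        (\<phi> ^^ n) x = g \<otimes>\<^bsub>free_group m\<^esub> x \<otimes>\<^bsub>free_group m\<^esub> inv\<^bsub>free_group m\<^esub> g"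
      using fin F.finite_order_Out_iff[OF a] by blast
    then show ?thesis
      by (intro that[of n g]) (auto simp: inv_free_group reduce_append_left reduce_append_right)
  qed
  show ?thesis
  proof (cases "m \<ge> 2")
    case False
    then have m: "words m \<subseteq> words 1" by (auto simp: words_def)
    show ?thesis
    proof (rule that[of n "[]"])
      fix f assume f: "f \<in> carrier (free_group m)"
      have w: "f \<in> words 1" "g \<in> words 1" "inv_word g \<in> words 1"
        using f n(2) m by (auto simp: carrier_free_group)
      have "reduce (g @ f @ inv_word g) = reduce (g @ inv_word g @ f)"
        using commute_one_generator[OF w(1,3)] by (metis reduce_append_right)
      then show "(\<phi> ^^ n) f = reduce ([] @ f @ inv_word [])"
        using e[OF f] by simp
    qed (use n a.hom_one in \<open>auto simp: carrier_free_group\<close>)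
  next
    case True
    let ?d = "reduce (inv_word g @ \<phi> g)"
    have pg: "\<phi> g \<in> carrier (free_group m)" using n(2) by simp
    have "?d = []"
    proof (rule free_group_centre[OF reduced_reduce])
      fix i :: nat assume "i < 2"
      then have i: "[(i, False)] \<in> carrier (free_group m)" using True by (auto simp: carrier_free_group)
      have "\<phi> ` carrier (free_group m) = carrier (free_group m)"
        using F.autE(2)[OF a] by (simp add: bij_betw_def)
      then obtain x where x: "x \<in> carrier (free_group m)" "\<phi> x = [(i, False)]"
        using i by (metis imageE)
      have px: "\<phi> x \<in> carrier (free_group m)" using x(1) by simp
      have "\<phi> ((\<phi> ^^ n) x) = (\<phi> ^^ n) (\<phi> x)" by (simp add: funpow_swap1)
      moreover have "\<phi> ((\<phi> ^^ n) x) = \<phi> g \<otimes>\<^bsub>free_group m\<^esub> \<phi> x \<otimes>\<^bsub>free_group m\<^esub> inv\<^bsub>free_group m\<^esub> \<phi> g"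
      proof -
        have "(\<phi> ^^ n) x = g \<otimes>\<^bsub>free_group m\<^esub> x \<otimes>\<^bsub>free_group m\<^esub> inv\<^bsub>free_group m\<^esub> g"
          using e[OF x(1)] n(2) by (simp add: inv_free_group reduce_append_left reduce_append_right)
        then show ?thesis using x(1) n(2) by (simp del: free_group_simps)
      qed
      ultimately have "reduce (\<phi> g @ \<phi> x @ inv_word (\<phi> g)) = reduce (g @ \<phi> x @ inv_word g)"
        using e[OF px] pg by (simp add: inv_free_group reduce_append_left reduce_append_right)
      then have "reduce (inv_word g @ reduce (\<phi> g @ \<phi> x @ inv_word (\<phi> g)) @ \<phi> g) =
          reduce (inv_word g @ reduce (g @ \<phi> x @ inv_word g) @ \<phi> g)" by simp
      moreover have "reduce (inv_word g @ reduce (\<phi> g @ \<phi> x @ inv_word (\<phi> g)) @ \<phi> g) = reduce (?d @ \<phi> x)"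
      proof -
        have "reduce (inv_word g @ reduce (\<phi> g @ \<phi> x @ inv_word (\<phi> g)) @ \<phi> g) =
            reduce ((inv_word g @ \<phi> g @ \<phi> x) @ reduce (inv_word (\<phi> g) @ \<phi> g))"
          by (metis append_assoc reduce_append_left reduce_append_right)
        also have "\<dots> = reduce (?d @ \<phi> x)" by (simp add: reduce_inv_word reduce_append_left)
        finally show ?thesis .
      qed
      moreover have "reduce (inv_word g @ reduce (g @ \<phi> x @ inv_word g) @ \<phi> g) = reduce (\<phi> x @ ?d)"
      proof -
        have "reduce (inv_word g @ reduce (g @ \<phi> x @ inv_word g) @ \<phi> g) =
            reduce (inv_word g @ g @ \<phi> x @ inv_word g @ \<phi> g)"
          by (metis append_assoc reduce_append_left reduce_append_right)
        then show ?thesis by (simp add: reduce_append_right)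
      qed
      ultimately show "reduce (?d @ [(i, False)]) = reduce ([(i, False)] @ ?d)" using x(2) by simp
    qed
    then have "reduce (g @ reduce (inv_word g @ \<phi> g)) = reduce g" by simp
    then have "\<phi> g = g"
      using n(2) pg by (simp add: reduce_append_right carrier_free_group reduce_reduced)
    then show ?thesis using that[OF n(1,2)] e by blast
  qed
qed

section \<open>Normal forms in a mapping torus\<close>

definition torus_presentation :: "nat \<Rightarrow> (nat \<Rightarrow> word) \<Rightarrow> presentation" where
  "torus_presentation m ph =
    (Suc m, map (\<lambda>i. [(m, True), (i, False), (m, False)] @ inv_word (ph i)) [0..<m])"

text \<open>The pair \<open>(n, f)\<close> stands for \<open>t^n f\<close>, and the product follows
  from \<open>t^-1 f t = \<phi>(f)\<close>. This concrete model receives a homomorphism from the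
  presented group that detects the free group and the exponent of \<open>t\<close>.\<close>

definition semidirect_int :: "('a, 'b) monoid_scheme \<Rightarrow> ('a \<Rightarrow> 'a) \<Rightarrow> (int \<times> 'a) monoid" where
  "semidirect_int F \<phi> = \<lparr>carrier = UNIV \<times> carrier F,
    mult = \<lambda>p q. (fst p + fst q, (\<phi> [^]\<^bsub>AutoGroup F\<^esub> fst q) (snd p) \<otimes>\<^bsub>F\<^esub> snd q),
    one = (0, \<one>\<^bsub>F\<^esub>)\<rparr>"

context group
begin

lemma aut_int_pow:
  fixes i j :: int
  assumes a: "\<phi> \<in> auto G"
  shows "\<phi> [^]\<^bsub>AutoGroup G\<^esub> i \<in> auto G"
    "x \<in> carrier G \<Longrightarrow> (\<phi> [^]\<^bsub>AutoGroup G\<^esub> i) x \<in> carrier G"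
    "x \<in> carrier G \<Longrightarrow> (\<phi> [^]\<^bsub>AutoGroup G\<^esub> i) ((\<phi> [^]\<^bsub>AutoGroup G\<^esub> j) x) = (\<phi> [^]\<^bsub>AutoGroup G\<^esub> (i + j)) x"
    "x \<in> carrier G \<Longrightarrow> y \<in> carrier G \<Longrightarrow> (\<phi> [^]\<^bsub>AutoGroup G\<^esub> i) (x \<otimes> y) =
      (\<phi> [^]\<^bsub>AutoGroup G\<^esub> i) x \<otimes> (\<phi> [^]\<^bsub>AutoGroup G\<^esub> i) y"
    "x \<in> carrier G \<Longrightarrow> (\<phi> [^]\<^bsub>AutoGroup G\<^esub> (0::int)) x = x"
    "x \<in> carrier G \<Longrightarrow> (\<phi> [^]\<^bsub>AutoGroup G\<^esub> (1::int)) x = \<phi> x"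
    "(\<phi> [^]\<^bsub>AutoGroup G\<^esub> i) \<one> = \<one>"
proof -
  interpret A: group "AutoGroup G" by (rule AutoGroup)
  have a': "\<phi> \<in> carrier (AutoGroup G)" using a by simp
  show p: "\<phi> [^]\<^bsub>AutoGroup G\<^esub> i \<in> auto G" for i :: int using A.int_pow_closed[OF a', of i] by simp
  show "x \<in> carrier G \<Longrightarrow> (\<phi> [^]\<^bsub>AutoGroup G\<^esub> i) x \<in> carrier G"
    using autE(1)[OF p] by (auto simp: hom_def)
  show "x \<in> carrier G \<Longrightarrow> (\<phi> [^]\<^bsub>AutoGroup G\<^esub> i) ((\<phi> [^]\<^bsub>AutoGroup G\<^esub> j) x) = (\<phi> [^]\<^bsub>AutoGroup G\<^esub> (i + j)) x"
    using A.int_pow_mult[OF a', of i j] p by (simp add: compose_def)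
  show "x \<in> carrier G \<Longrightarrow> y \<in> carrier G \<Longrightarrow> (\<phi> [^]\<^bsub>AutoGroup G\<^esub> i) (x \<otimes> y) =
      (\<phi> [^]\<^bsub>AutoGroup G\<^esub> i) x \<otimes> (\<phi> [^]\<^bsub>AutoGroup G\<^esub> i) y"
    by (rule hom_mult[OF autE(1)[OF p]])
  show "x \<in> carrier G \<Longrightarrow> (\<phi> [^]\<^bsub>AutoGroup G\<^esub> (0::int)) x = x" by simp
  show "x \<in> carrier G \<Longrightarrow> (\<phi> [^]\<^bsub>AutoGroup G\<^esub> (1::int)) x = \<phi> x"
    using A.int_pow_1[OF a'] by simp
  show "(\<phi> [^]\<^bsub>AutoGroup G\<^esub> i) \<one> = \<one>"
    by (rule hom_one[OF autE(1)[OF p] is_group is_group])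
qed

lemma group_semidirect_int:
  assumes a: "\<phi> \<in> auto G"
  shows "group (semidirect_int G \<phi>)"
proof (rule groupI)
  note s = semidirect_int_def aut_int_pow[OF a]
  fix x assume x: "x \<in> carrier (semidirect_int G \<phi>)"
  show "\<exists>y\<in>carrier (semidirect_int G \<phi>). y \<otimes>\<^bsub>semidirect_int G \<phi>\<^esub> x = \<one>\<^bsub>semidirect_int G \<phi>\<^esub>"
    by (rule bexI[of _ "(- fst x, (\<phi> [^]\<^bsub>AutoGroup G\<^esub> (- fst x)) (inv snd x))"])
      (use x in \<open>auto simp: s simp del: int_pow_0\<close>)
next
  note s = semidirect_int_def aut_int_pow[OF a]
  fix x y z assume "x \<in> carrier (semidirect_int G \<phi>)" "y \<in> carrier (semidirect_int G \<phi>)" "z \<in> carrier (semidirect_int G \<phi>)"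
  then show "x \<otimes>\<^bsub>semidirect_int G \<phi>\<^esub> y \<otimes>\<^bsub>semidirect_int G \<phi>\<^esub> z = x \<otimes>\<^bsub>semidirect_int G \<phi>\<^esub> (y \<otimes>\<^bsub>semidirect_int G \<phi>\<^esub> z)"
    by (auto simp: s m_assoc add.commute add.left_commute)
qed (auto simp: semidirect_int_def aut_int_pow[OF a])

end

lemma free_by_cyclic_iso:
  assumes "free_by_cyclic G m \<iota> \<tau> z k" and h: "h \<in> iso G H" and H: "group H"
  shows "free_by_cyclic H m (h \<circ> \<iota>) (\<tau> \<circ> inv_into (carrier G) h) (h z) k"
proof -
  interpret free_by_cyclic G m \<iota> \<tau> z k by fact
  interpret H: group H by fact
  have hom: "h \<in> hom G H" and bij: "bij_betw h (carrier G) (carrier H)" using h by (auto simp: iso_def)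
  interpret h: group_hom G H h by unfold_locales (rule hom)
  have inv: "inv_into (carrier G) h (h x) = x" if "x \<in> carrier G" for x
    using bij that by (simp add: bij_betw_def)
  have surj: "\<exists>x\<in>carrier G. y = h x" if "y \<in> carrier H" for y
    using bij that by (auto simp: bij_betw_def)
  show ?thesis
  proof unfold_locales
    show "h \<circ> \<iota> \<in> hom (free_group m) H" by (rule Group.hom_compose[OF iota_hom hom])
    have "\<iota> ` carrier (free_group m) \<subseteq> carrier G" by auto
    then have "inj_on h (\<iota> ` carrier (free_group m))" using bij by (auto simp: bij_betw_def intro: inj_on_subset)
    then show "inj_on (h \<circ> \<iota>) (carrier (free_group m))" by (rule comp_inj_on[OF iota_inj])
  next
    fix x y assume "x \<in> carrier H" "y \<in> carrier H"
    then obtain x' y' where xy: "x' \<in> carrier G" "x = h x'" "y' \<in> carrier G" "y = h y'" using surj by metis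
    then have "inv_into (carrier G) h (x \<otimes>\<^bsub>H\<^esub> y) = x' \<otimes>\<^bsub>G\<^esub> y'"
      using inv[of "x' \<otimes>\<^bsub>G\<^esub> y'"] by simp
    then show "(\<tau> \<circ> inv_into (carrier G) h) (x \<otimes>\<^bsub>H\<^esub> y) =
        (\<tau> \<circ> inv_into (carrier G) h) x + (\<tau> \<circ> inv_into (carrier G) h) y"
      using xy by (simp add: inv tau_mult)
  next
    fix x assume "x \<in> carrier H" "(\<tau> \<circ> inv_into (carrier G) h) x = 0"
    then obtain x' where "x' \<in> carrier G" "x = h x'" "\<tau> x' = 0" using surj inv by (metis comp_apply)
    then show "x \<in> (h \<circ> \<iota>) ` carrier (free_group m)" using tau_kernel by force
  next
    fix x assume "x \<in> carrier H"
    then obtain x' where x': "x' \<in> carrier G" "x = h x'" using surj by blast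
    then show "x \<otimes>\<^bsub>H\<^esub> h z = h z \<otimes>\<^bsub>H\<^esub> x"
      using z_central[OF x'(1)] h.hom_mult[of x' z] h.hom_mult[of z x'] by simp
  qed (use m_pos in \<open>auto simp: inv tau_iota tau_z k_pos\<close>)
qed

lemma word_elem_reduce: "word_elem P (reduce w) = word_elem P w"
  by (simp add: word_elem_def reduce_reduced reduced_reduce)

lemma word_elem_append:
  assumes "P \<in> presentations" "u \<in> words (fst P)" "v \<in> words (fst P)"
  shows "word_elem P (u @ v) = word_elem P u \<otimes>\<^bsub>presented_group P\<^esub> word_elem P v"
  using group.eval_word_append[OF group_presented_group[OF assms(1)] gen_closed[OF assms(1)] assms(2,3)] assms
  by (simp add: word_elem_eval)

lemma word_elem_inv_word:
  assumes "P \<in> presentations" "u \<in> words (fst P)"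
  shows "word_elem P (inv_word u) = inv\<^bsub>presented_group P\<^esub> word_elem P u"
  using group.eval_word_inv_word[OF group_presented_group[OF assms(1)] gen_closed[OF assms(1)] assms(2)] assms
  by (simp add: word_elem_eval)

lemma torus_presentation_presentations:
  "(\<And>i. i < m \<Longrightarrow> ph i \<in> words m) \<Longrightarrow> torus_presentation m ph \<in> presentations"
proof -
  assume ph: "\<And>i. i < m \<Longrightarrow> ph i \<in> words m"
  have "ph i \<in> words (Suc m)" if "i < m" for i
    using ph[OF that] by (auto simp: words_def)
  then show ?thesis by (auto simp: torus_presentation_def presentations_def)
qed

text \<open>The map to the semidirect product yields \<open>\<tau>\<close> and the injectivity of
  the free group; the relations yield the normal form \<open>t^j f\<close>, so that the kernel of
  \<open>\<tau>\<close> is the free group. The central element is \<open>z = t^k r\<close>: one has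
  \<open>f t^k r = t^k \<phi>^k(f) r = t^k r f\<close>, and \<open>z\<close> commutes with
  \<open>t\<close> because \<open>\<phi>\<close> fixes \<open>r\<close>.\<close>

lemma torus_free_by_cyclic:
  assumes m: "m \<ge> 1" and a: "\<phi> \<in> auto (free_group m)"
    and ph: "\<And>i. i < m \<Longrightarrow> ph i \<in> words m" "\<And>i. i < m \<Longrightarrow> \<phi> [(i, False)] = reduce (ph i)"
    and k: "k > 0" and r: "r \<in> carrier (free_group m)" "\<phi> r = r"
    and inner: "\<And>f. f \<in> carrier (free_group m) \<Longrightarrow> (\<phi> ^^ k) f = reduce (r @ f @ inv_word r)"
  shows "\<exists>\<iota> \<tau> z. free_by_cyclic (presented_group (torus_presentation m ph)) m \<iota> \<tau> z (int k)"
proof -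
  define T where "T = torus_presentation m ph"
  have T: "T \<in> presentations" unfolding T_def using ph(1) by (rule torus_presentation_presentations)
  have fT [simp]: "fst T = Suc m" by (simp add: T_def torus_presentation_def)
  have wm: "w \<in> words (Suc m)" if "w \<in> words m" for w using that by (auto simp: words_def)
  interpret F: group "free_group m" by (rule group_free_group)
  interpret G: group "presented_group T" by (rule group_presented_group[OF T])
  interpret a: group_hom "free_group m" "free_group m" \<phi> by unfold_locales (rule F.autE(1)[OF a])
  define S where "S = semidirect_int (free_group m) \<phi>"
  interpret S: group S unfolding S_def by (rule F.group_semidirect_int[OF a])
  have S_simps: "carrier S = UNIV \<times> carrier (free_group m)" "\<one>\<^bsub>S\<^esub> = (0, [])"
    "p \<otimes>\<^bsub>S\<^esub> q = (fst p + fst q, reduce ((\<phi> [^]\<^bsub>AutoGroup (free_group m)\<^esub> fst q) (snd p) @ snd q))" for p q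
    by (simp_all add: S_def semidirect_int_def)
  note pw = F.aut_int_pow[OF a]
  define b where "b i = (if i < m then (0 :: int, [(i, False)]) else (1, [] :: word))" for i
  have b: "b \<in> {..<Suc m} \<rightarrow> carrier S" by (auto simp: b_def S_simps carrier_free_group)
  have incl: "(\<lambda>f. (0 :: int, f)) \<in> hom (free_group m) S"
    by (rule homI) (auto simp: S_simps pw(5) simp del: int_pow_0)
  have evalb: "eval_word S b w = (0, reduce w)" if w: "w \<in> words m" for w
  proof -
    have "eval_word S b w = eval_word S (\<lambda>i. (0, [(i, False)])) w"
      by (rule eval_word_cong[OF w]) (simp add: b_def)
    also have "\<dots> = (0, reduce w)"
      using F.hom_eval_word[OF incl S.is_group free_gen_closed w] eval_word_free[OF w] by simp
    finally show ?thesis .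
  qed
  have "eval_word S b ([(m, True), (i, False), (m, False)] @ inv_word (ph i)) = \<one>\<^bsub>S\<^esub>" if i: "i < m" for i
  proof -
    have x: "[(i, False)] \<in> carrier (free_group m)" using i by (simp add: carrier_free_group)
    have t: "b m \<in> carrier S" "b i \<in> carrier S" "(0, \<phi> [(i, False)]) \<in> carrier S"
      using x a.hom_closed[OF x] by (auto simp: b_def S_simps carrier_free_group)
    have px: "reduce (\<phi> [(i, False)]) = \<phi> [(i, False)]" using ph(2)[OF i] by (simp add: reduce_reduced reduced_reduce)
    have "b i \<otimes>\<^bsub>S\<^esub> b m = b m \<otimes>\<^bsub>S\<^esub> (0, \<phi> [(i, False)])"
      using i x by (simp add: b_def S_simps pw(5,6) px carrier_free_group del: int_pow_0)
    then have conj: "inv\<^bsub>S\<^esub> b m \<otimes>\<^bsub>S\<^esub> (b i \<otimes>\<^bsub>S\<^esub> b m) = (0, \<phi> [(i, False)])"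
      using t by (simp add: S.inv_cancel)
    have "eval_word S b ([(m, True), (i, False), (m, False)] @ inv_word (ph i)) =
        inv\<^bsub>S\<^esub> b m \<otimes>\<^bsub>S\<^esub> (b i \<otimes>\<^bsub>S\<^esub> b m) \<otimes>\<^bsub>S\<^esub> eval_word S b (inv_word (ph i))"
      using t wm[OF ph(1)[OF i]] S.eval_word_closed[OF b, of "inv_word (ph i)"]
      by (simp add: eval_letter_def S.m_assoc)
    also have "\<dots> = (0, reduce (ph i)) \<otimes>\<^bsub>S\<^esub> (0, reduce (inv_word (ph i)))"
      unfolding conj using ph[OF i] by (simp add: evalb)
    also have "\<dots> = \<one>\<^bsub>S\<^esub>"
      using ph(1)[OF i] by (simp add: S_simps pw(5) reduce_append_left reduce_append_right reduce_inv_word' del: int_pow_0)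
    finally show ?thesis .
  qed
  then have rel: "eval_word S b u = \<one>\<^bsub>S\<^esub>" if "u \<in> set (snd T)" for u
    using that by (auto simp: T_def torus_presentation_def)
  have b': "b \<in> {..<fst T} \<rightarrow> carrier S" using b by simp
  obtain h where h: "h \<in> hom (presented_group T) S"
    "\<And>w. w \<in> words (Suc m) \<Longrightarrow> h (word_elem T w) = eval_word S b w"
    using presented_hom[OF T S.is_group b' rel] fT by metis
  interpret h: group_hom "presented_group T" S h by unfold_locales (rule h(1))
  define t where "t = gen T m"
  have t: "t \<in> carrier (presented_group T)" unfolding t_def by (rule word_elem_closed[OF T]) simp
  define \<tau> where "\<tau> g = fst (h g)" for g
  have tau_mult: "\<tau> (x \<otimes>\<^bsub>presented_group T\<^esub> y) = \<tau> x + \<tau> y"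
    if "x \<in> carrier (presented_group T)" "y \<in> carrier (presented_group T)" for x y
    using that by (simp add: \<tau>_def S_simps)
  have tau_t: "\<tau> t = 1"
    using h(2)[of "[(m, False)]"] by (simp add: \<tau>_def t_def eval_letter_def b_def S_simps(2,3))
  have tau_word: "\<tau> (word_elem T w) = 0" "snd (h (word_elem T w)) = reduce w" if "w \<in> words m" for w
    using h(2)[OF wm[OF that]] evalb[OF that] by (auto simp: \<tau>_def)
  have we: "word_elem T w \<in> carrier (presented_group T)" if "w \<in> words m" for w
    using word_elem_closed[OF T] wm[OF that] by simp
  have iota: "word_elem T \<in> hom (free_group m) (presented_group T)"
  proof (rule homI)
    fix u v assume "u \<in> carrier (free_group m)" "v \<in> carrier (free_group m)"
    then have uv: "u \<in> words (fst T)" "v \<in> words (fst T)" by (auto simp: carrier_free_group wm)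
    then show "word_elem T (u \<otimes>\<^bsub>free_group m\<^esub> v) = word_elem T u \<otimes>\<^bsub>presented_group T\<^esub> word_elem T v"
      using word_elem_append[OF T uv] by (simp add: word_elem_reduce)
  qed (simp add: we carrier_free_group)
  interpret i: group_hom "free_group m" "presented_group T" "word_elem T" by unfold_locales (rule iota)
  \<comment> \<open>Conjugation by \<open>t^-1\<close> and \<open>\<phi>\<close> give two
    homomorphisms from the free group that agree on the generators by the relators, hence
    everywhere.\<close>
  have conj1: "word_elem T f \<otimes>\<^bsub>presented_group T\<^esub> t = t \<otimes>\<^bsub>presented_group T\<^esub> word_elem T (\<phi> f)"
    if f: "f \<in> carrier (free_group m)" for f
  proof -
    define A where "A f = inv\<^bsub>presented_group T\<^esub> t \<otimes>\<^bsub>presented_group T\<^esub> word_elem T f \<otimes>\<^bsub>presented_group T\<^esub> t" for f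
    have A: "A \<in> hom (free_group m) (presented_group T)"
      by (rule homI) (use t in \<open>auto simp: A_def G.m_assoc G.inv_cancel simp del: free_group_simps\<close>)
    have B: "word_elem T \<circ> \<phi> \<in> hom (free_group m) (presented_group T)"
      by (rule Group.hom_compose[OF F.autE(1)[OF a] iota])
    have AB: "A [(i, False)] = (word_elem T \<circ> \<phi>) [(i, False)]" if i: "i < m" for i
    proof -
      have x: "gen T i \<in> carrier (presented_group T)" using i by (intro word_elem_closed[OF T]) simp
      have p: "ph i \<in> words (fst T)" using wm[OF ph(1)[OF i]] by simp
      have "[(m, True), (i, False), (m, False)] @ inv_word (ph i) \<in> set (snd T)"
        using i by (auto simp: T_def torus_presentation_def)
      from relator_trivial[OF T this]
      have "word_elem T (([(m, True)] @ [(i, False)] @ [(m, False)]) @ inv_word (ph i)) = \<one>\<^bsub>presented_group T\<^esub>"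
        by simp
      moreover have "word_elem T (([(m, True)] @ [(i, False)] @ [(m, False)]) @ inv_word (ph i)) =
          word_elem T ([(m, True)] @ [(i, False)] @ [(m, False)]) \<otimes>\<^bsub>presented_group T\<^esub> word_elem T (inv_word (ph i))"
        using i p by (intro word_elem_append[OF T]) auto
      moreover have "word_elem T ([(m, True)] @ [(i, False)] @ [(m, False)]) =
          word_elem T [(m, True)] \<otimes>\<^bsub>presented_group T\<^esub> (gen T i \<otimes>\<^bsub>presented_group T\<^esub> t)"
        unfolding t_def using i
        by (subst word_elem_append[OF T], simp, simp, subst word_elem_append[OF T]) auto
      moreover have "word_elem T [(m, True)] = inv\<^bsub>presented_group T\<^esub> t"
        using word_elem_inv_word[OF T, of "[(m, False)]"] by (simp add: t_def inv_letter_def)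
      ultimately have "A [(i, False)] \<otimes>\<^bsub>presented_group T\<^esub> inv\<^bsub>presented_group T\<^esub> word_elem T (ph i) = \<one>\<^bsub>presented_group T\<^esub>"
        using t x by (simp add: word_elem_inv_word[OF T p] A_def G.m_assoc)
      from G.inv_equality[OF this] have "A [(i, False)] = word_elem T (ph i)"
        using word_elem_closed[OF T p] hom_in_carrier[OF A, of "[(i, False)]"] i by (simp add: carrier_free_group)
      then show ?thesis using ph(2)[OF i] by (simp add: word_elem_reduce)
    qed
    have w: "f \<in> words m" "reduce f = f" using f by (auto simp: carrier_free_group reduce_reduced)
    have ef: "eval_word (free_group m) (\<lambda>i. [(i, False)]) f = f"
      using eval_word_free[OF w(1)] w(2) by simp
    have "A f = eval_word (presented_group T) (\<lambda>i. A [(i, False)]) f"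
      using F.hom_eval_word[OF A G.is_group free_gen_closed w(1)] unfolding ef .
    also have "\<dots> = eval_word (presented_group T) (\<lambda>i. (word_elem T \<circ> \<phi>) [(i, False)]) f"
      by (rule eval_word_cong[OF w(1) AB])
    also have "\<dots> = (word_elem T \<circ> \<phi>) f"
      using F.hom_eval_word[OF B G.is_group free_gen_closed w(1)] unfolding ef by (rule sym)
    finally have "A f = word_elem T (\<phi> f)" by simp
    then have "t \<otimes>\<^bsub>presented_group T\<^esub> A f = t \<otimes>\<^bsub>presented_group T\<^esub> word_elem T (\<phi> f)" by simp
    then show ?thesis using t we w(1) by (simp add: A_def G.m_assoc G.inv_cancel)
  qed
  have conjn: "word_elem T f \<otimes>\<^bsub>presented_group T\<^esub> t [^]\<^bsub>presented_group T\<^esub> n =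
      t [^]\<^bsub>presented_group T\<^esub> n \<otimes>\<^bsub>presented_group T\<^esub> word_elem T ((\<phi> ^^ n) f)"
    if f: "f \<in> carrier (free_group m)" for f and n :: nat
  proof (induction n)
    case (Suc n)
    have pf: "(\<phi> ^^ n) f \<in> carrier (free_group m)" by (rule F.funpow_hom_closed[OF F.autE(1)[OF a] f])
    have pf': "word_elem T f \<in> carrier (presented_group T)" "word_elem T ((\<phi> ^^ n) f) \<in> carrier (presented_group T)"
      "word_elem T (\<phi> ((\<phi> ^^ n) f)) \<in> carrier (presented_group T)"
      using f pf a.hom_closed[OF pf] by (auto intro: i.hom_closed)
    have "word_elem T f \<otimes>\<^bsub>presented_group T\<^esub> t [^]\<^bsub>presented_group T\<^esub> Suc n =
        (word_elem T f \<otimes>\<^bsub>presented_group T\<^esub> t [^]\<^bsub>presented_group T\<^esub> n) \<otimes>\<^bsub>presented_group T\<^esub> t"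
      using t pf' by (simp add: G.m_assoc)
    also have "\<dots> = t [^]\<^bsub>presented_group T\<^esub> n \<otimes>\<^bsub>presented_group T\<^esub> (word_elem T ((\<phi> ^^ n) f) \<otimes>\<^bsub>presented_group T\<^esub> t)"
      unfolding Suc using t pf' by (simp add: G.m_assoc)
    also have "\<dots> = t [^]\<^bsub>presented_group T\<^esub> Suc n \<otimes>\<^bsub>presented_group T\<^esub> word_elem T ((\<phi> ^^ Suc n) f)"
      unfolding conj1[OF pf] using t pf' by (simp add: G.m_assoc)
    finally show ?case .
  qed (use f in \<open>simp add: i.hom_closed\<close>)
  have conjz: "\<exists>f'\<in>carrier (free_group m). word_elem T f \<otimes>\<^bsub>presented_group T\<^esub> t [^]\<^bsub>presented_group T\<^esub> j =
      t [^]\<^bsub>presented_group T\<^esub> j \<otimes>\<^bsub>presented_group T\<^esub> word_elem T f'"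
    if f: "f \<in> carrier (free_group m)" for f and j :: int
  proof (cases j rule: int_cases2)
    case (nonneg n)
    then show ?thesis
      using conjn[OF f, of n] F.funpow_hom_closed[OF F.autE(1)[OF a] f, of n] by (auto simp: int_pow_int)
  next
    \<comment> \<open>Writing \<open>f\<close> as \<open>\<phi>^n(f')\<close> with
      \<open>\<phi>\<close> bijective, the rule for \<open>t^n\<close>, applied to
      \<open>f'\<close>, can be solved for the negative power.\<close>
    case (nonpos n)
    have "bij_betw (\<phi> ^^ n) (carrier (free_group m)) (carrier (free_group m))"
      using F.autE(2)[OF a] by (rule bij_betw_funpow)
    then obtain f' where f': "f' \<in> carrier (free_group m)" "(\<phi> ^^ n) f' = f"
      using f by (metis bij_betw_def imageE)
    let ?s = "t [^]\<^bsub>presented_group T\<^esub> n"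
    have c: "word_elem T f' \<in> carrier (presented_group T)" "word_elem T f \<in> carrier (presented_group T)"
      "?s \<in> carrier (presented_group T)" using f f' t by (auto intro: i.hom_closed)
    have "inv\<^bsub>presented_group T\<^esub> ?s \<otimes>\<^bsub>presented_group T\<^esub> (word_elem T f' \<otimes>\<^bsub>presented_group T\<^esub> ?s) \<otimes>\<^bsub>presented_group T\<^esub>
        inv\<^bsub>presented_group T\<^esub> ?s = word_elem T f \<otimes>\<^bsub>presented_group T\<^esub> inv\<^bsub>presented_group T\<^esub> ?s"
      using conjn[OF f'(1), of n] c f'(2) by (simp add: G.inv_cancel)
    then have "word_elem T f \<otimes>\<^bsub>presented_group T\<^esub> inv\<^bsub>presented_group T\<^esub> ?s =
        inv\<^bsub>presented_group T\<^esub> ?s \<otimes>\<^bsub>presented_group T\<^esub> word_elem T f'"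
      using c by (simp add: G.m_assoc)
    then show ?thesis using f'(1) t by (auto simp: nonpos G.int_pow_neg int_pow_int)
  qed
  have normal_form: "\<exists>j::int. \<exists>f\<in>carrier (free_group m). word_elem T w = t [^]\<^bsub>presented_group T\<^esub> j \<otimes>\<^bsub>presented_group T\<^esub> word_elem T f"
    if "w \<in> words (Suc m)" for w
    using that
  proof (induction w)
    case Nil
    have "word_elem T [] = \<one>\<^bsub>presented_group T\<^esub>" using i.hom_one by simp
    then show ?case
      by (intro exI[of _ "0::int"] bexI[of _ "[]"]) (auto simp: carrier_free_group)
  next
    case (Cons l w)
    then obtain j :: int and f where f: "f \<in> carrier (free_group m)"
      "word_elem T w = t [^]\<^bsub>presented_group T\<^esub> j \<otimes>\<^bsub>presented_group T\<^esub> word_elem T f" by auto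
    have fc: "word_elem T f \<in> carrier (presented_group T)" using f(1) by (rule i.hom_closed)
    have step: "word_elem T (l # w) = word_elem T [l] \<otimes>\<^bsub>presented_group T\<^esub> word_elem T w"
      using Cons.prems word_elem_append[OF T, of "[l]" w] by simp
    show ?case
    proof (cases "fst l < m")
      case True
      then have l: "[l] \<in> carrier (free_group m)" by (simp add: carrier_free_group)
      then obtain f' where f': "f' \<in> carrier (free_group m)" "word_elem T [l] \<otimes>\<^bsub>presented_group T\<^esub> t [^]\<^bsub>presented_group T\<^esub> j =
          t [^]\<^bsub>presented_group T\<^esub> j \<otimes>\<^bsub>presented_group T\<^esub> word_elem T f'" using conjz by blast
      have "word_elem T (l # w) = t [^]\<^bsub>presented_group T\<^esub> j \<otimes>\<^bsub>presented_group T\<^esub> (word_elem T f' \<otimes>\<^bsub>presented_group T\<^esub> word_elem T f)"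
        unfolding step f(2) using f'(2) i.hom_closed[OF l] i.hom_closed[OF f'(1)] fc t
        by (simp add: G.m_assoc[symmetric])
      also have "\<dots> = t [^]\<^bsub>presented_group T\<^esub> j \<otimes>\<^bsub>presented_group T\<^esub> word_elem T (f' \<otimes>\<^bsub>free_group m\<^esub> f)"
        unfolding i.hom_mult[OF f'(1) f(1)] ..
      finally show ?thesis using F.m_closed[OF f'(1) f(1)] by blast
    next
      case False
      then have "fst l = m" using Cons.prems by simp
      then have "word_elem T [l] = t [^]\<^bsub>presented_group T\<^esub> (if snd l then -1 else 1 :: int)"
        using t G.int_pow_neg[OF t, of 1] word_elem_inv_word[OF T, of "[(m, False)]"]
        by (cases l) (auto simp: t_def inv_letter_def)
      then have "word_elem T (l # w) = t [^]\<^bsub>presented_group T\<^esub> ((if snd l then -1 else 1) + j) \<otimes>\<^bsub>presented_group T\<^esub> word_elem T f"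
        unfolding step f(2) using t fc by (simp add: G.int_pow_mult[OF t] G.m_assoc)
      then show ?thesis using f(1) by blast
    qed
  qed
  define z where "z = t [^]\<^bsub>presented_group T\<^esub> k \<otimes>\<^bsub>presented_group T\<^esub> word_elem T r"
  have rc: "word_elem T r \<in> carrier (presented_group T)" using r(1) by (rule i.hom_closed)
  have z: "z \<in> carrier (presented_group T)" using t rc by (simp add: z_def)
  have zf: "word_elem T f \<otimes>\<^bsub>presented_group T\<^esub> z = z \<otimes>\<^bsub>presented_group T\<^esub> word_elem T f"
    if f: "f \<in> carrier (free_group m)" for f
  proof -
    have fc: "word_elem T f \<in> carrier (presented_group T)" using f by (rule i.hom_closed)
    have pk: "(\<phi> ^^ k) f \<in> carrier (free_group m)" by (rule F.funpow_hom_closed[OF F.autE(1)[OF a] f])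
    have "(\<phi> ^^ k) f \<otimes>\<^bsub>free_group m\<^esub> r = reduce ((r @ f) @ reduce (inv_word r @ r))"
      unfolding inner[OF f] using reduce_append_right[of "r @ f" "inv_word r @ r"]
      by (simp add: reduce_append_left)
    then have e: "(\<phi> ^^ k) f \<otimes>\<^bsub>free_group m\<^esub> r = r \<otimes>\<^bsub>free_group m\<^esub> f"
      by (simp add: reduce_inv_word)
    have "word_elem T f \<otimes>\<^bsub>presented_group T\<^esub> z =
        t [^]\<^bsub>presented_group T\<^esub> k \<otimes>\<^bsub>presented_group T\<^esub> (word_elem T ((\<phi> ^^ k) f) \<otimes>\<^bsub>presented_group T\<^esub> word_elem T r)"
      using conjn[OF f, of k] t rc fc i.hom_closed[OF pk] by (simp add: z_def G.m_assoc[symmetric])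
    also have "\<dots> = t [^]\<^bsub>presented_group T\<^esub> k \<otimes>\<^bsub>presented_group T\<^esub> (word_elem T r \<otimes>\<^bsub>presented_group T\<^esub> word_elem T f)"
      using i.hom_mult[OF pk r(1)] i.hom_mult[OF r(1) f] e by simp
    finally show ?thesis using t rc fc by (simp add: z_def G.m_assoc)
  qed
  have zt: "z \<otimes>\<^bsub>presented_group T\<^esub> t = t \<otimes>\<^bsub>presented_group T\<^esub> z"
    using conj1[OF r(1)] t rc r(2) by (simp add: z_def G.m_assoc flip: G.nat_pow_Suc2)
      (simp add: G.m_assoc[symmetric] G.nat_pow_Suc2[symmetric])
  have tau_one: "\<tau> \<one>\<^bsub>presented_group T\<^esub> = 0" using tau_mult[of "\<one>\<^bsub>presented_group T\<^esub>" "\<one>\<^bsub>presented_group T\<^esub>"] by simp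
  have tau_pow: "\<tau> (t [^]\<^bsub>presented_group T\<^esub> n) = int n" for n :: nat
    using t by (induction n) (auto simp: tau_one tau_mult tau_t)
  have tau_inv: "\<tau> (inv\<^bsub>presented_group T\<^esub> x) = - \<tau> x" if "x \<in> carrier (presented_group T)" for x
    using tau_mult[of x "inv\<^bsub>presented_group T\<^esub> x"] that tau_one by simp
  have tau_int_pow: "\<tau> (t [^]\<^bsub>presented_group T\<^esub> j) = j" for j :: int
    using t by (cases j rule: int_cases2) (auto simp: int_pow_int G.int_pow_neg tau_inv tau_pow)
  have nf: "\<exists>j::int. \<exists>f\<in>carrier (free_group m). g = t [^]\<^bsub>presented_group T\<^esub> j \<otimes>\<^bsub>presented_group T\<^esub> word_elem T f"
    if g: "g \<in> carrier (presented_group T)" for g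
  proof -
    obtain w where "w \<in> words (fst T)" "g = word_elem T w" by (rule word_elem_surj[OF T g])
    with normal_form[of w] show ?thesis by simp
  qed
  have "free_by_cyclic (presented_group T) m (word_elem T) \<tau> z (int k)"
  proof unfold_locales
    show "word_elem T \<in> hom (free_group m) (presented_group T)" by (rule iota)
    show "inj_on (word_elem T) (carrier (free_group m))"
      by (rule inj_on_inverseI[where g = "\<lambda>g. snd (h g)"]) (auto simp: carrier_free_group tau_word reduce_reduced)
    fix x assume x: "x \<in> carrier (presented_group T)"
    then obtain j :: int and f where f: "f \<in> carrier (free_group m)" "x = t [^]\<^bsub>presented_group T\<^esub> j \<otimes>\<^bsub>presented_group T\<^esub> word_elem T f"
      using nf by blast
    have fc: "word_elem T f \<in> carrier (presented_group T)" using f(1) by (rule i.hom_closed)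
    have "\<tau> x = j" using f t fc tau_word(1)[of f] by (simp add: tau_mult tau_int_pow carrier_free_group)
    then show "x \<in> word_elem T ` carrier (free_group m)" if "\<tau> x = 0"
      using that f fc by simp
    have "z \<otimes>\<^bsub>presented_group T\<^esub> t [^]\<^bsub>presented_group T\<^esub> j = t [^]\<^bsub>presented_group T\<^esub> j \<otimes>\<^bsub>presented_group T\<^esub> z"
      by (rule G.int_pow_commute[OF z t zt])
    then show "x \<otimes>\<^bsub>presented_group T\<^esub> z = z \<otimes>\<^bsub>presented_group T\<^esub> x"
      using f zf[OF f(1)] t z fc by (metis G.int_pow_closed G.m_assoc)
  qed (use z k m tau_mult tau_word tau_pow t rc r in \<open>auto simp: carrier_free_group z_def\<close>)
  then show ?thesis unfolding T_def by blast
qed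

section \<open>The intersection of all subgroups of small index\<close>

text \<open>A right action, as suits right cosets and words that are executed from left to right.
  Only the points below \<open>N\<close> matter.\<close>

definition perm_action :: "('a, 'b) monoid_scheme \<Rightarrow> nat \<Rightarrow> ('a \<Rightarrow> nat \<Rightarrow> nat) \<Rightarrow> bool" where
  "perm_action G N A \<longleftrightarrow> (\<forall>g\<in>carrier G. \<forall>j<N. A g j < N) \<and> (\<forall>j<N. A \<one>\<^bsub>G\<^esub> j = j) \<and>
    (\<forall>g\<in>carrier G. \<forall>h\<in>carrier G. \<forall>j<N. A (g \<otimes>\<^bsub>G\<^esub> h) j = A h (A g j))"

definition action_kernel :: "('a, 'b) monoid_scheme \<Rightarrow> nat \<Rightarrow> 'a set" where
  "action_kernel G N = {g \<in> carrier G. \<forall>A. perm_action G N A \<longrightarrow> (\<forall>j<N. A g j = j)}"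

context group
begin

lemma action_kernel_subgroup: "subgroup (action_kernel G N) G"
proof (rule subgroupI)
  have "\<one> \<in> action_kernel G N" by (auto simp: action_kernel_def perm_action_def)
  then show "action_kernel G N \<noteq> {}" by blast
  fix g assume g: "g \<in> action_kernel G N"
  have "A (inv g) j = j" if A: "perm_action G N A" and j: "j < N" for A j
  proof -
    have gc: "g \<in> carrier G" and Ag: "A g j = j" using g A j by (auto simp: action_kernel_def)
    have "A (g \<otimes> inv g) j = A (inv g) (A g j)" using A j gc unfolding perm_action_def by blast
    moreover have "A \<one> j = j" using A j by (simp add: perm_action_def)
    ultimately show ?thesis using gc Ag by simp
  qed
  then show "inv g \<in> action_kernel G N" using g by (auto simp: action_kernel_def)
  fix h assume h: "h \<in> action_kernel G N"
  have "A (g \<otimes> h) j = j" if A: "perm_action G N A" and j: "j < N" for A j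
  proof -
    have "A (g \<otimes> h) j = A h (A g j)" using A j g h by (auto simp: action_kernel_def perm_action_def)
    moreover have "A g j = j" "A h j = j" using A j g h unfolding action_kernel_def by blast+
    ultimately show ?thesis by simp
  qed
  then show "g \<otimes> h \<in> action_kernel G N" using g h by (simp add: action_kernel_def)
qed (auto simp: action_kernel_def)

text \<open>An action precomposed with an automorphism is again an action on \<open>N\<close>
  points. The inverse automorphism gives the other inclusion.\<close>

lemma characteristic_action_kernel: "characteristic (action_kernel G N) G"
  unfolding characteristic_def
proof (intro conjI ballI)
  show "subgroup (action_kernel G N) G" by (rule action_kernel_subgroup)
  have sub: "\<alpha> x \<in> action_kernel G N" if \<alpha>: "\<alpha> \<in> auto G" and x: "x \<in> action_kernel G N" for \<alpha> x
  proof -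
    interpret a: group_hom G G \<alpha> by unfold_locales (rule autE(1)[OF \<alpha>])
    have "A (\<alpha> x) j = j" if A: "perm_action G N A" and j: "j < N" for A j
    proof -
      have "perm_action G N (\<lambda>g. A (\<alpha> g))" using A by (auto simp: perm_action_def)
      with x j show ?thesis by (auto simp: action_kernel_def)
    qed
    then show ?thesis using x by (auto simp: action_kernel_def)
  qed
  fix \<alpha> assume \<alpha>: "\<alpha> \<in> auto G"
  interpret A: group "AutoGroup G" by (rule AutoGroup)
  have \<beta>: "inv\<^bsub>AutoGroup G\<^esub> \<alpha> \<in> auto G" using A.inv_closed[of \<alpha>] \<alpha> by simp
  show "\<alpha> ` action_kernel G N = action_kernel G N"
  proof (intro equalityI subsetI)
    fix x assume x: "x \<in> action_kernel G N"
    then have "x \<in> carrier G" by (simp add: action_kernel_def)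
    then have "x = \<alpha> ((inv\<^bsub>AutoGroup G\<^esub> \<alpha>) x)"
      using A.r_inv[of \<alpha>] \<alpha> \<beta> by (simp add: compose_def) (metis restrict_apply')
    with sub[OF \<beta> x] show "x \<in> \<alpha> ` action_kernel G N" by blast
  qed (use sub[OF \<alpha>] in auto)
qed

text \<open>The group acts on the right cosets of \<open>S\<close>, which can be labelled by points
  below \<open>N\<close>. An element acting trivially fixes the coset \<open>S\<close> and so
  belongs to \<open>S\<close>.\<close>

lemma action_kernel_le:
  assumes S: "subgroup S G" and fin: "finite (rcosets S)" and card: "card (rcosets S) \<le> N"
  shows "action_kernel G N \<subseteq> S"
proof
  fix g assume g: "g \<in> action_kernel G N"
  then have gc: "g \<in> carrier G" by (simp add: action_kernel_def)
  obtain e where e: "inj_on e (rcosets S)" "e ` (rcosets S) \<subseteq> {..<N}"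
    using card_le_inj[OF fin, of "{..<N}"] card by auto
  \<comment> \<open>Points that label no coset are fixed, which turns index at most \<open>N\<close>
    into an action on exactly \<open>N\<close> points.\<close>
  define A where "A = (\<lambda>g j. if j \<in> e ` (rcosets S) then e (inv_into (rcosets S) e j #> g) else j)"
  have coset: "C #> g \<in> rcosets S" if "C \<in> rcosets S" "g \<in> carrier G" for C g
    using that subgroup.subset[OF S] by (auto simp: RCOSETS_def coset_mult_assoc)
  have assoc: "C #> g #> h = C #> (g \<otimes> h)" if "C \<in> rcosets S" "g \<in> carrier G" "h \<in> carrier G" for C g h
    using that subgroup.rcosets_carrier[OF S is_group] by (intro coset_mult_assoc) auto
  have A_e: "A g (e C) = e (C #> g)" if "C \<in> rcosets S" for C g
    using that e(1) by (simp add: A_def)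
  have "perm_action G N A"
    unfolding perm_action_def
  proof (intro conjI ballI allI impI)
    fix j assume j: "j < N"
    have one: "C #> \<one> = C" if "C \<in> rcosets S" for C
      using that subgroup.rcosets_carrier[OF S is_group] by (intro coset_mult_one) auto
    show "A \<one> j = j"
      using one A_e by (cases "j \<in> e ` (rcosets S)") (auto simp: A_def)
    fix g h assume gh: "g \<in> carrier G" "h \<in> carrier G"
    show "A (g \<otimes> h) j = A h (A g j)"
    proof (cases "j \<in> e ` (rcosets S)")
      case True
      then obtain C where C: "C \<in> rcosets S" "j = e C" by auto
      then show ?thesis using A_e coset gh assoc by simp
    qed (simp add: A_def)
  next
    fix g j assume gj: "g \<in> carrier G" "j < N"
    show "A g j < N"
    proof (cases "j \<in> e ` (rcosets S)")
      case True
      then obtain C where C: "C \<in> rcosets S" "j = e C" by auto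
      then show ?thesis using A_e coset[OF C(1) gj(1)] e(2) by auto
    qed (use gj in \<open>simp add: A_def\<close>)
  qed
  moreover have SS: "S \<in> rcosets S"
    using S coset_join2[OF one_closed S] subgroup.one_closed[OF S] by (auto simp: RCOSETS_def)
  moreover have "e S < N" using SS e(2) by blast
  ultimately have "A g (e S) = e S" using g by (auto simp: action_kernel_def)
  then have "S #> g = S" using A_e[OF SS] e(1) SS coset[OF SS gc] by (auto dest: inj_onD)
  then show "g \<in> S" using coset_join1[OF _ gc S] by simp
qed

end

text \<open>\<open>x\<close> is a table written in base \<open>N\<close>: the digit at position
  \<open>encode_letter l * N + j\<close> is the image of the point \<open>j\<close> under the letter
  \<open>l\<close>. With \<open>2 n\<close> letters the numbers below \<open>N ^ (2 * n * N)\<close>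
  list all tables, so quantifying over actions becomes a bounded quantifier over numbers.\<close>

definition table_act :: "nat \<Rightarrow> nat \<Rightarrow> letter \<Rightarrow> nat \<Rightarrow> nat" where
  "table_act N x l j = (x div N ^ (encode_letter l * N + j)) mod N"

definition word_act :: "nat \<Rightarrow> nat \<Rightarrow> word \<Rightarrow> nat \<Rightarrow> nat" where
  "word_act N x w j = foldl (\<lambda>j l. table_act N x l j) j w"

definition valid_table :: "presentation \<Rightarrow> nat \<Rightarrow> nat \<Rightarrow> bool" where
  "valid_table P N x \<longleftrightarrow>
    (\<forall>i<fst P. \<forall>j<N. table_act N x (i, False) (table_act N x (i, True) j) = j \<and>
       table_act N x (i, True) (table_act N x (i, False) j) = j) \<and>
    (\<forall>r\<in>set (snd P). \<forall>j<N. word_act N x r j = j)"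

definition num_tables :: "nat \<Rightarrow> nat \<Rightarrow> nat" where
  "num_tables n N = N ^ (2 * n * N)"

definition kernel_word :: "presentation \<Rightarrow> nat \<Rightarrow> word \<Rightarrow> bool" where
  "kernel_word P N w \<longleftrightarrow>
    (\<forall>x<num_tables (fst P) N. valid_table P N x \<longrightarrow> (\<forall>j<N. word_act N x w j = j))"

definition all_words :: "nat \<Rightarrow> nat \<Rightarrow> word list" where
  "all_words n L = rec_nat [[]] (\<lambda>_ ws. [] # concat (map (\<lambda>w. map (\<lambda>a. a # w)
     (concat (map (\<lambda>i. [(i, False), (i, True)]) [0..<n]))) ws)) L"

text \<open>An element of the group is determined modulo the kernel by the point it assigns to each
  pair of a table and a point, so \<open>N ^ (num_tables (fst P) N * N)\<close> bounds the index.
  Words of twice that length suffice to generate a subgroup of that index.\<close>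

definition kernel_gens :: "presentation \<Rightarrow> nat \<Rightarrow> word list" where
  "kernel_gens P N = filter (kernel_word P N) (all_words (fst P) (2 * N ^ (num_tables (fst P) N * N)))"

lemma set_all_words: "set (all_words n L) = {w \<in> words n. length w \<le> L}"
proof (induction L)
  case 0
  then show ?case by (auto simp: all_words_def)
next
  case (Suc L)
  let ?ls = "concat (map (\<lambda>i. [(i, False), (i, True)]) [0..<n])"
  have "set ?ls = {a. fst a < n}" by auto
  moreover have "all_words n (Suc L) = [] # concat (map (\<lambda>w. map (\<lambda>a. a # w) ?ls) (all_words n L))"
    by (simp add: all_words_def)
  ultimately have "set (all_words n (Suc L)) = insert [] {a # w |a w. fst a < n \<and> w \<in> set (all_words n L)}"
    by auto
  also have "\<dots> = {w \<in> words n. length w \<le> Suc L}"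
  proof (intro equalityI subsetI)
    fix w assume "w \<in> {w \<in> words n. length w \<le> Suc L}"
    then show "w \<in> insert [] {a # w |a w. fst a < n \<and> w \<in> set (all_words n L)}"
      by (cases w) (auto simp: Suc)
  next
    fix w assume "w \<in> insert [] {a # w |a w. fst a < n \<and> w \<in> set (all_words n L)}"
    then show "w \<in> {w \<in> words n. length w \<le> Suc L}" unfolding Suc by auto
  qed
  finally show ?case .
qed

text \<open>Prescribed digits are assembled by Horner's scheme, starting from the lowest
  one.\<close>

lemma table_exists:
  fixes N :: nat
  assumes "\<And>q. q < M \<Longrightarrow> d q < N"
  shows "\<exists>x<N ^ M. \<forall>q<M. (x div N ^ q) mod N = d q"
  using assms
proof (induction M arbitrary: d)
  case (Suc M)
  from Suc.IH[of "\<lambda>q. d (Suc q)"] Suc.prems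
  obtain x where x: "x < N ^ M" "\<And>q. q < M \<Longrightarrow> (x div N ^ q) mod N = d (Suc q)" by auto
  let ?x = "x * N + d 0"
  have d0: "d 0 < N" using Suc.prems by simp
  have "?x < Suc x * N" using d0 by simp
  also have "Suc x * N \<le> N ^ M * N" using x(1) by (intro mult_le_mono) auto
  finally have "?x < N ^ Suc M" by (simp add: mult.commute)
  moreover have "(?x div N ^ q) mod N = d q" if "q < Suc M" for q
  proof (cases q)
    case 0
    then show ?thesis using d0 by simp
  next
    case (Suc p)
    have "?x div N ^ Suc p = ?x div N div N ^ p" by (simp add: div_mult2_eq)
    also have "?x div N = x" using d0 by simp
    finally show ?thesis using x(2)[of p] that Suc by simp
  qed
  ultimately show ?case by blast
qed simp

context
  fixes P and N :: nat
  assumes P: "P \<in> presentations" and N: "N > 0"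
begin

interpretation G: group "presented_group P" by (rule group_presented_group[OF P])

lemma table_act_less: "table_act N x l j < N"
  using N by (simp add: table_act_def)

lemma word_act_simps [simp]:
  "word_act N x [] j = j" "word_act N x (l # w) j = word_act N x w (table_act N x l j)"
  "word_act N x (u @ v) j = word_act N x v (word_act N x u j)"
  by (simp_all add: word_act_def)

lemma word_act_less: "j < N \<Longrightarrow> word_act N x w j < N"
  by (induction w arbitrary: j) (auto simp: table_act_less)

lemma table_act_inv:
  "valid_table P N x \<Longrightarrow> fst l < fst P \<Longrightarrow> j < N \<Longrightarrow> table_act N x (inv_letter l) (table_act N x l j) = j"
  by (cases l; cases "snd l") (auto simp: valid_table_def inv_letter_def)

lemma word_act_reduce:
  assumes v: "valid_table P N x"
  shows "w \<in> words (fst P) \<Longrightarrow> j < N \<Longrightarrow> word_act N x (reduce w) j = word_act N x w j"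
proof (induction w arbitrary: j)
  case (Cons l w)
  have "word_act N x (cons_reduce l u) j = word_act N x u (table_act N x l j)" for u
    using table_act_inv[OF v, of l j] Cons.prems by (cases u) auto
  then show ?case using Cons table_act_less by (simp add: reduce_Cons)
qed simp

lemma word_act_inv_word:
  assumes v: "valid_table P N x" and w: "w \<in> words (fst P)" "j < N"
  shows "word_act N x (inv_word w) (word_act N x w j) = j" "word_act N x w (word_act N x (inv_word w) j) = j"
  using word_act_reduce[OF v _ w(2), of "w @ inv_word w"] word_act_reduce[OF v _ w(2), of "inv_word w @ w"] w(1)
  by (simp_all add: reduce_inv_word reduce_inv_word')

text \<open>A derivation presents the word as a product of conjugates of relators, each of which
  acts trivially in a valid table. Hence the action of words descends to the presented
  group.\<close>

lemma word_act_trivial: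
  assumes v: "valid_table P N x" and w: "w \<in> words (fst P)" "word_elem P w = \<one>\<^bsub>presented_group P\<^esub>" and j: "j < N"
  shows "word_act N x w j = j"
proof -
  obtain d where d: "derivation P d" "reduce (derived_word d) = reduce w"
    using word_elem_eq_one_iff_derivation[OF P w(1)] w(2) by blast
  have "word_act N x (derived_word d) j = j"
    using d(1)
  proof (induction d)
    case (Cons p d)
    have p: "fst p \<in> words (fst P)" "snd p \<in> set (snd P) \<or> inv_word (snd p) \<in> set (snd P)"
      using Cons.prems by (auto simp: derivation_def words_def)
    have s: "word_act N x (snd p) j = j" if "j < N" for j
    proof (cases "snd p \<in> set (snd P)")
      case False
      then have r: "inv_word (snd p) \<in> set (snd P)" using p(2) by simp
      then have "snd p \<in> words (fst P)"
        using P words_simps(4)[of "snd p"] by (auto simp: presentations_def simp del: words_simps(4))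
      then have "word_act N x (snd p) (word_act N x (inv_word (snd p)) j) = j"
        using word_act_inv_word(2)[OF v] that by blast
      moreover have "word_act N x (inv_word (snd p)) j = j" using r v that by (auto simp: valid_table_def)
      ultimately show ?thesis by simp
    qed (use v that in \<open>auto simp: valid_table_def\<close>)
    have "derivation P d" using Cons.prems by (simp add: derivation_def)
    with Cons.IH p(1) j show ?case
      by (simp add: derived_word_def s word_act_less word_act_inv_word[OF v])
  qed (simp add: derived_word_def)
  then show ?thesis
    using word_act_reduce[OF v derivation_words[OF P d(1)] j] word_act_reduce[OF v w(1) j] d(2) by simp
qed

text \<open>A valid table defines an action of the group by executing representing words. Conversely
  the values of any action on single letters are the digits of a valid table below the bound, so the
  finitely many tables account for all actions.\<close>

lemma word_elem_in_action_kernel_iff: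
  assumes w: "w \<in> words (fst P)"
  shows "word_elem P w \<in> action_kernel (presented_group P) N \<longleftrightarrow> kernel_word P N w"
proof
  assume k: "word_elem P w \<in> action_kernel (presented_group P) N"
  show "kernel_word P N w"
    unfolding kernel_word_def
  proof (intro allI impI)
    fix x j assume v: "valid_table P N x" and j: "j < N"
    define A where "A g = word_act N x (SOME w. w \<in> words (fst P) \<and> g = word_elem P w)" for g
    have A: "A (word_elem P u) i = word_act N x u i" if u: "u \<in> words (fst P)" and i: "i < N" for u i
    proof -
      define u' where "u' = (SOME w. w \<in> words (fst P) \<and> word_elem P u = word_elem P w)"
      have u': "u' \<in> words (fst P)" "word_elem P u = word_elem P u'"
        using someI[of "\<lambda>w. w \<in> words (fst P) \<and> word_elem P u = word_elem P w" u] u by (auto simp: u'_def)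
      have "word_elem P (u' @ inv_word u) = \<one>\<^bsub>presented_group P\<^esub>"
        using u u' word_elem_closed[OF P u] by (simp add: word_elem_append[OF P] word_elem_inv_word[OF P])
      then have "word_act N x (inv_word u) (word_act N x u' i) = i"
        using word_act_trivial[OF v _ _ i, of "u' @ inv_word u"] u u' by simp
      then have "word_act N x u i = word_act N x u (word_act N x (inv_word u) (word_act N x u' i))" by simp
      also have "\<dots> = word_act N x u' i"
        by (rule word_act_inv_word(2)[OF v u word_act_less[OF i]])
      finally show ?thesis by (simp add: A_def u'_def)
    qed
    have "perm_action (presented_group P) N A"
      unfolding perm_action_def
    proof (intro conjI ballI allI impI)
      fix g i assume "g \<in> carrier (presented_group P)" "i < N"
      then show "A g i < N" using A word_act_less by (metis word_elem_surj[OF P])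
    next
      fix i assume "i < N"
      moreover have "word_elem P [] = \<one>\<^bsub>presented_group P\<^esub>" by (simp add: word_elem_eval[OF P])
      ultimately show "A \<one>\<^bsub>presented_group P\<^esub> i = i" using A[of "[]" i] by simp
    next
      fix g h i assume gh: "g \<in> carrier (presented_group P)" "h \<in> carrier (presented_group P)" and i: "i < N"
      obtain u where u: "u \<in> words (fst P)" "g = word_elem P u" by (rule word_elem_surj[OF P gh(1)])
      obtain v where v: "v \<in> words (fst P)" "h = word_elem P v" by (rule word_elem_surj[OF P gh(2)])
      show "A (g \<otimes>\<^bsub>presented_group P\<^esub> h) i = A h (A g i)"
        using u v i word_act_less[OF i] A[of "u @ v" i] by (simp add: A word_elem_append[OF P u(1) v(1)])
    qed
    then show "word_act N x w j = j" using k j A[OF w j] by (auto simp: action_kernel_def)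
  qed
next
  assume k: "kernel_word P N w"
  have "A (word_elem P w) j = j" if A: "perm_action (presented_group P) N A" and j: "j < N" for A j
  proof -
    let ?n = "fst P"
    \<comment> \<open>The inverse of \<open>encode_letter\<close>: position \<open>q\<close> of the
      table has to hold the image of \<open>q mod N\<close> under the letter with code
      \<open>q div N\<close>.\<close>
    define dl where "dl c = (c div 2, odd c)" for c :: nat
    have dl: "dl (encode_letter l) = l" for l by (cases l) (auto simp: dl_def encode_letter_def)
    have closed: "word_elem P [l] \<in> carrier (presented_group P)" if "fst l < ?n" for l
      using that by (intro word_elem_closed[OF P]) simp
    have "A (word_elem P [dl (q div N)]) (q mod N) < N" if "q < 2 * ?n * N" for q
    proof -
      have "q div N < 2 * ?n" using that by (simp add: less_mult_imp_div_less)
      then have "fst (dl (q div N)) < ?n" by (simp add: dl_def)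
      then show ?thesis using A closed N by (simp add: perm_action_def)
    qed
    from table_exists[of "2 * ?n * N" "\<lambda>q. A (word_elem P [dl (q div N)]) (q mod N)" N, OF this] obtain x where x: "x < N ^ (2 * ?n * N)"
      "\<And>q. q < 2 * ?n * N \<Longrightarrow> (x div N ^ q) mod N = A (word_elem P [dl (q div N)]) (q mod N)" by blast
    have tab: "table_act N x l i = A (word_elem P [l]) i" if l: "fst l < ?n" and i: "i < N" for l i
    proof -
      have "encode_letter l + 1 \<le> 2 * ?n" using l by (auto simp: encode_letter_def)
      then have "(encode_letter l + 1) * N \<le> 2 * ?n * N" by (rule mult_le_mono1)
      then have "encode_letter l * N + i < 2 * ?n * N" using i by (simp add: algebra_simps)
      moreover have "(encode_letter l * N + i) div N = encode_letter l" "(encode_letter l * N + i) mod N = i"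
        using i by auto
      ultimately show ?thesis using x(2)[of "encode_letter l * N + i"] dl by (simp add: table_act_def)
    qed
    have act: "word_act N x u i = A (word_elem P u) i" if "u \<in> words ?n" "i < N" for u i
      using that
    proof (induction u arbitrary: i)
      case Nil
      have "word_elem P [] = \<one>\<^bsub>presented_group P\<^esub>" by (simp add: word_elem_eval[OF P])
      then show ?case using A Nil by (simp add: perm_action_def)
    next
      case (Cons l u)
      have "word_elem P (l # u) = word_elem P [l] \<otimes>\<^bsub>presented_group P\<^esub> word_elem P u"
        using Cons.prems word_elem_append[OF P, of "[l]" u] by simp
      then have "A (word_elem P (l # u)) i = A (word_elem P u) (A (word_elem P [l]) i)"
        using A closed[of l] word_elem_closed[OF P, of u] Cons.prems by (auto simp: perm_action_def)
      then show ?case using Cons table_act_less[of x l i] by (simp add: tab)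
    qed
    have Aone: "A \<one>\<^bsub>presented_group P\<^esub> i = i" if "i < N" for i using A that by (simp add: perm_action_def)
    have "valid_table P N x"
      unfolding valid_table_def
    proof (intro conjI allI impI ballI)
      fix i k assume ik: "i < ?n" "k < N"
      have red: "word_elem P [(i, True), (i, False)] = \<one>\<^bsub>presented_group P\<^esub>"
        "word_elem P [(i, False), (i, True)] = \<one>\<^bsub>presented_group P\<^esub>"
        using ik word_elem_append[OF P, of "[(i, True)]" "[(i, False)]"] word_elem_append[OF P, of "[(i, False)]" "[(i, True)]"]
          word_elem_inv_word[OF P, of "[(i, False)]"] closed[of "(i, False)"] by (auto simp: inv_letter_def)
      show "table_act N x (i, False) (table_act N x (i, True) k) = k"
        "table_act N x (i, True) (table_act N x (i, False) k) = k"
        using act[of "[(i, True), (i, False)]" k] act[of "[(i, False), (i, True)]" k] red ik Aone by auto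
    next
      fix r k assume "r \<in> set (snd P)" "k < N"
      then show "word_act N x r k = k"
        using act[of r k] relator_trivial[OF P] Aone P by (auto simp: presentations_def)
    qed
    then show ?thesis using k x(1) act[OF w j] j by (simp add: kernel_word_def num_tables_def)
  qed
  then show "word_elem P w \<in> action_kernel (presented_group P) N"
    using word_elem_closed[OF P w] by (simp add: action_kernel_def)
qed

lemma card_rcosets_action_kernel:
  "finite (rcosets\<^bsub>presented_group P\<^esub> action_kernel (presented_group P) N)"
  "card (rcosets\<^bsub>presented_group P\<^esub> action_kernel (presented_group P) N) \<le> N ^ (num_tables (fst P) N * N)"
proof -
  let ?X = "{..<num_tables (fst P) N} \<times> {..<N}"
  define rep where "rep g = (SOME w. w \<in> words (fst P) \<and> g = word_elem P w)" for g
  have rep: "rep g \<in> words (fst P)" "word_elem P (rep g) = g" if "g \<in> carrier (presented_group P)" for g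
  proof -
    have "\<exists>w. w \<in> words (fst P) \<and> g = word_elem P w" by (rule word_elem_surj[OF P that]) blast
    from someI_ex[OF this] show "rep g \<in> words (fst P)" "word_elem P (rep g) = g" by (auto simp: rep_def)
  qed
  \<comment> \<open>The values of a representing word in all tables at once. Invalid tables are
    included, as the bound allows for them; agreement in the valid ones is what decides the
    coset.\<close>
  define sig where "sig g = (\<lambda>p\<in>?X. word_act N (fst p) (rep g) (snd p))" for g
  have R: "sig ` carrier (presented_group P) \<subseteq> PiE ?X (\<lambda>_. {..<N})"
    by (intro image_subsetI PiE_I) (auto simp: sig_def word_act_less)
  have key: "g \<otimes>\<^bsub>presented_group P\<^esub> inv\<^bsub>presented_group P\<^esub> h \<in> action_kernel (presented_group P) N"
    if g: "g \<in> carrier (presented_group P)" and h: "h \<in> carrier (presented_group P)" and e: "sig g = sig h" for g h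
  proof -
    have "kernel_word P N (rep g @ inv_word (rep h))"
      unfolding kernel_word_def
    proof (intro allI impI)
      fix x j assume x: "x < num_tables (fst P) N" "valid_table P N x" "j < N"
      then have "word_act N x (rep g) j = word_act N x (rep h) j"
        using fun_cong[OF e, of "(x, j)"] by (simp add: sig_def)
      then show "word_act N x (rep g @ inv_word (rep h)) j = j"
        using word_act_inv_word(1)[OF x(2) rep(1)[OF h] x(3)] by simp
    qed
    then have "word_elem P (rep g @ inv_word (rep h)) \<in> action_kernel (presented_group P) N"
      using rep(1)[OF g] rep(1)[OF h] by (subst word_elem_in_action_kernel_iff) auto
    then show ?thesis
      using rep[OF g] rep[OF h] by (simp add: word_elem_append[OF P] word_elem_inv_word[OF P])
  qed
  have fin: "finite (PiE ?X (\<lambda>_. {..<N}))" by (intro finite_PiE) auto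
  have card: "card (PiE ?X (\<lambda>_. {..<N})) = N ^ (num_tables (fst P) N * N)"
    by (subst card_PiE) (auto simp: card_cartesian_product)
  show "finite (rcosets\<^bsub>presented_group P\<^esub> action_kernel (presented_group P) N)"
    by (rule G.card_rcosets_le(1)[OF G.action_kernel_subgroup fin R key])
  show "card (rcosets\<^bsub>presented_group P\<^esub> action_kernel (presented_group P) N) \<le> N ^ (num_tables (fst P) N * N)"
    using G.card_rcosets_le(2)[OF G.action_kernel_subgroup fin R key] unfolding card .
qed

text \<open>Among the prefixes of a word longer than the index two lie in the same coset; cutting out the
  subword between them splits off a short element of the subgroup.\<close>

lemma generated_by_short_words:
  assumes S: "subgroup S (presented_group P)" and fin: "finite (rcosets\<^bsub>presented_group P\<^esub> S)"
    and card: "card (rcosets\<^bsub>presented_group P\<^esub> S) \<le> B"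
  shows "generate (presented_group P)
    (word_elem P ` {w \<in> words (fst P). length w \<le> 2 * B \<and> word_elem P w \<in> S}) = S"
proof
  let ?W = "word_elem P ` {w \<in> words (fst P). length w \<le> 2 * B \<and> word_elem P w \<in> S}"
  show "generate (presented_group P) ?W \<subseteq> S"
    by (rule G.generate_subgroup_incl[OF _ S]) auto
  have "word_elem P w \<in> generate (presented_group P) ?W"
    if "w \<in> words (fst P)" "word_elem P w \<in> S" for w
    using that
  proof (induction "length w" arbitrary: w rule: less_induct)
    case less
    show ?case
    proof (cases "length w \<le> 2 * B")
      case True
      then show ?thesis using less.prems by (intro generate.incl) auto
    next
      case False
      let ?c = "\<lambda>i. S #>\<^bsub>presented_group P\<^esub> word_elem P (take i w)"
      have pre: "take i w \<in> words (fst P)" "drop i w \<in> words (fst P)" for i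
        using less.prems(1) set_take_subset[of i w] set_drop_subset[of i w] by (auto simp: words_def)
      have "?c ` {..B} \<subseteq> rcosets\<^bsub>presented_group P\<^esub> S"
        using word_elem_closed[OF P pre(1)] by (auto simp: RCOSETS_def)
      then have "card (?c ` {..B}) \<le> B" using card_mono[OF fin] card by (meson order_trans)
      then have "\<not> inj_on ?c {..B}" using pigeonhole[of ?c "{..B}"] by simp
      then obtain i j where ij: "i < j" "j \<le> B" "?c i = ?c j"
        unfolding inj_on_def by (metis atMost_iff linorder_neqE_nat)
      have split: "w = take j w @ drop j w" by simp
      \<comment> \<open>In the group \<open>w\<close> is the product of \<open>?u\<close> and
        \<open>?v\<close>. Both prefixes in \<open>?u\<close> have length at most \<open>B\<close>,
        which is the origin of \<open>2 * B\<close>, and \<open>?v\<close> is shorter than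
        \<open>w\<close> because \<open>i < j\<close>.\<close>
      let ?u = "take j w @ inv_word (take i w)" and ?v = "take i w @ drop j w"
      have uv: "?u \<in> words (fst P)" "?v \<in> words (fst P)" using pre by auto
      have c: "word_elem P (take i w) \<in> carrier (presented_group P)" "word_elem P (take j w) \<in> carrier (presented_group P)"
        "word_elem P (drop j w) \<in> carrier (presented_group P)"
        using word_elem_closed[OF P] pre by auto
      have "word_elem P (take j w) \<in> ?c i" using ij(3) G.rcos_self[OF c(2) S] by simp
      then obtain s where s: "s \<in> S" "word_elem P (take j w) = s \<otimes>\<^bsub>presented_group P\<^esub> word_elem P (take i w)"
        by (auto simp: r_coset_def)
      have sc: "s \<in> carrier (presented_group P)" using s(1) subgroup.mem_carrier[OF S] by blast
      have u: "word_elem P ?u = s"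
        using s c sc pre by (simp add: word_elem_append[OF P] word_elem_inv_word[OF P] G.m_assoc)
      have uw: "word_elem P w = word_elem P ?u \<otimes>\<^bsub>presented_group P\<^esub> word_elem P ?v"
      proof -
        have "word_elem P w = word_elem P (take j w) \<otimes>\<^bsub>presented_group P\<^esub> word_elem P (drop j w)"
          using word_elem_append[OF P pre(1,2), of j j] by simp
        then show ?thesis using c sc pre by (simp add: u s(2) word_elem_append[OF P] G.m_assoc)
      qed
      have "word_elem P ?v = inv\<^bsub>presented_group P\<^esub> s \<otimes>\<^bsub>presented_group P\<^esub> word_elem P w"
        using uw u sc word_elem_closed[OF P uv(2)] by (simp add: G.inv_cancel)
      then have v: "word_elem P ?v \<in> S"
        using less.prems(2) s(1) S by (simp add: subgroup.m_closed subgroup.m_inv_closed)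
      have "length ?v < length w" using ij False by simp
      from less.hyps[OF this uv(2) v] have "word_elem P ?v \<in> generate (presented_group P) ?W" .
      moreover have "length ?u \<le> 2 * B" using ij by (simp add: inv_word_def)
      then have "word_elem P ?u \<in> generate (presented_group P) ?W"
        using uv(1) s(1) u by (intro generate.incl) auto
      ultimately show ?thesis unfolding uw by (intro generate.eng)
    qed
  qed
  then show "S \<subseteq> generate (presented_group P) ?W"
    using word_elem_surj[OF P] subgroup.mem_carrier[OF S] by blast
qed

lemma set_kernel_gens: "set (kernel_gens P N) \<subseteq> words (fst P)"
  by (auto simp: kernel_gens_def set_all_words)

lemma generate_kernel_gens:
  "generate (presented_group P) (word_elem P ` set (kernel_gens P N)) = action_kernel (presented_group P) N"
proof -
  let ?B = "N ^ (num_tables (fst P) N * N)"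
  have "set (kernel_gens P N) = {w \<in> words (fst P). length w \<le> 2 * ?B \<and>
      word_elem P w \<in> action_kernel (presented_group P) N}"
    using word_elem_in_action_kernel_iff by (auto simp: kernel_gens_def set_all_words)
  then show ?thesis
    using generated_by_short_words[OF G.action_kernel_subgroup card_rcosets_action_kernel] by simp
qed

end

section \<open>The algorithm\<close>

text \<open>The only unbounded search. The truth value of \<open>Q\<close> is flipped because
  minimization looks for a zero. On inputs without a witness the program may run forever, and
  nothing is claimed there.\<close>

lemma computable_search:
  fixes out :: "nat \<Rightarrow> nat \<Rightarrow> 'a::enc"
  assumes Q: "computable (\<lambda>z. Q (fst z) (snd z))" and out: "computable (\<lambda>z. out (fst z) (snd z))"
  shows "\<exists>p. \<forall>x. (\<exists>c. Q x c) \<longrightarrow> rec_eval p [x] (enc (out x (LEAST c. Q x c)))"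
proof -
  obtain f where f: "\<And>n h. rcomp n h \<Longrightarrow> rcomp n (\<lambda>xs. f (h xs))" "\<And>z. f (enc z) = enc (Q (fst z) (snd z))"
    using computableE[OF Q] by blast
  obtain g where g: "\<And>n h. rcomp n h \<Longrightarrow> rcomp n (\<lambda>xs. g (h xs))" "\<And>z. g (enc z) = enc (out (fst z) (snd z))"
    using computableE[OF out] by blast
  have "rcomp 2 (\<lambda>xs. 1 - f (prod_encode (xs ! 1, xs ! 0)))"
    by (intro rcomp_diff f rcomp_prod_encode rcomp_const rcomp_nth) auto
  then obtain p where "\<And>xs. length xs = 2 \<Longrightarrow> rec_eval p xs (1 - f (prod_encode (xs ! 1, xs ! 0)))"
    unfolding rcomp_def by blast
  from this[of "[c, x]" for c x] have "rec_eval p [c, x] (1 - f (prod_encode (x, c)))" for c x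
    by simp
  then have p: "rec_eval p [c, x] (1 - of_bool (Q x c))" for c x
    using f(2)[of "(x, c)"] unfolding enc_prod_def enc_nat_def enc_bool_def fst_conv snd_conv by metis
  have "rcomp 2 (\<lambda>xs. g (prod_encode (xs ! 1, xs ! 0)))"
    by (intro g rcomp_prod_encode rcomp_nth) auto
  then obtain q where "\<And>xs. length xs = 2 \<Longrightarrow> rec_eval q xs (g (prod_encode (xs ! 1, xs ! 0)))"
    unfolding rcomp_def by blast
  from this[of "[c, x]" for c x] have "rec_eval q [c, x] (g (prod_encode (x, c)))" for c x
    by simp
  then have q: "rec_eval q [c, x] (enc (out x c))" for c x
    using g(2)[of "(x, c)"] unfolding enc_prod_def enc_nat_def fst_conv snd_conv by metis
  have "rec_eval (Comp q [Mu p, Proj 0]) [x] (enc (out x (LEAST c. Q x c)))" if "\<exists>c. Q x c" for x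
  proof (rule rec_eval.comp[where ys = "[LEAST c. Q x c, x]"])
    have "rec_eval (Mu p) [x] (LEAST c. Q x c)"
    proof (rule rec_eval.mu)
      show "rec_eval p ((LEAST c. Q x c) # [x]) 0"
        using p[of "LEAST c. Q x c" x] LeastI_ex[OF that] by simp
      fix i assume "i < (LEAST c. Q x c)"
      then have "\<not> Q x i" by (rule not_less_Least)
      then show "\<exists>y. rec_eval p (i # [x]) (Suc y)" using p[of i x] by auto
    qed
    moreover have "rec_eval (Proj 0) [x] x" using rec_eval.proj[of 0 "[x]"] by simp
    ultimately show "list_all2 (\<lambda>g y. rec_eval g [x] y) [Mu p, Proj 0] [LEAST c. Q x c, x]" by simp
  qed (rule q)
  then show ?thesis by blast
qed

section \<open>Computability of the operations on words, presentations and tables\<close>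

lemma computable_inv_letter [comp_intros]: "computable f \<Longrightarrow> computable (\<lambda>x. inv_letter (f x))"
  unfolding inv_letter_def by (intro comp_intros)

lemma computable_inv_word [comp_intros]: "computable f \<Longrightarrow> computable (\<lambda>x. inv_word (f x))"
proof (rule computable_comp[where f = inv_word])
  show "computable inv_word"
    unfolding inv_word_def[abs_def] by (intro comp_intros)
qed

lemma computable_reduce [comp_intros]: "computable f \<Longrightarrow> computable (\<lambda>x. reduce (f x))"
proof (rule computable_comp[where f = reduce])
  have cr: "cons_reduce = (\<lambda>a w. if w \<noteq> [] \<and> hd w = inv_letter a then tl w else a # w)"
  proof (intro ext)
    show "cons_reduce a w = (if w \<noteq> [] \<and> hd w = inv_letter a then tl w else a # w)" for a w
      by (cases w) auto
  qed
  then have r: "reduce = (\<lambda>w. foldr (\<lambda>a w. if w \<noteq> [] \<and> hd w = inv_letter a then tl w else a # w) w [])"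
    by (simp add: reduce_def[abs_def] cr)
  show "computable reduce" unfolding r by (intro comp_intros)
qed

text \<open>Total access, so that a finite list of words can serve as the substitution
  \<open>nat \<Rightarrow> word\<close> required by \<open>subst\<close>.\<close>

definition lookup :: "word list \<Rightarrow> nat \<Rightarrow> word" where
  "lookup ws i = (if i < length ws then ws ! i else [])"

lemma computable_lookup [comp_intros]:
  "computable f \<Longrightarrow> computable g \<Longrightarrow> computable (\<lambda>x. lookup (f x) (g x))"
  unfolding lookup_def by (intro comp_intros)

lemma computable_subst [comp_intros]:
  assumes "computable f" "computable g"
  shows "computable (\<lambda>x. subst (lookup (f x)) (g x))"
  unfolding subst_def by (intro comp_intros assms computable_comp[OF assms(1)])

lemma computable_words [comp_intros]:
  assumes "computable f" "computable g"
  shows "computable (\<lambda>x. f x \<in> words (g x))"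
  unfolding words_def mem_Collect_eq by (intro comp_intros assms computable_comp[OF assms(2)])

lemma computable_torus_presentation [comp_intros]:
  assumes "computable f" "computable g"
  shows "computable (\<lambda>x. torus_presentation (f x) (lookup (g x)))"
  unfolding torus_presentation_def
  by (intro comp_intros assms computable_comp[OF assms(1)] computable_comp[OF assms(2)])

lemma computable_derived_word [comp_intros]: "computable f \<Longrightarrow> computable (\<lambda>x. derived_word (f x))"
  unfolding derived_word_def by (intro comp_intros)

lemma computable_derivation [comp_intros]:
  assumes "computable f" "computable g"
  shows "computable (\<lambda>x. derivation (f x) (g x))"
  unfolding derivation_def by (intro comp_intros assms computable_comp[OF assms(1)])

lemma computable_encode_letter [comp_intros]: "computable f \<Longrightarrow> computable (\<lambda>x. encode_letter (f x))"
  unfolding encode_letter_def by (intro comp_intros)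

lemma computable_table_act [comp_intros]:
  "computable f \<Longrightarrow> computable g \<Longrightarrow> computable h \<Longrightarrow> computable j \<Longrightarrow>
    computable (\<lambda>x. table_act (f x) (g x) (h x) (j x))"
  unfolding table_act_def by (intro comp_intros)

lemma computable_word_act [comp_intros]:
  assumes "computable f" "computable g" "computable h" "computable j"
  shows "computable (\<lambda>x. word_act (f x) (g x) (h x) (j x))"
  unfolding word_act_def
  by (intro comp_intros assms computable_comp[OF assms(1)] computable_comp[OF assms(2)])

lemma computable_valid_table [comp_intros]:
  assumes "computable f" "computable g" "computable h"
  shows "computable (\<lambda>x. valid_table (f x) (g x) (h x))"
  unfolding valid_table_def
  by (intro comp_intros assms computable_comp[OF assms(1)] computable_comp[OF assms(2)] computable_comp[OF assms(3)])

lemma computable_num_tables [comp_intros]: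
  "computable f \<Longrightarrow> computable g \<Longrightarrow> computable (\<lambda>x. num_tables (f x) (g x))"
  unfolding num_tables_def by (intro comp_intros)

lemma computable_kernel_word [comp_intros]:
  assumes "computable f" "computable g" "computable h"
  shows "computable (\<lambda>x. kernel_word (f x) (g x) (h x))"
  unfolding kernel_word_def
  by (intro comp_intros assms computable_comp[OF assms(1)] computable_comp[OF assms(2)] computable_comp[OF assms(3)])

lemma computable_all_words [comp_intros]:
  assumes "computable f" "computable g"
  shows "computable (\<lambda>x. all_words (f x) (g x))"
  unfolding all_words_def
  by (intro comp_intros assms computable_comp[OF assms(1)] computable_comp[OF assms(2)])

lemma computable_kernel_gens [comp_intros]:
  assumes "computable f" "computable g"
  shows "computable (\<lambda>x. kernel_gens (f x) (g x))"
  unfolding kernel_gens_def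
  by (intro comp_intros assms computable_comp[OF assms(1)] computable_comp[OF assms(2)])

section \<open>Enumeration of certificates by natural numbers\<close>

definition dec_pair :: "(nat \<Rightarrow> 'a) \<Rightarrow> (nat \<Rightarrow> 'b) \<Rightarrow> nat \<Rightarrow> 'a \<times> 'b" where
  "dec_pair f g c = (f (fst (prod_decode c)), g (snd (prod_decode c)))"

definition dec_list :: "(nat \<Rightarrow> 'a) \<Rightarrow> nat \<Rightarrow> 'a list" where
  "dec_list f c = map f (list_decode c)"

definition dec_letter :: "nat \<Rightarrow> letter" where
  "dec_letter c = (c div 2, odd c)"

lemma dec_letter_encode_letter [simp]: "dec_letter (encode_letter l) = l"
  by (cases l) (auto simp: dec_letter_def encode_letter_def)

lemma surj_dec_letter: "surj dec_letter"
  by (metis dec_letter_encode_letter surjI)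

lemma surj_dec_pair: "surj f \<Longrightarrow> surj g \<Longrightarrow> surj (dec_pair f g)"
proof (rule surjI)
  show "surj f \<Longrightarrow> surj g \<Longrightarrow> dec_pair f g (prod_encode (inv_into UNIV f (fst p), inv_into UNIV g (snd p))) = p" for p
    by (simp add: dec_pair_def surj_f_inv_f)
qed

lemma surj_dec_list: "surj f \<Longrightarrow> surj (dec_list f)"
proof (rule surjI)
  show "surj f \<Longrightarrow> dec_list f (list_encode (map (inv_into UNIV f) xs)) = xs" for xs
    by (simp add: dec_list_def surj_f_inv_f comp_def)
qed

lemma computable_dec_pair [comp_intros]:
  assumes "computable f" "computable g"
  shows "computable (dec_pair f g)"
proof -
  have c: "computable (\<lambda>c. fst (prod_decode c))" "computable (\<lambda>c. snd (prod_decode c))"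
    by (rule computable_nat1[OF _ computable_id]; rule rcomp_prod_decode; rule rcomp_nth; simp)+
  show ?thesis
    unfolding dec_pair_def[abs_def]
    by (intro comp_intros computable_comp[OF assms(1)] computable_comp[OF assms(2)] c)
qed

lemma computable_dec_list [comp_intros]:
  assumes "computable f"
  shows "computable (dec_list f)"
proof -
  have "enc (list_decode c) = c" for c
  proof -
    have "map enc xs = (xs :: nat list)" for xs by (induction xs) (auto simp: enc_nat_def)
    then show ?thesis by (simp add: enc_list_def)
  qed
  then have "computable list_decode"
    by (intro computableI[where g = "\<lambda>x. x"]) (auto intro: rcomp_nth simp: enc_nat_def)
  then show ?thesis
    unfolding dec_list_def[abs_def] by (intro comp_intros computable_comp[OF assms]) auto
qed

lemma computable_dec_letter [comp_intros]: "computable dec_letter"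
  unfolding dec_letter_def[abs_def] by (intro comp_intros)

text \<open>The first component holds the rank \<open>m\<close>, the images of the generators under
  \<open>\<phi>\<close>, the exponent \<open>k\<close> and the conjugator \<open>r\<close>. Then
  come the substitutions \<open>u\<close> and \<open>v\<close> between the given presentation and
  the torus, and finally the derivations \<open>D\<close> over the given presentation and
  \<open>E\<close> over the torus.\<close>

type_synonym iso_cert =
  "(nat \<times> word list \<times> nat \<times> word) \<times> (word list \<times> word list) \<times>
   ((word \<times> word) list list \<times> (word \<times> word) list list)"

definition derives :: "(word \<times> word) list list \<Rightarrow> word \<Rightarrow> bool" where
  "derives D w \<longleftrightarrow> reduce w \<in> set (map (\<lambda>d. reduce (derived_word d)) D)"

definition iso_check :: "presentation \<Rightarrow> presentation \<Rightarrow> word list \<Rightarrow> word list \<Rightarrow>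
    (word \<times> word) list list \<Rightarrow> (word \<times> word) list list \<Rightarrow> bool" where
  "iso_check P T u v D E \<longleftrightarrow>
    (\<forall>i<fst P. lookup u i \<in> words (fst T)) \<and> (\<forall>i<fst T. lookup v i \<in> words (fst P)) \<and>
    (\<forall>d\<in>set D. derivation P d) \<and> (\<forall>d\<in>set E. derivation T d) \<and>
    (\<forall>r\<in>set (snd P). derives E (subst (lookup u) r)) \<and>
    (\<forall>r\<in>set (snd T). derives D (subst (lookup v) r)) \<and>
    (\<forall>i<fst P. derives D (subst (lookup v) (lookup u i) @ [(i, True)])) \<and>
    (\<forall>i<fst T. derives E (subst (lookup u) (lookup v i) @ [(i, True)]))"

text \<open>Everything is tested on generators. A certificate contains no inverse of the
  endomorphism: bijectivity follows from the \<open>k\<close>-th power being conjugation by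
  \<open>r\<close>.\<close>

definition finite_order_check :: "nat \<Rightarrow> word list \<Rightarrow> nat \<Rightarrow> word \<Rightarrow> bool" where
  "finite_order_check m ph k r \<longleftrightarrow> 1 \<le> m \<and> 1 \<le> k \<and> (\<forall>i<m. lookup ph i \<in> words m) \<and> r \<in> words m \<and>
    reduce (subst (lookup ph) r) = reduce r \<and>
    (\<forall>i<m. reduce ((subst (lookup ph) ^^ k) [(i, False)]) = reduce (r @ [(i, False)] @ inv_word r))"

definition cert_check :: "presentation \<Rightarrow> iso_cert \<Rightarrow> bool" where
  "cert_check P c \<longleftrightarrow>
    finite_order_check (fst (fst c)) (fst (snd (fst c))) (fst (snd (snd (fst c)))) (snd (snd (snd (fst c)))) \<and>
    iso_check P (torus_presentation (fst (fst c)) (lookup (fst (snd (fst c)))))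
      (fst (fst (snd c))) (snd (fst (snd c))) (fst (snd (snd c))) (snd (snd (snd c)))"

definition cert_index :: "iso_cert \<Rightarrow> nat" where
  "cert_index c = fst (snd (snd (fst c))) * 6 ^ Suc (fst (fst c))"

definition dec_word :: "nat \<Rightarrow> word" where
  "dec_word = dec_list dec_letter"

definition dec_presentation :: "nat \<Rightarrow> presentation" where
  "dec_presentation = dec_pair (\<lambda>n. n) (dec_list dec_word)"

text \<open>The search requires only that every certificate is the value of some number.\<close>

definition dec_cert :: "nat \<Rightarrow> iso_cert" where
  "dec_cert = dec_pair
     (dec_pair (\<lambda>n. n) (dec_pair (dec_list dec_word) (dec_pair (\<lambda>n. n) dec_word)))
     (dec_pair (dec_pair (dec_list dec_word) (dec_list dec_word))
       (dec_pair (dec_list (dec_list (dec_pair dec_word dec_word)))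
         (dec_list (dec_list (dec_pair dec_word dec_word)))))"

lemma dec_presentation_encode [simp]: "dec_presentation (encode_presentation P) = P"
proof -
  have "dec_word (encode_word w) = w" for w
    by (simp add: dec_word_def dec_list_def encode_word_def comp_def)
  then show ?thesis
    by (simp add: dec_presentation_def dec_pair_def dec_list_def encode_presentation_def encode_words_def comp_def)
qed

lemma surj_dec_cert: "surj dec_cert"
  unfolding dec_cert_def dec_word_def
  by (intro surj_dec_pair surj_dec_list surj_dec_letter) (auto simp: surj_def)

lemma computable_dec_cert: "computable dec_cert"
  unfolding dec_cert_def dec_word_def by (intro comp_intros)

lemma computable_dec_presentation: "computable dec_presentation"
  unfolding dec_presentation_def dec_word_def by (intro comp_intros)

lemma computable_derives [comp_intros]:
  assumes "computable f" "computable g"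
  shows "computable (\<lambda>x. derives (f x) (g x))"
  unfolding derives_def by (intro comp_intros assms)

lemma computable_iso_check [comp_intros]:
  assumes "computable P" "computable T" "computable u" "computable v" "computable D" "computable E"
  shows "computable (\<lambda>x. iso_check (P x) (T x) (u x) (v x) (D x) (E x))"
  unfolding iso_check_def
  by (intro comp_intros assms computable_comp[OF assms(1)] computable_comp[OF assms(2)] computable_comp[OF assms(3)]
      computable_comp[OF assms(4)] computable_comp[OF assms(5)] computable_comp[OF assms(6)])

lemma computable_finite_order_check [comp_intros]:
  assumes "computable m" "computable ph" "computable k" "computable r"
  shows "computable (\<lambda>x. finite_order_check (m x) (ph x) (k x) (r x))"
  unfolding finite_order_check_def
  by (intro comp_intros assms computable_comp[OF assms(1)] computable_comp[OF assms(2)] computable_comp[OF assms(3)]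
      computable_comp[OF assms(4)])

lemma computable_cert_check [comp_intros]:
  assumes "computable f" "computable g"
  shows "computable (\<lambda>x. cert_check (f x) (g x))"
  unfolding cert_check_def by (intro comp_intros assms)

lemma computable_cert_index [comp_intros]: "computable f \<Longrightarrow> computable (\<lambda>x. cert_index (f x))"
  unfolding cert_index_def by (intro comp_intros)

lemma search_program:
  obtains p where "\<And>P. \<exists>c. cert_check P c \<Longrightarrow>
    \<exists>c. cert_check P c \<and> rec_eval p [encode_presentation P] (encode_words (kernel_gens P (cert_index c)))"
proof -
  have 1: "computable (\<lambda>z. cert_check (dec_presentation (fst z)) (dec_cert (snd z)))"
    by (intro comp_intros computable_comp[OF computable_dec_presentation] computable_comp[OF computable_dec_cert])
  \<comment> \<open>The letters are replaced by their numbers first, because only then does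
    \<open>enc\<close> produce the output format \<open>encode_words\<close>.\<close>
  have 2: "computable (\<lambda>z. map (map encode_letter)
      (kernel_gens (dec_presentation (fst z)) (cert_index (dec_cert (snd z)))))"
    by (intro comp_intros computable_comp[OF computable_dec_presentation] computable_comp[OF computable_dec_cert])
  obtain p where p: "\<And>x. \<exists>c. cert_check (dec_presentation x) (dec_cert c) \<Longrightarrow>
      rec_eval p [x] (enc (map (map encode_letter) (kernel_gens (dec_presentation x)
        (cert_index (dec_cert (LEAST c. cert_check (dec_presentation x) (dec_cert c)))))))"
    using computable_search[OF 1 2] by blast
  have enc: "enc (map (map encode_letter) ws) = encode_words ws" for ws
    by (simp add: enc_list_def enc_nat_def encode_words_def encode_word_def[abs_def] comp_def)
  show ?thesis
  proof (rule that[of p])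
    fix P assume "\<exists>c. cert_check P c"
    then have ex: "\<exists>c. cert_check P (dec_cert c)" using surj_dec_cert by (metis surjD)
    then have "cert_check P (dec_cert (LEAST c. cert_check P (dec_cert c)))" by (rule LeastI_ex)
    moreover have "rec_eval p [encode_presentation P]
        (encode_words (kernel_gens P (cert_index (dec_cert (LEAST c. cert_check P (dec_cert c))))))"
      using p[of "encode_presentation P"] ex by (simp add: enc)
    ultimately show "\<exists>c. cert_check P c \<and>
        rec_eval p [encode_presentation P] (encode_words (kernel_gens P (cert_index c)))" by blast
  qed
qed

section \<open>Soundness and completeness of certificates\<close>

lemma subst_reduce:
  assumes f: "\<And>i. i < n \<Longrightarrow> f i \<in> words m" and w: "w \<in> words n"
  shows "reduce (subst f w) = eval_word (free_group m) (\<lambda>i. reduce (f i)) w"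
    "reduce (subst f (reduce w)) = reduce (subst f w)"
proof -
  interpret F: group "free_group m" by (rule group_free_group)
  have e: "reduce (subst f w) = eval_word (free_group m) (\<lambda>i. reduce (f i)) w" if w: "w \<in> words n" for w
  proof -
    have "reduce (subst f w) = eval_word (free_group m) (\<lambda>i. [(i, False)]) (subst f w)"
      by (simp add: eval_word_free subst_in_words[OF w f])
    also have "\<dots> = eval_word (free_group m) (\<lambda>i. eval_word (free_group m) (\<lambda>i. [(i, False)]) (f i)) w"
      by (rule F.eval_word_subst[OF free_gen_closed f w])
    also have "\<dots> = eval_word (free_group m) (\<lambda>i. reduce (f i)) w"
      by (rule eval_word_cong[OF w]) (simp add: eval_word_free f)
    finally show ?thesis .
  qed
  show "reduce (subst f w) = eval_word (free_group m) (\<lambda>i. reduce (f i)) w" by (rule e[OF w])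
  have "(\<lambda>i. reduce (f i)) \<in> {..<n} \<rightarrow> carrier (free_group m)" using f by simp
  from F.eval_word_reduce[OF this w] show "reduce (subst f (reduce w)) = reduce (subst f w)"
    by (simp add: e w reduce_in_words)
qed

lemma funpow_subst_words:
  "(\<And>i. i < m \<Longrightarrow> f i \<in> words m) \<Longrightarrow> w \<in> words m \<Longrightarrow> (subst f ^^ k) w \<in> words m"
  by (induction k) (auto intro: subst_in_words)

lemma endo_eq_subst:
  assumes hom: "\<phi> \<in> hom (free_group m) (free_group m)"
    and f: "\<And>i. i < m \<Longrightarrow> f i \<in> words m" "\<And>i. i < m \<Longrightarrow> \<phi> [(i, False)] = reduce (f i)"
    and w: "w \<in> words m"
  shows "(\<phi> ^^ k) (reduce w) = reduce ((subst f ^^ k) w)"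
proof (induction k)
  case (Suc k)
  interpret F: group "free_group m" by (rule group_free_group)
  let ?v = "(subst f ^^ k) w"
  have v: "?v \<in> words m" using f(1) w by (rule funpow_subst_words)
  have "\<phi> (reduce ?v) = eval_word (free_group m) (\<lambda>i. \<phi> [(i, False)]) ?v"
    using F.hom_eval_word[OF hom group_free_group free_gen_closed v] eval_word_free[OF v] by simp
  also have "\<dots> = eval_word (free_group m) (\<lambda>i. reduce (f i)) ?v"
    by (rule eval_word_cong[OF v]) (simp add: f)
  also have "\<dots> = reduce (subst f ?v)" using subst_reduce(1)[OF f(1) v] by simp
  finally show ?case using Suc by simp
qed simp

lemma finite_order_check_free_by_cyclic:
  assumes c: "finite_order_check m ph k r"
  shows "\<exists>\<iota> \<tau> z. free_by_cyclic (presented_group (torus_presentation m (lookup ph))) m \<iota> \<tau> z (int k)"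
proof -
  let ?f = "lookup ph"
  interpret F: group "free_group m" by (rule group_free_group)
  have m: "1 \<le> m" "0 < k" and f: "\<And>i. i < m \<Longrightarrow> ?f i \<in> words m" and r: "r \<in> words m"
    "reduce (subst ?f r) = reduce r"
    and inner: "\<And>i. i < m \<Longrightarrow> reduce ((subst ?f ^^ k) [(i, False)]) = reduce (r @ [(i, False)] @ inv_word r)"
    using c by (auto simp: finite_order_check_def)
  define \<phi> where "\<phi> = (\<lambda>w\<in>carrier (free_group m). reduce (subst ?f w))"
  have a: "(\<lambda>i. reduce (?f i)) \<in> {..<m} \<rightarrow> carrier (free_group m)" using f by simp
  have phi_eval: "\<phi> w = eval_word (free_group m) (\<lambda>i. reduce (?f i)) w" if "w \<in> carrier (free_group m)" for w
    using that subst_reduce(1)[of m ?f m w] f by (simp add: \<phi>_def carrier_free_group)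
  have hom: "\<phi> \<in> hom (free_group m) (free_group m)"
    using F.eval_word_hom[OF a] F.m_closed by (auto simp: hom_def phi_eval simp del: free_group_simps)
  have gen: "\<phi> [(i, False)] = reduce (?f i)" if "i < m" for i
    using that by (simp add: \<phi>_def carrier_free_group)
  have pow: "(\<phi> ^^ n) (reduce w) = reduce ((subst ?f ^^ n) w)" if "w \<in> words m" for w n
    by (rule endo_eq_subst[OF hom f gen that])
  have conj: "(\<phi> ^^ k) w = reduce r \<otimes>\<^bsub>free_group m\<^esub> w \<otimes>\<^bsub>free_group m\<^esub> inv\<^bsub>free_group m\<^esub> reduce r"
    if w: "w \<in> carrier (free_group m)" for w
  proof -
    have rc: "reduce r \<in> carrier (free_group m)" using r by simp
    have ww: "w \<in> words m" "reduce w = w" using w by (auto simp: carrier_free_group reduce_reduced)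
    let ?c = "inner_aut (free_group m) (reduce r)"
    have hc: "?c \<in> hom (free_group m) (free_group m)"
      using F.inner_aut_in_auto[OF rc] F.autE(1) by blast
    have hp: "\<phi> ^^ k \<in> hom (free_group m) (free_group m)" by (rule F.funpow_hom[OF hom])
    have inv_r: "inv\<^bsub>free_group m\<^esub> reduce r = reduce (inv_word r)"
    proof (rule F.inv_equality)
      show "reduce (inv_word r) \<otimes>\<^bsub>free_group m\<^esub> reduce r = \<one>\<^bsub>free_group m\<^esub>"
        by (simp add: reduce_append_left reduce_append_right reduce_inv_word)
    qed (use r in auto)
    have "(\<phi> ^^ k) w = eval_word (free_group m) (\<lambda>i. (\<phi> ^^ k) [(i, False)]) w"
      using F.hom_eval_word[OF hp group_free_group free_gen_closed ww(1)] eval_word_free[OF ww(1)] ww(2) by simp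
    also have "\<dots> = eval_word (free_group m) (\<lambda>i. ?c [(i, False)]) w"
    proof (rule eval_word_cong[OF ww(1)])
      fix i assume i: "i < m"
      have "(\<phi> ^^ k) [(i, False)] = reduce (r @ [(i, False)] @ inv_word r)"
        using pow[of "[(i, False)]" k] i inner[OF i] by simp
      then show "(\<phi> ^^ k) [(i, False)] = ?c [(i, False)]"
        using i by (simp add: inner_aut_def carrier_free_group inv_r reduce_append_left reduce_append_right)
    qed
    also have "\<dots> = ?c w"
      using F.hom_eval_word[OF hc group_free_group free_gen_closed ww(1)] eval_word_free[OF ww(1)] ww(2) by simp
    finally show ?thesis using w by (simp add: inner_aut_def)
  qed
  have rc: "reduce r \<in> carrier (free_group m)" using r by simp
  have closed: "\<phi> w \<in> carrier (free_group m)" if "w \<in> carrier (free_group m)" for w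
    by (rule hom_in_carrier[OF hom that])
  \<comment> \<open>\<open>\<phi>^k\<close> is a conjugation, hence bijective. Splitting off the
    innermost factor gives injectivity of \<open>\<phi>\<close>, splitting off the outermost one
    gives surjectivity.\<close>
  have "bij_betw \<phi> (carrier (free_group m)) (carrier (free_group m))"
    unfolding bij_betw_def
  proof
    show "inj_on \<phi> (carrier (free_group m))"
    proof (rule inj_onI)
      fix x y assume xy: "x \<in> carrier (free_group m)" "y \<in> carrier (free_group m)" "\<phi> x = \<phi> y"
      have "(\<phi> ^^ k) x = (\<phi> ^^ k) y"
      proof -
        have "(\<phi> ^^ Suc (k - 1)) x = (\<phi> ^^ Suc (k - 1)) y"
          unfolding funpow_Suc_right o_apply xy(3) ..
        then show ?thesis using m(2) by (simp del: funpow.simps)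
      qed
      then show "x = y"
        using xy(1,2) rc unfolding conj[OF xy(1)] conj[OF xy(2)] by (simp del: free_group_simps)
    qed
    show "\<phi> ` carrier (free_group m) = carrier (free_group m)"
    proof (intro equalityI subsetI)
      fix y assume y: "y \<in> carrier (free_group m)"
      let ?x = "inv\<^bsub>free_group m\<^esub> reduce r \<otimes>\<^bsub>free_group m\<^esub> y \<otimes>\<^bsub>free_group m\<^esub> reduce r"
      have x: "?x \<in> carrier (free_group m)" using y rc by (simp del: free_group_simps)
      have "(\<phi> ^^ k) ?x = y"
        unfolding conj[OF x] using y rc by (simp add: F.m_assoc F.inv_cancel del: free_group_simps)
      moreover have "(\<phi> ^^ Suc (k - 1)) ?x = \<phi> ((\<phi> ^^ (k - 1)) ?x)" by simp
      ultimately have e: "\<phi> ((\<phi> ^^ (k - 1)) ?x) = y" using m(2) by (simp del: funpow.simps free_group_simps)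
      show "y \<in> \<phi> ` carrier (free_group m)"
        using imageI[OF F.funpow_hom_closed[OF hom x, of "k - 1"], of \<phi>] unfolding e .
    qed (use closed in auto)
  qed
  then have aut: "\<phi> \<in> auto (free_group m)"
    using hom by (simp add: auto_def Bij_def \<phi>_def)
  have "\<phi> (reduce r) = reduce r"
    using pow[OF r(1), of 1] r(2) by simp
  moreover have "(\<phi> ^^ k) w = reduce (reduce r @ w @ inv_word (reduce r))" if "w \<in> carrier (free_group m)" for w
    unfolding conj[OF that] by (simp add: inv_free_group[OF rc] reduce_append_left reduce_append_right)
  ultimately show ?thesis
    using torus_free_by_cyclic[OF m(1) aut f gen m(2) rc] by blast
qed

lemma derives_trivial:
  assumes P: "P \<in> presentations" and D: "\<forall>d\<in>set D. derivation P d" and w: "w \<in> words (fst P)" "derives D w"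
  shows "word_elem P w = \<one>\<^bsub>presented_group P\<^esub>"
proof -
  obtain d where "d \<in> set D" "reduce w = reduce (derived_word d)" using w(2) by (auto simp: derives_def)
  then show ?thesis using D word_elem_eq_one_iff_derivation[OF P w(1)] by metis
qed

lemma derivations_exist:
  assumes P: "P \<in> presentations"
    and ws: "\<And>w. w \<in> set ws \<Longrightarrow> w \<in> words (fst P) \<and> word_elem P w = \<one>\<^bsub>presented_group P\<^esub>"
  obtains D where "\<forall>d\<in>set D. derivation P d" "\<forall>w\<in>set ws. derives D w"
proof -
  have "\<exists>d. derivation P d \<and> reduce (derived_word d) = reduce w" if "w \<in> set ws" for w
    using ws[OF that] word_elem_eq_one_iff_derivation[OF P] by blast
  then obtain d where "\<And>w. w \<in> set ws \<Longrightarrow> derivation P (d w) \<and> reduce (derived_word (d w)) = reduce w"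
    by metis
  then show ?thesis by (intro that[of "map d ws"]) (auto simp: derives_def image_iff)
qed

lemma subst_cong: "w \<in> words n \<Longrightarrow> (\<And>i. i < n \<Longrightarrow> f i = g i) \<Longrightarrow> subst f w = subst g w"
  by (induction w) (auto simp: subst_def)

lemma lookup_map: "i < n \<Longrightarrow> lookup (map f [0..<n]) i = f i"
  by (simp add: lookup_def)

lemma iso_check_iff:
  assumes P: "P \<in> presentations" and T: "T \<in> presentations"
  shows "(\<exists>u v D E. iso_check P T u v D E) \<longleftrightarrow> presented_group P \<cong> presented_group T"
proof
  assume "\<exists>u v D E. iso_check P T u v D E"
  then obtain u v D E where c: "iso_check P T u v D E" by blast
  have u: "\<And>i. i < fst P \<Longrightarrow> lookup u i \<in> words (fst T)" and v: "\<And>i. i < fst T \<Longrightarrow> lookup v i \<in> words (fst P)"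
    and D: "\<forall>d\<in>set D. derivation P d" and E: "\<forall>d\<in>set E. derivation T d"
    using c by (auto simp: iso_check_def)
  note trivial = derives_trivial[OF P D] derives_trivial[OF T E]
  have rels: "\<And>r. r \<in> set (snd P) \<Longrightarrow> r \<in> words (fst P)" "\<And>r. r \<in> set (snd T) \<Longrightarrow> r \<in> words (fst T)"
    using P T by (auto simp: presentations_def)
  show "presented_group P \<cong> presented_group T"
    unfolding presented_group_iso_iff[OF P T]
  proof (rule exI[of _ "lookup u"], rule exI[of _ "lookup v"], intro conjI allI impI ballI)
    show "word_elem T (subst (lookup u) r) = \<one>\<^bsub>presented_group T\<^esub>" if "r \<in> set (snd P)" for r
      using c that by (intro trivial subst_in_words[OF rels(1)] u) (auto simp: iso_check_def)
    show "word_elem P (subst (lookup v) r) = \<one>\<^bsub>presented_group P\<^esub>" if "r \<in> set (snd T)" for r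
      using c that by (intro trivial subst_in_words[OF rels(2)] v) (auto simp: iso_check_def)
    show "word_elem P (subst (lookup v) (lookup u i) @ [(i, True)]) = \<one>\<^bsub>presented_group P\<^esub>" if "i < fst P" for i
      using c that subst_in_words[OF u[OF that], of "lookup v" "fst P"] v
      by (intro trivial) (auto simp: iso_check_def)
    show "word_elem T (subst (lookup u) (lookup v i) @ [(i, True)]) = \<one>\<^bsub>presented_group T\<^esub>" if "i < fst T" for i
      using c that subst_in_words[OF v[OF that], of "lookup u" "fst T"] u
      by (intro trivial) (auto simp: iso_check_def)
  qed (use u v in auto)
next
  assume "presented_group P \<cong> presented_group T"
  then obtain f g where f: "\<And>i. i < fst P \<Longrightarrow> f i \<in> words (fst T)" and g: "\<And>i. i < fst T \<Longrightarrow> g i \<in> words (fst P)"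
    and 1: "\<And>r. r \<in> set (snd P) \<Longrightarrow> word_elem T (subst f r) = \<one>\<^bsub>presented_group T\<^esub>"
    and 2: "\<And>r. r \<in> set (snd T) \<Longrightarrow> word_elem P (subst g r) = \<one>\<^bsub>presented_group P\<^esub>"
    and 3: "\<And>i. i < fst P \<Longrightarrow> word_elem P (subst g (f i) @ [(i, True)]) = \<one>\<^bsub>presented_group P\<^esub>"
    and 4: "\<And>i. i < fst T \<Longrightarrow> word_elem T (subst f (g i) @ [(i, True)]) = \<one>\<^bsub>presented_group T\<^esub>"
    unfolding presented_group_iso_iff[OF P T] by blast
  let ?u = "map f [0..<fst P]" and ?v = "map g [0..<fst T]"
  have rels: "\<And>r. r \<in> set (snd P) \<Longrightarrow> r \<in> words (fst P)" "\<And>r. r \<in> set (snd T) \<Longrightarrow> r \<in> words (fst T)"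
    using P T by (auto simp: presentations_def)
  have fu: "subst (lookup ?u) w = subst f w" if "w \<in> words (fst P)" for w
    by (rule subst_cong[OF that]) (rule lookup_map)
  have gv: "subst (lookup ?v) w = subst g w" if "w \<in> words (fst T)" for w
    by (rule subst_cong[OF that]) (rule lookup_map)
  obtain D where D: "\<forall>d\<in>set D. derivation P d"
    "\<forall>w\<in>set (map (subst g) (snd T) @ map (\<lambda>i. subst g (f i) @ [(i, True)]) [0..<fst P]). derives D w"
  proof (rule derivations_exist[OF P])
    fix w assume "w \<in> set (map (subst g) (snd T) @ map (\<lambda>i. subst g (f i) @ [(i, True)]) [0..<fst P])"
    then show "w \<in> words (fst P) \<and> word_elem P w = \<one>\<^bsub>presented_group P\<^esub>"
      using 2 3 subst_in_words[OF rels(2) g] subst_in_words[OF f g] by auto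
  qed
  obtain E where E: "\<forall>d\<in>set E. derivation T d"
    "\<forall>w\<in>set (map (subst f) (snd P) @ map (\<lambda>i. subst f (g i) @ [(i, True)]) [0..<fst T]). derives E w"
  proof (rule derivations_exist[OF T])
    fix w assume "w \<in> set (map (subst f) (snd P) @ map (\<lambda>i. subst f (g i) @ [(i, True)]) [0..<fst T])"
    then show "w \<in> words (fst T) \<and> word_elem T w = \<one>\<^bsub>presented_group T\<^esub>"
      using 1 4 subst_in_words[OF rels(1) f] subst_in_words[OF g f] by auto
  qed
  have "iso_check P T ?u ?v D E"
    using D E f g rels by (auto simp: iso_check_def lookup_map fu gv)
  then show "\<exists>u v D E. iso_check P T u v D E" by blast
qed

lemma cert_exists:
  assumes P: "P \<in> presentations" and iso: "presented_group P \<cong> mapping_torus m \<phi>" and m: "m \<ge> 1"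
    and a: "\<phi> \<in> auto (free_group m)" and fin: "finite_order (Out (free_group m)) (out_class (free_group m) \<phi>)"
  shows "\<exists>c. cert_check P c"
proof -
  interpret F: group "free_group m" by (rule group_free_group)
  have hom: "\<phi> \<in> hom (free_group m) (free_group m)" by (rule F.autE(1)[OF a])
  let ?ph = "map (\<lambda>i. \<phi> [(i, False)]) [0..<m]"
  let ?T = "torus_presentation m (lookup ?ph)"
  have img: "\<phi> [(i, False)] \<in> carrier (free_group m)" if "i < m" for i
    by (rule hom_in_carrier[OF hom]) (simp add: carrier_free_group that)
  have w: "lookup ?ph i \<in> words m" "\<phi> [(i, False)] = reduce (lookup ?ph i)" if "i < m" for i
    using img[OF that] by (auto simp: lookup_map that carrier_free_group reduce_reduced)
  obtain k r where k: "k > (0::nat)" and r: "r \<in> carrier (free_group m)" "\<phi> r = r"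
    and inner: "\<And>f. f \<in> carrier (free_group m) \<Longrightarrow> (\<phi> ^^ k) f = reduce (r @ f @ inv_word r)"
    using finite_order_fixed_conjugator[OF a fin] by blast
  have rw: "r \<in> words m" "reduce r = r" using r(1) by (auto simp: carrier_free_group reduce_reduced)
  note endo = endo_eq_subst[OF hom w]
  have "finite_order_check m ?ph k r"
    unfolding finite_order_check_def
  proof (intro conjI allI impI)
    show "reduce (subst (lookup ?ph) r) = reduce r"
      using endo[of r 1] rw r(2) by simp
    fix i assume i: "i < m"
    then show "reduce ((subst (lookup ?ph) ^^ k) [(i, False)]) = reduce (r @ [(i, False)] @ inv_word r)"
      using endo[of "[(i, False)]" k] inner[of "[(i, False)]"] by (simp add: carrier_free_group)
  qed (use m k w rw in auto)
  moreover have "mapping_torus m \<phi> = presented_group ?T"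
  proof -
    have "map (\<lambda>i. [(m, True), (i, False), (m, False)] @ inv_word (\<phi> [(i, False)])) [0..<m] =
        map (\<lambda>i. [(m, True), (i, False), (m, False)] @ inv_word (lookup ?ph i)) [0..<m]"
      by (rule map_cong) (auto simp: lookup_map)
    then show ?thesis unfolding mapping_torus_def torus_presentation_def by (simp only:)
  qed
  then obtain u v D E where "iso_check P ?T u v D E"
    using iso iso_check_iff[OF P torus_presentation_presentations, of m "lookup ?ph"] w(1) by auto
  ultimately have "cert_check P ((m, ?ph, k, r), (u, v), (D, E))"
    by (simp add: cert_check_def)
  then show ?thesis by blast
qed

text \<open>The certificate found by the search may exhibit a mapping torus other than the one known
  to exist, with different \<open>m\<close> and \<open>k\<close>. Correctness is therefore shown for
  every valid certificate, in the locale transported along the isomorphism that it encodes.\<close>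

lemma cert_check_separates:
  assumes P: "P \<in> presentations" and c: "cert_check P c"
  shows "cert_index c > 0"
    "congruence_separates_torsion (presented_group P) (action_kernel (presented_group P) (cert_index c))"
proof -
  obtain m ph k r u v D E where c_eq: "c = ((m, ph, k, r), (u, v), (D, E))" by (metis surj_pair)
  let ?T = "torus_presentation m (lookup ph)"
  have foc: "finite_order_check m ph k r" and ic: "iso_check P ?T u v D E"
    using c by (auto simp: cert_check_def c_eq)
  have mk: "1 \<le> m" "1 \<le> k" "\<And>i. i < m \<Longrightarrow> lookup ph i \<in> words m"
    using foc by (auto simp: finite_order_check_def)
  have T: "?T \<in> presentations" using mk(3) by (rule torus_presentation_presentations)
  have N: "cert_index c = k * 6 ^ Suc m" by (simp add: cert_index_def c_eq)
  then show pos: "cert_index c > 0" using mk by simp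
  interpret G: group "presented_group P" by (rule group_presented_group[OF P])
  have "presented_group ?T \<cong> presented_group P"
    using iso_check_iff[OF P T] ic by (intro G.iso_sym) blast
  then obtain h where h: "h \<in> iso (presented_group ?T) (presented_group P)" by (auto simp: is_iso_def)
  obtain \<iota> \<tau> z where "free_by_cyclic (presented_group ?T) m \<iota> \<tau> z (int k)"
    using finite_order_check_free_by_cyclic[OF foc] by blast
  from free_by_cyclic_iso[OF this h G.is_group] obtain \<iota> \<tau> z
    where "free_by_cyclic (presented_group P) m \<iota> \<tau> z (int k)" by blast
  then interpret free_by_cyclic "presented_group P" m \<iota> \<tau> z "int k" .
  \<comment> \<open>By the choice of \<open>cert_index\<close> the congruence subgroup is one of the
    subgroups contained in the intersection's range, so triviality modulo the kernel implies
    triviality modulo it.\<close>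
  have le: "action_kernel (presented_group P) (cert_index c) \<subseteq> congruence_subgroup"
    by (rule G.action_kernel_le[OF congruence_subgroup_subgroup card_rcosets_congruence_subgroup(1)])
      (use card_rcosets_congruence_subgroup(2) in \<open>simp add: N\<close>)
  show "congruence_separates_torsion (presented_group P) (action_kernel (presented_group P) (cert_index c))"
  proof (rule G.congruence_separates_torsionI)
    show "characteristic (action_kernel (presented_group P) (cert_index c)) (presented_group P)"
      by (rule G.characteristic_action_kernel)
    show "finite (rcosets\<^bsub>presented_group P\<^esub> action_kernel (presented_group P) (cert_index c))"
      by (rule card_rcosets_action_kernel(1)[OF P pos])
  qed (rule inner_if_congruent; use le in blast)
qed

theorem theorem2p1:
  shows "congruences_effectively_separating_torsion
    {mapping_torus m \<phi> | m \<phi>.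
      m \<ge> 1 \<and> \<phi> \<in> auto (free_group m) \<and>
      finite_order (Out (free_group m)) (out_class (free_group m) \<phi>)}"
proof -
  obtain p where p: "\<And>P. \<exists>c. cert_check P c \<Longrightarrow>
    \<exists>c. cert_check P c \<and> rec_eval p [encode_presentation P] (encode_words (kernel_gens P (cert_index c)))"
    using search_program by blast
  show ?thesis
    unfolding congruences_effectively_separating_torsion_def
  proof (intro exI[of _ p] ballI impI)
    fix P assume P: "P \<in> presentations"
      and "\<exists>G\<in>{mapping_torus m \<phi> | m \<phi>. m \<ge> 1 \<and> \<phi> \<in> auto (free_group m) \<and>
        finite_order (Out (free_group m)) (out_class (free_group m) \<phi>)}. presented_group P \<cong> G"
    then have "\<exists>c. cert_check P c" using cert_exists[OF P] by blast
    then obtain c where c: "cert_check P c"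
      "rec_eval p [encode_presentation P] (encode_words (kernel_gens P (cert_index c)))"
      using p by blast
    note sep = cert_check_separates[OF P c(1)]
    show "\<exists>ws. set ws \<subseteq> words (fst P) \<and> rec_eval p [encode_presentation P] (encode_words ws) \<and>
        congruence_separates_torsion (presented_group P) (generate (presented_group P) (word_elem P ` set ws))"
    proof (intro exI[of _ "kernel_gens P (cert_index c)"] conjI)
      show "set (kernel_gens P (cert_index c)) \<subseteq> words (fst P)" by (rule set_kernel_gens[OF P sep(1)])
      show "congruence_separates_torsion (presented_group P)
          (generate (presented_group P) (word_elem P ` set (kernel_gens P (cert_index c))))"
        unfolding generate_kernel_gens[OF P sep(1)] by (rule sep(2))
    qed (rule c(2))
  qed
qed

end
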